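(* Let $E$ be a row-finite graph with no sinks and let $F$ be a graph which is primitively equivalent to $E$. Then $\mathcal{G}_E\cong\mathcal{G}_F$ (as topological groupoids), and hence $C^*(E)\cong C^*(F)$.
   Context: Graphs. A directed graph $E$ consists of a vertex set $E^0$, an edge set $E^1$ and source and range maps $s,r:E^1\to E^0$. Throughout, "graph" means a countable directed graph without multiple edges (at most one edge from $v$ to $w$ for each ordered pair $(v,w)$; loops allowed) which is connected (any two vertices are joined by an undirected path). $E$ is row-finite if every vertex is the source of only finitely many edges; a sink is a vertex which is the source of no edge. The vertex matrix $B_E$ is the $E^0\times E^0$ matrix with $B_E(v,w)=\#\{e\in E^1: s(e)=v,\ r(e)=w\}$. Primitive transfer. Let $B$ be a (possibly infinite) square 0-1 matrix; write $B_p$ for its $p$-th row and $E_i$ for the row with a $1$ in position $i$ and $0$ elsewhere. Suppose $B_p$ is a nonzero row and $B_p=E_{k_1}+\cdots+E_{k_r}+B_{m_1}+\cdots+B_{m_s}$ for some distinct indices $k_1,\dots,k_r,m_1,\dots,m_s$ (all $r+s$ of them pairwise distinct) with $p\notin\{m_1,\dots,m_s\}$ and no $B_{m_i}$ a zero row. Let $C$ be the matrix which agrees with $B$ outside row $p$, and with $C_{pj}=1$ if $j\in\{k_1,\dots,k_r,m_1,\dots,m_s\}$ and $C_{pj}=0$ otherwise. Then $C$ is called a primitive transfer of $B$ (at $p$). Primitive equivalence. Two square 0-1 matrices $B,C$ of the same (possibly infinite) size are primitively equivalent if there are matrices $D_1=B,D_2,\dots,D_q=C$ such that for each $1\le i\le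 q-1$: $D_i$ is a primitive transfer of $D_{i+1}$, or $D_{i+1}$ is a primitive transfer of $D_i$, or $D_i=PD_{i+1}P^{-1}$ for a permutation matrix $P$. Two graphs are primitively equivalent if their vertex matrices are. Path groupoid. $E^*$ denotes the set of finite paths (including vertices as paths of length $0$), $E^\infty$ the set of infinite paths $x=x_1x_2\cdots$; $|\alpha|$ is the length of $\alpha\in E^*$. For $x,y\in E^\infty$, $k\in\mathbf{Z}$, write $x\sim_k y$ if $x_i=y_{i-k}$ for all large $i$. Then $\mathcal{G}_E=\{(x,k,y):x\sim_k y\}$ with $(x,k,y)^{-1}=(y,-k,x)$ and $(x,k,y)(y,l,z)=(x,k+l,z)$, with the topology generated by the sets $Z(\alpha,\beta)=\{(\alpha x,|\alpha|-|\beta|,\beta x): x\in E^\infty,\ s(x)=r(\alpha)\}$ for $\alpha,\beta\in E^*$ with $r(\alpha)=r(\beta)$. Graph algebra. For a row-finite graph $E$, a Cuntz-Krieger $E$-family consists of mutually orthogonal projections $\{P_v: v\in E^0\}$ and partial isometries $\{S_e:e\in E^1\}$ with $S_e^*S_e=P_{r(e)}$ for all $e$, and $P_v=\sum_{s(e)=v}S_eS_e^*$ for every $v\in s(E^1)$. $C^*(E)$ is the universal $C^*$-algebra generated by a Cuntz-Krieger $E$-family. (If $E$ has no sinks, $C^*(E)$ coincides with the groupoid $C^*$-algebra $C^*(\mathcal{G}_E)$.) *)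

theory Defs
  imports "HOL-Analysis.Analysis" "HOL-Algebra.Ring" "HOL-Library.Omega_Words_Fun"
    "Graph_Theory.Graph_Theory"
begin

section \<open>Graphs\<close>

text \<open>Source and range of an edge are \<^const>\<open>tail\<close> and \<^const>\<open>head\<close>. The library's notion of
  connectedness (any two vertices are joined by an undirected path) includes that there is at
  least one vertex.\<close>

definition directed_graph :: "('v, 'e) pre_digraph \<Rightarrow> bool" where
  "directed_graph G \<longleftrightarrow> nomulti_digraph G \<and> countable (verts G) \<and> countable (arcs G)
     \<and> Digraph_Component.connected G"

definition row_finite :: "('v, 'e) pre_digraph \<Rightarrow> bool" where
  "row_finite G \<longleftrightarrow> (\<forall>v \<in> verts G. finite (out_arcs G v))"

definition no_sinks :: "('v, 'e) pre_digraph \<Rightarrow> bool" where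
  "no_sinks G \<longleftrightarrow> (\<forall>v \<in> verts G. out_arcs G v \<noteq> {})"

definition vertex_matrix :: "('v, 'e) pre_digraph \<Rightarrow> 'v \<Rightarrow> 'v \<Rightarrow> nat" where
  "vertex_matrix G v w = card {e \<in> arcs G. tail G e = v \<and> head G e = w}"

section \<open>Primitive equivalence\<close>

text \<open>A \<open>V \<times> V\<close> matrix is a function \<^typ>\<open>'v \<Rightarrow> 'v \<Rightarrow> nat\<close>, of which only the values at
  indices in \<open>V\<close> matter.\<close>

definition zero_one_matrix :: "'v set \<Rightarrow> ('v \<Rightarrow> 'v \<Rightarrow> nat) \<Rightarrow> bool" where
  "zero_one_matrix V B \<longleftrightarrow> (\<forall>i \<in> V. \<forall>j \<in> V. B i j \<in> {0, 1})"

definition zero_row :: "'v set \<Rightarrow> ('v \<Rightarrow> 'v \<Rightarrow> nat) \<Rightarrow> 'v \<Rightarrow> bool" where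
  "zero_row V B i \<longleftrightarrow> (\<forall>j \<in> V. B i j = 0)"

text \<open>\<open>primitive_transfer V B C\<close>: \<open>C\<close> is a primitive transfer of \<open>B\<close>. Here \<open>K\<close> and \<open>M\<close> are the
  sets of the indices \<open>k\<^sub>1, \<dots>, k\<^sub>r\<close> and \<open>m\<^sub>1, \<dots>, m\<^sub>s\<close>.\<close>

definition primitive_transfer_at ::
  "'v set \<Rightarrow> 'v \<Rightarrow> ('v \<Rightarrow> 'v \<Rightarrow> nat) \<Rightarrow> ('v \<Rightarrow> 'v \<Rightarrow> nat) \<Rightarrow> bool" where
  "primitive_transfer_at V p B C \<longleftrightarrow>
     p \<in> V \<and> zero_one_matrix V B \<and> \<not> zero_row V B p \<and>
     (\<exists>K M. finite K \<and> K \<subseteq> V \<and> finite M \<and> M \<subseteq> V \<and> K \<inter> M = {} \<and> p \<notin> M \<and>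
        (\<forall>m \<in> M. \<not> zero_row V B m) \<and>
        (\<forall>j \<in> V. B p j = (\<Sum>k\<in>K. if j = k then 1 else 0) + (\<Sum>m\<in>M. B m j)) \<and>
        (\<forall>i \<in> V - {p}. \<forall>j \<in> V. C i j = B i j) \<and>
        (\<forall>j \<in> V. C p j = (if j \<in> K \<union> M then 1 else 0)))"

definition primitive_transfer ::
  "'v set \<Rightarrow> ('v \<Rightarrow> 'v \<Rightarrow> nat) \<Rightarrow> ('v \<Rightarrow> 'v \<Rightarrow> nat) \<Rightarrow> bool" where
  "primitive_transfer V B C \<longleftrightarrow> (\<exists>p. primitive_transfer_at V p B C)"

text \<open>\<open>B = P C P\<^sup>-\<^sup>1\<close>, where \<open>P\<close> is the permutation matrix with entries \<open>1\<close> at \<open>(i, \<pi> i)\<close>. The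
  identity permutation identifies matrices that agree on \<open>V \<times> V\<close>.\<close>

definition permutation_conjugate ::
  "'v set \<Rightarrow> ('v \<Rightarrow> 'v \<Rightarrow> nat) \<Rightarrow> ('v \<Rightarrow> 'v \<Rightarrow> nat) \<Rightarrow> bool" where
  "permutation_conjugate V B C \<longleftrightarrow>
     (\<exists>\<pi>. bij_betw \<pi> V V \<and> (\<forall>i \<in> V. \<forall>j \<in> V. B i j = C (\<pi> i) (\<pi> j)))"

definition primitive_step ::
  "'v set \<Rightarrow> ('v \<Rightarrow> 'v \<Rightarrow> nat) \<Rightarrow> ('v \<Rightarrow> 'v \<Rightarrow> nat) \<Rightarrow> bool" where
  "primitive_step V D D' \<longleftrightarrow>
     primitive_transfer V D' D \<or> primitive_transfer V D D' \<or> permutation_conjugate V D D'"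

definition primitively_equivalent_matrices ::
  "'v set \<Rightarrow> ('v \<Rightarrow> 'v \<Rightarrow> nat) \<Rightarrow> ('v \<Rightarrow> 'v \<Rightarrow> nat) \<Rightarrow> bool" where
  "primitively_equivalent_matrices V B C \<longleftrightarrow>
     zero_one_matrix V B \<and> zero_one_matrix V C \<and> (primitive_step V)\<^sup>*\<^sup>* B C"

text \<open>The vertex matrices of two graphs have different index sets. That they have the same size
  means that the vertex sets can be identified by a bijection \<open>h\<close>; as conjugation by permutation
  matrices is allowed, it does not matter which bijection is used.\<close>

definition primitively_equivalent ::
  "('v, 'e) pre_digraph \<Rightarrow> ('w, 'f) pre_digraph \<Rightarrow> bool" where
  "primitively_equivalent E F \<longleftrightarrow>
     (\<exists>h. bij_betw h (verts E) (verts F) \<and>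
        primitively_equivalent_matrices (verts E) (vertex_matrix E)
          (\<lambda>v w. vertex_matrix F (h v) (h w)))"

section \<open>Topological groupoids and the path groupoid\<close>

record 'g top_groupoid =
  arrows :: "'g set"
  composable :: "('g \<times> 'g) set"
  gcomp :: "'g \<Rightarrow> 'g \<Rightarrow> 'g"
  ginv :: "'g \<Rightarrow> 'g"
  gtop :: "'g topology"

definition top_groupoid_iso :: "('g \<Rightarrow> 'h) \<Rightarrow> 'g top_groupoid \<Rightarrow> 'h top_groupoid \<Rightarrow> bool" where
  "top_groupoid_iso f G H \<longleftrightarrow>
     bij_betw f (arrows G) (arrows H) \<and>
     (\<forall>a \<in> arrows G. \<forall>b \<in> arrows G. (a, b) \<in> composable G \<longleftrightarrow> (f a, f b) \<in> composable H) \<and>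
     (\<forall>a \<in> arrows G. \<forall>b \<in> arrows G.
        (a, b) \<in> composable G \<longrightarrow> f (gcomp G a b) = gcomp H (f a) (f b)) \<and>
     (\<forall>a \<in> arrows G. f (ginv G a) = ginv H (f a)) \<and>
     homeomorphic_map (gtop G) (gtop H) f"

definition top_groupoid_isomorphic :: "'g top_groupoid \<Rightarrow> 'h top_groupoid \<Rightarrow> bool" where
  "top_groupoid_isomorphic G H \<longleftrightarrow> (\<exists>f. top_groupoid_iso f G H)"

definition infinite_paths :: "('v, 'e) pre_digraph \<Rightarrow> 'e word set" where
  "infinite_paths G = {x. \<forall>n. x n \<in> arcs G \<and> head G (x n) = tail G (x (Suc n))}"

text \<open>\<open>x \<sim>\<^sub>k y\<close>. For large \<open>i\<close> the integer \<open>i - k\<close> is nonnegative, so the truncation by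
  \<^const>\<open>nat\<close> is harmless; numbering the edges of a path from 0 rather than from 1 does not change
  the relation.\<close>

definition shift_tail_equiv :: "'e word \<Rightarrow> int \<Rightarrow> 'e word \<Rightarrow> bool" where
  "shift_tail_equiv x k y \<longleftrightarrow> (\<forall>\<^sub>F i in sequentially. x i = y (nat (int i - k)))"

text \<open>\<open>Z(\<alpha>,\<beta>)\<close> for finite paths \<open>\<alpha>\<close>, \<open>\<beta>\<close> with edge lists \<open>p\<close>, \<open>q\<close> and common range \<open>v\<close>. A path
  of length 0 has the empty edge list, so its range cannot be recovered from the list.\<close>

definition cylinder ::
  "('v, 'e) pre_digraph \<Rightarrow> 'e list \<Rightarrow> 'e list \<Rightarrow> 'v \<Rightarrow> ('e word \<times> int \<times> 'e word) set" where
  "cylinder G p q v =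
     {(p \<frown> x, int (length p) - int (length q), q \<frown> x) | x. x \<in> infinite_paths G \<and> tail G (x 0) = v}"

definition path_groupoid ::
  "('v, 'e) pre_digraph \<Rightarrow> ('e word \<times> int \<times> 'e word) top_groupoid" where
  "path_groupoid G = \<lparr>
     arrows = {(x, k, y). x \<in> infinite_paths G \<and> y \<in> infinite_paths G \<and> shift_tail_equiv x k y},
     composable = {((x, k, y), (y', l, z)) | x k y y' l z. y = y'},
     gcomp = (\<lambda>(x, k, y) (y', l, z). (x, k + l, z)),
     ginv = (\<lambda>(x, k, y). (y, - k, x)),
     gtop = topology_generated_by
       {cylinder G p q v | u w p q v. pre_digraph.awalk G u p v \<and> pre_digraph.awalk G w q v} \<rparr>"

section \<open>C*-algebras\<close>

text \<open>C*-algebras need not be unital; the field \<^const>\<open>one\<close> inherited from the record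
  \<^typ>\<open>'a ring\<close> carries no meaning and is ignored by all notions below.\<close>

record 'a cstar = "'a ring" +
  scale :: "complex \<Rightarrow> 'a \<Rightarrow> 'a"
  star :: "'a \<Rightarrow> 'a"
  nrm :: "'a \<Rightarrow> real"

locale cstar_algebra = abelian_group A for A :: "'a cstar" (structure) +
  assumes mult_closed: "\<lbrakk>x \<in> carrier A; y \<in> carrier A\<rbrakk> \<Longrightarrow> x \<otimes> y \<in> carrier A"
    and mult_assoc: "\<lbrakk>x \<in> carrier A; y \<in> carrier A; z \<in> carrier A\<rbrakk> \<Longrightarrow>
      (x \<otimes> y) \<otimes> z = x \<otimes> (y \<otimes> z)"
    and distrib_left: "\<lbrakk>x \<in> carrier A; y \<in> carrier A; z \<in> carrier A\<rbrakk> \<Longrightarrow>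
      x \<otimes> (y \<oplus> z) = (x \<otimes> y) \<oplus> (x \<otimes> z)"
    and distrib_right: "\<lbrakk>x \<in> carrier A; y \<in> carrier A; z \<in> carrier A\<rbrakk> \<Longrightarrow>
      (x \<oplus> y) \<otimes> z = (x \<otimes> z) \<oplus> (y \<otimes> z)"
    and scale_closed: "x \<in> carrier A \<Longrightarrow> scale A c x \<in> carrier A"
    and scale_add_right: "\<lbrakk>x \<in> carrier A; y \<in> carrier A\<rbrakk> \<Longrightarrow>
      scale A c (x \<oplus> y) = scale A c x \<oplus> scale A c y"
    and scale_add_left: "x \<in> carrier A \<Longrightarrow> scale A (c + d) x = scale A c x \<oplus> scale A d x"
    and scale_scale: "x \<in> carrier A \<Longrightarrow> scale A c (scale A d x) = scale A (c * d) x"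
    and scale_one: "x \<in> carrier A \<Longrightarrow> scale A 1 x = x"
    and scale_mult_left: "\<lbrakk>x \<in> carrier A; y \<in> carrier A\<rbrakk> \<Longrightarrow>
      scale A c x \<otimes> y = scale A c (x \<otimes> y)"
    and scale_mult_right: "\<lbrakk>x \<in> carrier A; y \<in> carrier A\<rbrakk> \<Longrightarrow>
      x \<otimes> scale A c y = scale A c (x \<otimes> y)"
    and star_closed: "x \<in> carrier A \<Longrightarrow> star A x \<in> carrier A"
    and star_star: "x \<in> carrier A \<Longrightarrow> star A (star A x) = x"
    and star_add: "\<lbrakk>x \<in> carrier A; y \<in> carrier A\<rbrakk> \<Longrightarrow> star A (x \<oplus> y) = star A x \<oplus> star A y"
    and star_mult: "\<lbrakk>x \<in> carrier A; y \<in> carrier A\<rbrakk> \<Longrightarrow> star A (x \<otimes> y) = star A y \<otimes> star A x"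
    and star_scale: "x \<in> carrier A \<Longrightarrow> star A (scale A c x) = scale A (cnj c) (star A x)"
    and nrm_nonneg: "x \<in> carrier A \<Longrightarrow> 0 \<le> nrm A x"
    and nrm_eq_0: "x \<in> carrier A \<Longrightarrow> nrm A x = 0 \<longleftrightarrow> x = \<zero>"
    and nrm_triangle: "\<lbrakk>x \<in> carrier A; y \<in> carrier A\<rbrakk> \<Longrightarrow> nrm A (x \<oplus> y) \<le> nrm A x + nrm A y"
    and nrm_scale: "x \<in> carrier A \<Longrightarrow> nrm A (scale A c x) = cmod c * nrm A x"
    and nrm_mult: "\<lbrakk>x \<in> carrier A; y \<in> carrier A\<rbrakk> \<Longrightarrow> nrm A (x \<otimes> y) \<le> nrm A x * nrm A y"
    and cstar_identity: "x \<in> carrier A \<Longrightarrow> nrm A (star A x \<otimes> x) = (nrm A x)\<^sup>2"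
    and complete: "\<lbrakk>\<And>n. \<sigma> n \<in> carrier A;
        \<forall>\<epsilon>>0. \<exists>N. \<forall>m\<ge>N. \<forall>n\<ge>N. nrm A (\<sigma> m \<ominus> \<sigma> n) < \<epsilon>\<rbrakk> \<Longrightarrow>
      \<exists>x \<in> carrier A. (\<lambda>n::nat. nrm A (\<sigma> n \<ominus> x)) \<longlonglongrightarrow> 0"

definition star_hom :: "('a \<Rightarrow> 'b) \<Rightarrow> 'a cstar \<Rightarrow> 'b cstar \<Rightarrow> bool" where
  "star_hom h A B \<longleftrightarrow>
     h \<in> carrier A \<rightarrow> carrier B \<and>
     (\<forall>x \<in> carrier A. \<forall>y \<in> carrier A. h (x \<oplus>\<^bsub>A\<^esub> y) = h x \<oplus>\<^bsub>B\<^esub> h y) \<and>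
     (\<forall>x \<in> carrier A. \<forall>y \<in> carrier A. h (x \<otimes>\<^bsub>A\<^esub> y) = h x \<otimes>\<^bsub>B\<^esub> h y) \<and>
     (\<forall>c. \<forall>x \<in> carrier A. h (scale A c x) = scale B c (h x)) \<and>
     (\<forall>x \<in> carrier A. h (star A x) = star B (h x))"

text \<open>A bijective *-homomorphism between C*-algebras is automatically isometric.\<close>

definition cstar_isomorphic :: "'a cstar \<Rightarrow> 'b cstar \<Rightarrow> bool" where
  "cstar_isomorphic A B \<longleftrightarrow> (\<exists>h. star_hom h A B \<and> bij_betw h (carrier A) (carrier B))"

definition closed_star_subalgebra :: "'a set \<Rightarrow> 'a cstar \<Rightarrow> bool" where
  "closed_star_subalgebra H A \<longleftrightarrow>
     H \<subseteq> carrier A \<and> \<zero>\<^bsub>A\<^esub> \<in> H \<and>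
     (\<forall>x \<in> H. \<forall>y \<in> H. x \<oplus>\<^bsub>A\<^esub> y \<in> H \<and> x \<otimes>\<^bsub>A\<^esub> y \<in> H) \<and>
     (\<forall>c. \<forall>x \<in> H. scale A c x \<in> H) \<and>
     (\<forall>x \<in> H. star A x \<in> H) \<and>
     (\<forall>\<sigma> x. (\<forall>n. \<sigma> n \<in> H) \<and> x \<in> carrier A \<and> (\<lambda>n::nat. nrm A (\<sigma> n \<ominus>\<^bsub>A\<^esub> x)) \<longlonglongrightarrow> 0 \<longrightarrow> x \<in> H)"

definition generates_cstar :: "'a set \<Rightarrow> 'a cstar \<Rightarrow> bool" where
  "generates_cstar X A \<longleftrightarrow> X \<subseteq> carrier A \<and>
     (\<forall>H. closed_star_subalgebra H A \<and> X \<subseteq> H \<longrightarrow> H = carrier A)"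

definition projection :: "'a cstar \<Rightarrow> 'a \<Rightarrow> bool" where
  "projection A p \<longleftrightarrow> p \<in> carrier A \<and> star A p = p \<and> p \<otimes>\<^bsub>A\<^esub> p = p"

definition partial_isometry :: "'a cstar \<Rightarrow> 'a \<Rightarrow> bool" where
  "partial_isometry A s \<longleftrightarrow> s \<in> carrier A \<and> s \<otimes>\<^bsub>A\<^esub> star A s \<otimes>\<^bsub>A\<^esub> s = s"

section \<open>Graph algebras\<close>

text \<open>Meaningful for row-finite graphs only, so that the sums are finite.\<close>

definition cuntz_krieger_family ::
  "('v, 'e) pre_digraph \<Rightarrow> 'a cstar \<Rightarrow> ('v \<Rightarrow> 'a) \<Rightarrow> ('e \<Rightarrow> 'a) \<Rightarrow> bool" where
  "cuntz_krieger_family G A P S \<longleftrightarrow>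
     (\<forall>v \<in> verts G. projection A (P v)) \<and>
     (\<forall>v \<in> verts G. \<forall>w \<in> verts G. v \<noteq> w \<longrightarrow> P v \<otimes>\<^bsub>A\<^esub> P w = \<zero>\<^bsub>A\<^esub>) \<and>
     (\<forall>e \<in> arcs G. partial_isometry A (S e)) \<and>
     (\<forall>e \<in> arcs G. star A (S e) \<otimes>\<^bsub>A\<^esub> S e = P (head G e)) \<and>
     (\<forall>v \<in> tail G ` arcs G. P v = (\<Oplus>\<^bsub>A\<^esub>e \<in> out_arcs G v. S e \<otimes>\<^bsub>A\<^esub> star A (S e)))"

text \<open>\<open>graph_cstar_algebra G A\<close>: \<open>A\<close> is (a copy of) \<open>C*(G)\<close>, the C*-algebra generated by a
  universal Cuntz-Krieger \<open>G\<close>-family. The test algebras \<open>B\<close> have elements in the same type as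
  \<open>A\<close>. This is no restriction as soon as the type has at least the cardinality of the continuum:
  a C*-algebra generated by a Cuntz-Krieger family of a countable graph is separable and hence has
  a copy with elements in such a type. For the same reason \<open>C*(G)\<close> exists in such a type.\<close>

definition universal_cuntz_krieger_family ::
  "('v, 'e) pre_digraph \<Rightarrow> 'a cstar \<Rightarrow> ('v \<Rightarrow> 'a) \<Rightarrow> ('e \<Rightarrow> 'a) \<Rightarrow> bool" where
  "universal_cuntz_krieger_family G A P S \<longleftrightarrow>
     cuntz_krieger_family G A P S \<and>
     generates_cstar (P ` verts G \<union> S ` arcs G) A \<and>
     (\<forall>(B :: 'a cstar) Q T. cstar_algebra B \<and> cuntz_krieger_family G B Q T \<longrightarrow>
        (\<exists>h. star_hom h A B \<and> (\<forall>v \<in> verts G. h (P v) = Q v) \<and> (\<forall>e \<in> arcs G. h (S e) = T e)))"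

definition graph_cstar_algebra :: "('v, 'e) pre_digraph \<Rightarrow> 'a cstar \<Rightarrow> bool" where
  "graph_cstar_algebra G A \<longleftrightarrow>
     cstar_algebra A \<and> (\<exists>P S. universal_cuntz_krieger_family G A P S)"

end

theory Submission
  imports Defs
begin

text \<open>If \<open>C\<close> is a primitive transfer of \<open>B\<close> at \<open>p\<close>, then replacing every edge \<open>p \<rightarrow> j\<close> with \<open>j \<notin> K\<close> by the
  path \<open>p \<rightarrow> m \<rightarrow> j\<close> through the unique suitable \<open>m \<in> M\<close> turns the infinite paths of the graph of \<open>B\<close>
  bijectively into those of the graph of \<open>C\<close>. Tail-equivalent paths stay tail-equivalent, with a lag
  that is again additive, and cylinders are mapped onto cylinders; this is the isomorphism of path
  groupoids. On the side of the algebras, \<open>S\<^sub>(\<^sub>p\<^sub>,\<^sub>j\<^sub>) = T\<^sub>(\<^sub>p\<^sub>,\<^sub>m\<^sub>) T\<^sub>(\<^sub>m\<^sub>,\<^sub>j\<^sub>)\<close> and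
  \<open>T\<^sub>(\<^sub>p\<^sub>,\<^sub>m\<^sub>) = \<Sum>\<^sub>j S\<^sub>(\<^sub>p\<^sub>,\<^sub>j\<^sub>) S\<^sub>(\<^sub>m\<^sub>,\<^sub>j\<^sub>)\<^sup>*\<close> convert Cuntz-Krieger families of the two graphs into each other inside
  any C*-algebra, so both graphs have the same graph algebras. The facts about abstract C*-algebras
  that this needs, orthogonality of projections whose sum is a projection and contractivity of
  *-homomorphisms, are obtained from the C*-identity without spectral theory.\<close>

text \<open>The definition of a Cuntz-Krieger family does not say that distinct edges leaving one
  vertex have orthogonal range projections. The conversion of families relies on it, both to make
  cross terms vanish and to have P_v S_e = S_e for an edge e leaving v, so orthogonality is
  extracted from P_v being a projection. Contractivity enters through uniqueness of the graph
  algebra: *-homomorphisms are not assumed continuous, whereas generation is tested with closed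
  *-subalgebras.

  That p lies outside M is what makes the path substitution decodable. A new edge p -> m is followed
  by an edge leaving m, which differs from p, so two new edges are never adjacent and the first edge
  of a block reveals its length.

  Only E is given as row-finite without sinks. Both properties travel back along every step,
  whichever of the two matrices is a transfer of the other, so the chain of matrices is traversed
  backwards from its E end.\<close>

section \<open>C*-algebras\<close>

subsection \<open>Algebra and norm\<close>

context cstar_algebra
begin

lemma mult_zero_left: "x \<in> carrier A \<Longrightarrow> \<zero> \<otimes> x = \<zero>"
proof -
  assume x: "x \<in> carrier A"
  have "\<zero> \<otimes> x \<oplus> \<zero> \<otimes> x = \<zero> \<otimes> x \<oplus> \<zero>"
    using distrib_right[of \<zero> \<zero> x] x by (simp add: mult_closed)
  then show ?thesis using x by (simp add: mult_closed)
qed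

lemma mult_zero_right: "x \<in> carrier A \<Longrightarrow> x \<otimes> \<zero> = \<zero>"
proof -
  assume x: "x \<in> carrier A"
  have "x \<otimes> \<zero> \<oplus> x \<otimes> \<zero> = x \<otimes> \<zero> \<oplus> \<zero>"
    using distrib_left[of x \<zero> \<zero>] x by (simp add: mult_closed)
  then show ?thesis using x by (simp add: mult_closed)
qed

lemma scale_zero_left: "x \<in> carrier A \<Longrightarrow> scale A 0 x = \<zero>"
proof -
  assume x: "x \<in> carrier A"
  have "scale A 0 x \<oplus> scale A 0 x = scale A 0 x \<oplus> \<zero>"
    using scale_add_left[of x 0 0] x by (simp add: scale_closed)
  then show ?thesis using x by (simp add: scale_closed)
qed

lemma scale_zero_right: "scale A c \<zero> = \<zero>"
  using scale_scale[of \<zero> c 0] by (simp add: scale_zero_left)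

lemma minus_eq_scale: "x \<in> carrier A \<Longrightarrow> \<ominus> x = scale A (-1) x"
proof -
  assume x: "x \<in> carrier A"
  have "scale A (-1) x \<oplus> x = \<zero>"
    using scale_add_left[of x "-1" 1] x by (simp add: scale_one scale_zero_left)
  then show ?thesis using x by (simp add: minus_equality scale_closed)
qed

lemma mult_minus_left: "\<lbrakk>x \<in> carrier A; y \<in> carrier A\<rbrakk> \<Longrightarrow> (\<ominus> x) \<otimes> y = \<ominus> (x \<otimes> y)"
  by (simp add: minus_eq_scale mult_closed scale_mult_left)

lemma mult_minus_right: "\<lbrakk>x \<in> carrier A; y \<in> carrier A\<rbrakk> \<Longrightarrow> x \<otimes> (\<ominus> y) = \<ominus> (x \<otimes> y)"
  by (simp add: minus_eq_scale mult_closed scale_mult_right)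

lemma scale_minus: "x \<in> carrier A \<Longrightarrow> scale A c (\<ominus> x) = \<ominus> scale A c x"
  by (simp add: minus_eq_scale scale_closed scale_scale)

lemma star_minus: "x \<in> carrier A \<Longrightarrow> star A (\<ominus> x) = \<ominus> star A x"
  by (simp add: minus_eq_scale star_closed star_scale)

lemma star_zero: "star A \<zero> = \<zero>"
  using star_scale[of \<zero> 0] by (simp add: scale_zero_left star_closed)

lemmas closed_simps = mult_closed scale_closed star_closed minus_closed

lemmas linear_simps = distrib_left distrib_right mult_minus_left mult_minus_right
  scale_mult_left scale_mult_right scale_add_right scale_minus scale_scale
  star_add star_minus star_mult star_scale star_star mult_assoc minus_add a_minus_def

lemma uminus_zero [simp]: "\<ominus> \<zero> = \<zero>"
  by (rule minus_equality) simp_all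

text \<open>Registers the identities with the \<open>algebra\<close> method. Only sums are commuted,
  never products, so the method is usable for noncommutative identities; relations special to the
  elements at hand are supplied with \<open>using\<close> or \<open>unfolding\<close>.\<close>

lemmas cstar_simprules
  [algebra cstar "zero A" "add A" "a_inv A" "a_minus A" "scale A" "star A" "mult A"] =
  a_closed zero_closed a_inv_closed minus_closed mult_closed scale_closed star_closed
  a_assoc l_zero l_neg a_comm minus_eq r_zero r_neg r_neg2 r_neg1 minus_add minus_minus uminus_zero
  a_lcomm mult_assoc distrib_left distrib_right mult_minus_left mult_minus_right
  mult_zero_left mult_zero_right scale_mult_left scale_mult_right scale_add_right scale_minus
  scale_zero_right scale_scale scale_one star_add star_minus star_mult star_scale star_star star_zero

lemma nrm_zero: "nrm A \<zero> = 0"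
  by (simp add: nrm_eq_0)

lemma nrm_minus: "x \<in> carrier A \<Longrightarrow> nrm A (\<ominus> x) = nrm A x"
  by (simp add: minus_eq_scale nrm_scale)

lemma nrm_diff: "\<lbrakk>x \<in> carrier A; y \<in> carrier A\<rbrakk> \<Longrightarrow> nrm A (x \<ominus> y) \<le> nrm A x + nrm A y"
  using nrm_triangle[of x "\<ominus> y"] by (simp add: a_minus_def nrm_minus)

lemma diff_eq_zero_iff: "\<lbrakk>x \<in> carrier A; y \<in> carrier A\<rbrakk> \<Longrightarrow> x \<ominus> y = \<zero> \<longleftrightarrow> x = y"
proof
  assume "x \<in> carrier A" "y \<in> carrier A" "x \<ominus> y = \<zero>"
  then have "x \<oplus> (\<ominus> y \<oplus> y) = \<zero> \<oplus> y" by (simp add: a_minus_def a_assoc[symmetric])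
  then show "x = y" using \<open>x \<in> carrier A\<close> \<open>y \<in> carrier A\<close> by (simp add: l_neg)
qed (simp add: a_minus_def r_neg)

lemma nrm_star: "x \<in> carrier A \<Longrightarrow> nrm A (star A x) = nrm A x"
proof -
  have le: "nrm A y \<le> nrm A (star A y)" if y: "y \<in> carrier A" for y
  proof (cases "nrm A y = 0")
    case True
    then show ?thesis using y by (simp add: nrm_nonneg star_closed)
  next
    case False
    have "nrm A y * nrm A y \<le> nrm A (star A y) * nrm A y"
      using cstar_identity[OF y] nrm_mult[of "star A y" y] y
      by (simp add: star_closed power2_eq_square)
    then show ?thesis using False nrm_nonneg[OF y] by simp
  qed
  show "x \<in> carrier A \<Longrightarrow> nrm A (star A x) = nrm A x"
    using le[of x] le[of "star A x"] by (simp add: star_closed star_star)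
qed

lemma mult_cancel_nrm:
  assumes "x \<in> carrier A" "star A x \<otimes> x = \<zero>"
  shows "x = \<zero>"
  using cstar_identity[OF assms(1)] assms by (simp add: nrm_zero nrm_eq_0)

lemma projection_nrm_le_1:
  assumes "projection A q"
  shows "nrm A q \<le> 1"
proof -
  have "nrm A q * nrm A q = nrm A q * 1"
    using cstar_identity[of q] assms by (simp add: projection_def power2_eq_square)
  then show ?thesis by (metis mult_cancel_left order_refl zero_le_one)
qed

text \<open>Multiplication by 1 - q is contractive, expressed without a unit. The difference y = x -
  q x satisfies q y = 0, so \<open>star A y \<otimes> y\<close> equals
  \<open>star A x \<otimes> y\<close>, and the C*-identity gives |y|^2 \<le> |x| |y|.\<close>

lemma nrm_complement_le:
  assumes q: "projection A q" and x: "x \<in> carrier A"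
  shows "nrm A (x \<ominus> q \<otimes> x) \<le> nrm A x"
proof (cases "nrm A (x \<ominus> q \<otimes> x) = 0")
  case True
  then show ?thesis using x by (simp add: nrm_nonneg)
next
  case False
  have qc: "q \<in> carrier A" "star A q = q" "q \<otimes> q = q" using q by (auto simp: projection_def)
  define y where "y = x \<ominus> q \<otimes> x"
  have y: "y \<in> carrier A" using x qc by (simp add: y_def closed_simps)
  have "q \<otimes> y = q \<otimes> x \<oplus> \<ominus> ((q \<otimes> q) \<otimes> x)"
    using x qc(1,2) by (simp add: y_def linear_simps closed_simps)
  then have qy: "q \<otimes> y = \<zero>" using x qc by (simp add: r_neg closed_simps)
  have "star A y \<otimes> y = star A x \<otimes> y \<ominus> (star A x \<otimes> q) \<otimes> y"
    unfolding y_def[symmetric] using x y qc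
    by (subst y_def) (simp add: linear_simps closed_simps)
  also have "\<dots> = star A x \<otimes> y" using x y qc
    by (simp add: mult_assoc qy mult_zero_right star_closed mult_closed a_minus_def)
  finally have "nrm A y ^ 2 \<le> nrm A x * nrm A y"
    using cstar_identity[OF y] nrm_mult[of "star A x" y] x y by (simp add: star_closed nrm_star)
  then show ?thesis using False nrm_nonneg[OF y] by (simp add: y_def power2_eq_square)
qed

lemma finsum_mult_left:
  "\<lbrakk>finite I; a \<in> carrier A; f \<in> I \<rightarrow> carrier A\<rbrakk> \<Longrightarrow> a \<otimes> (\<Oplus>i\<in>I. f i) = (\<Oplus>i\<in>I. a \<otimes> f i)"
proof (induct set: finite)
  case empty then show ?case by (simp add: mult_zero_right)
next
  case (insert x F) then show ?case by (simp add: Pi_def distrib_left mult_closed)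
qed

lemma finsum_mult_right:
  "\<lbrakk>finite I; a \<in> carrier A; f \<in> I \<rightarrow> carrier A\<rbrakk> \<Longrightarrow> (\<Oplus>i\<in>I. f i) \<otimes> a = (\<Oplus>i\<in>I. f i \<otimes> a)"
proof (induct set: finite)
  case empty then show ?case by (simp add: mult_zero_left)
next
  case (insert x F) then show ?case by (simp add: Pi_def distrib_right mult_closed)
qed

lemma star_finsum:
  "\<lbrakk>finite I; f \<in> I \<rightarrow> carrier A\<rbrakk> \<Longrightarrow> star A (\<Oplus>i\<in>I. f i) = (\<Oplus>i\<in>I. star A (f i))"
proof (induct set: finite)
  case empty then show ?case by (simp add: star_zero)
next
  case (insert x F) then show ?case by (simp add: Pi_def star_add star_closed)
qed

lemma nrm_finsum_le:
  "\<lbrakk>finite I; f \<in> I \<rightarrow> carrier A\<rbrakk> \<Longrightarrow> nrm A (\<Oplus>i\<in>I. f i) \<le> (\<Sum>i\<in>I. nrm A (f i))"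
proof (induct set: finite)
  case empty then show ?case by (simp add: nrm_zero)
next
  case (insert x F)
  then have "nrm A (f x \<oplus> (\<Oplus>i\<in>F. f i)) \<le> nrm A (f x) + nrm A (\<Oplus>i\<in>F. f i)"
    by (intro nrm_triangle) (auto simp: Pi_def)
  with insert show ?case by (simp add: Pi_def)
qed

lemma finsum_single:
  assumes "finite I" "j \<in> I" "f \<in> I \<rightarrow> carrier A" "\<And>i. i \<in> I \<Longrightarrow> i \<noteq> j \<Longrightarrow> f i = \<zero>"
  shows "(\<Oplus>i\<in>I. f i) = f j"
proof -
  have "(\<Oplus>i\<in>I. f i) = (\<Oplus>i\<in>I. if j = i then f i else \<zero>)"
    using assms by (intro finsum_cong') auto
  also have "\<dots> = f j" using assms by (intro finsum_singleton) auto
  finally show ?thesis .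
qed

subsection \<open>Polynomials in an element of a corner\<close>

text \<open>Evaluation at b in Horner form, with the projection u in the place of the constant 1,
  since A need not have a unit. For b in the corner uAu it turns out multiplicative, so identities
  in A can be checked between complex polynomials.\<close>

definition corner_poly :: "'a \<Rightarrow> 'a \<Rightarrow> complex poly \<Rightarrow> 'a" where
  "corner_poly u b p = fold_coeffs (\<lambda>c x. scale A c u \<oplus> b \<otimes> x) p \<zero>"

context
  fixes u b
  assumes u: "projection A u" and b: "b \<in> carrier A" and ub: "u \<otimes> b = b" and bu: "b \<otimes> u = b"
begin

lemma corner_unit_closed: "u \<in> carrier A"
  using u by (simp add: projection_def)

lemma corner_poly_0: "corner_poly u b 0 = \<zero>"
  by (simp add: corner_poly_def)

lemma corner_poly_pCons:
  "corner_poly u b (pCons c p) = scale A c u \<oplus> b \<otimes> corner_poly u b p"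
proof (cases "c = 0 \<and> p = 0")
  \<comment> \<open>\<open>pCons 0 0\<close> is the zero polynomial, on which
    \<open>fold_coeffs\<close> takes no step.\<close>
  case True
  then show ?thesis using b corner_unit_closed
    by (simp add: corner_poly_0 scale_zero_left mult_zero_right)
next
  case False
  then show ?thesis by (cases "p = 0") (auto simp: corner_poly_def)
qed

lemma corner_poly_closed: "corner_poly u b p \<in> carrier A"
  using b corner_unit_closed
  by (induct p) (simp_all add: corner_poly_0 corner_poly_pCons closed_simps)

lemma corner_poly_add: "corner_poly u b (p + q) = corner_poly u b p \<oplus> corner_poly u b q"
  using b corner_unit_closed
  by (induct p q rule: poly_induct2)
    (simp_all add: corner_poly_0 corner_poly_pCons scale_add_left distrib_left
      corner_poly_closed closed_simps a_ac)

lemma corner_poly_smult: "corner_poly u b (smult c p) = scale A c (corner_poly u b p)"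
  using b corner_unit_closed
  by (induct p)
    (simp_all add: corner_poly_0 corner_poly_pCons scale_add_right scale_scale scale_mult_right
      corner_poly_closed closed_simps scale_zero_right)

lemma corner_poly_unit: "u \<otimes> corner_poly u b p = corner_poly u b p"
proof (cases p)
  case (pCons c q)
  have uu: "u \<otimes> u = u" using u by (simp add: projection_def)
  have "u \<otimes> (b \<otimes> corner_poly u b q) = b \<otimes> corner_poly u b q"
    using b corner_unit_closed ub by (simp add: mult_assoc[symmetric] corner_poly_closed)
  then show ?thesis using b corner_unit_closed uu
    by (simp add: pCons corner_poly_pCons distrib_left scale_mult_right
      corner_poly_closed closed_simps)
qed

lemma corner_poly_mult: "corner_poly u b (p * q) = corner_poly u b p \<otimes> corner_poly u b q"
proof (induct p)
  case 0
  then show ?case by (simp add: corner_poly_0 mult_zero_left corner_poly_closed)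
next
  case (pCons c p)
  have 0: "scale A 0 u \<oplus> b \<otimes> corner_poly u b (p * q) = b \<otimes> corner_poly u b (p * q)"
    using b corner_unit_closed by (simp add: scale_zero_left corner_poly_closed closed_simps)
  show ?case
    using b corner_unit_closed pCons 0
    by (simp add: corner_poly_add corner_poly_smult corner_poly_pCons distrib_right
      scale_mult_left corner_poly_unit mult_assoc corner_poly_closed closed_simps)
qed

lemma corner_poly_linear:
  "corner_poly u b [:c, d:] = scale A c u \<oplus> scale A d b"
  using b corner_unit_closed bu
  by (simp add: corner_poly_pCons corner_poly_0 mult_zero_right scale_mult_right closed_simps)

lemma nrm_corner_poly_mult_le:
  assumes "nrm A (corner_poly u b p) \<le> 1" "nrm A (corner_poly u b q) \<le> 1"
  shows "nrm A (corner_poly u b (p * q)) \<le> 1"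
proof -
  have "nrm A (corner_poly u b (p * q)) \<le> nrm A (corner_poly u b p) * nrm A (corner_poly u b q)"
    using nrm_mult[of "corner_poly u b p" "corner_poly u b q"]
    by (simp add: corner_poly_mult corner_poly_closed)
  also have "\<dots> \<le> 1" using assms by (simp add: mult_le_one nrm_nonneg corner_poly_closed)
  finally show ?thesis .
qed

lemma nrm_corner_poly_power_le:
  "nrm A (corner_poly u b p) \<le> 1 \<Longrightarrow> n > 0 \<Longrightarrow> nrm A (corner_poly u b (p ^ n)) \<le> 1"
proof (induct n)
  case (Suc n)
  then show ?case by (cases "n = 0") (auto intro: nrm_corner_poly_mult_le)
qed simp

lemma nrm_corner_poly_smult:
  "nrm A (corner_poly u b (smult c p)) = cmod c * nrm A (corner_poly u b p)"
  by (simp add: corner_poly_smult nrm_scale corner_poly_closed)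

lemma nrm_corner_poly_add:
  "nrm A (corner_poly u b (p + q)) \<le> nrm A (corner_poly u b p) + nrm A (corner_poly u b q)"
  by (simp add: corner_poly_add nrm_triangle corner_poly_closed)

text \<open>If both \<open>1 + t b\<close> and \<open>1 - t b\<close> are contractions, so are \<open>1 \<plusminus> i t b\<close> by the C*-identity, and
  \<open>4 + 6 x = (1 + x)\<^sup>3 + ((1 + i x)\<^sup>3 + (1 - i x)\<^sup>3) / 2 + (1 + x)\<^sup>2 (1 - x) + (1 + x)\<^sup>2\<close> is a
  sum of four contractions at \<open>x = t b\<close>.\<close>

lemma nrm_corner_poly_expand:
  fixes t :: real
  assumes sa: "star A b = b"
    and plus: "nrm A (corner_poly u b [:1, of_real t:]) \<le> 1"
    and minus: "nrm A (corner_poly u b [:1, - of_real t:]) \<le> 1"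
  shows "nrm A (corner_poly u b [:1, of_real (3 / 2 * t):]) \<le> 1"
proof -
  let ?N = "\<lambda>p. nrm A (corner_poly u b p)"
  define x where "x = [:0, complex_of_real t:]"
  have p: "?N (1 + x) \<le> 1" and m: "?N (1 - x) \<le> 1"
    using plus minus by (simp_all add: x_def one_pCons)
  \<comment> \<open>1 + x^2 is the mean of (1 + x)^2 and (1 - x)^2. It is also (1 - ix)(1 + ix),
    whose norm is by the C*-identity the square of the norm of 1 + ix.\<close>
  have sq: "?N (1 + x ^ 2) \<le> 1"
  proof -
    have "?N (smult (1/2) ((1 + x) ^ 2 + (1 - x) ^ 2)) \<le> 1"
      using nrm_corner_poly_add[of "(1 + x) ^ 2" "(1 - x) ^ 2"]
        nrm_corner_poly_power_le[OF p, of 2] nrm_corner_poly_power_le[OF m, of 2]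
      by (simp add: nrm_corner_poly_smult)
    moreover have "smult (1/2) ((1 + x) ^ 2 + (1 - x) ^ 2) = 1 + x ^ 2"
      by (simp add: x_def power2_eq_square one_pCons)
    ultimately show ?thesis by simp
  qed
  have imag: "?N (1 + smult c x) \<le> 1" if c: "c = \<i> \<or> c = - \<i>" for c
  proof -
    have "corner_poly u b (1 + smult (cnj c) x) = star A (corner_poly u b (1 + smult c x))"
      using b corner_unit_closed u
      by (simp add: x_def one_pCons corner_poly_linear star_add star_scale sa projection_def
        closed_simps)
    then have "?N (1 + smult c x) ^ 2 = ?N ((1 + smult (cnj c) x) * (1 + smult c x))"
      using cstar_identity[OF corner_poly_closed] by (simp add: corner_poly_mult)
    also have "(1 + smult (cnj c) x) * (1 + smult c x) = 1 + x ^ 2"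
      using c by (auto simp: x_def power2_eq_square one_pCons)
    finally show ?thesis using sq
      by (metis abs_square_le_1 abs_le_iff)
  qed
  have c3: "?N ((1 + smult c x) ^ 3) \<le> 1" if "c = \<i> \<or> c = - \<i>" for c
    by (intro nrm_corner_poly_power_le imag that) simp
  let ?q = "(1 + x) ^ 3 + (smult (1/2) ((1 + smult \<i> x) ^ 3 + (1 + smult (- \<i>) x) ^ 3)
    + ((1 + x) ^ 2 * (1 - x) + (1 + x) ^ 2))"
  have "?N (smult (1/2) ((1 + smult \<i> x) ^ 3 + (1 + smult (- \<i>) x) ^ 3)) \<le> 1"
    unfolding nrm_corner_poly_smult
    using nrm_corner_poly_add[of "(1 + smult \<i> x) ^ 3" "(1 + smult (- \<i>) x) ^ 3"]
      c3[of \<i>] c3[of "- \<i>"] by simp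
  moreover have "?N ((1 + x) ^ 3) \<le> 1" "?N ((1 + x) ^ 2) \<le> 1"
    by (intro nrm_corner_poly_power_le p; simp)+
  moreover have "?N ((1 + x) ^ 2 * (1 - x)) \<le> 1"
    by (intro nrm_corner_poly_mult_le nrm_corner_poly_power_le p m) simp
  ultimately have "?N ?q \<le> 4"
    using nrm_corner_poly_add[of "(1 + x) ^ 3" "smult (1/2) ((1 + smult \<i> x) ^ 3
        + (1 + smult (- \<i>) x) ^ 3) + ((1 + x) ^ 2 * (1 - x) + (1 + x) ^ 2)"]
      nrm_corner_poly_add[of "smult (1/2) ((1 + smult \<i> x) ^ 3 + (1 + smult (- \<i>) x) ^ 3)"
        "(1 + x) ^ 2 * (1 - x) + (1 + x) ^ 2"]
      nrm_corner_poly_add[of "(1 + x) ^ 2 * (1 - x)" "(1 + x) ^ 2"]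
    by linarith
  \<comment> \<open>The terms of degree two and three cancel. Division of 4 + 6x by 4 produces the
    factor 3/2 by which the admissible t grows.\<close>
  moreover have "?q = smult 4 [:1, of_real (3 / 2 * t):]"
    by (simp add: x_def power2_eq_square power3_eq_cube one_pCons algebra_simps)
  ultimately have "?N (smult 4 [:1, of_real (3 / 2 * t):]) \<le> 4"
    by (simp only:)
  then show ?thesis unfolding nrm_corner_poly_smult by simp
qed

text \<open>The unit of a corner is extreme among contractions in self-adjoint directions. Applying
  the previous lemma to t and to -t keeps u + t b and u - t b contractive for t = (3/2)^n, and their
  difference bounds (3/2)^n |b| by 1 for every n.\<close>

lemma corner_selfadjoint_eq_zero:
  assumes sa: "star A b = b" and plus: "nrm A (u \<oplus> b) \<le> 1" and minus: "nrm A (u \<ominus> b) \<le> 1"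
  shows "b = \<zero>"
proof -
  let ?N = "\<lambda>p. nrm A (corner_poly u b p)"
  have uc: "u \<in> carrier A" by (rule corner_unit_closed)
  have N: "?N [:1, of_real ((3/2) ^ n):] \<le> 1 \<and> ?N [:1, - of_real ((3/2) ^ n):] \<le> 1" for n
  proof (induct n)
    case 0
    show ?case using plus minus b uc
      by (simp add: corner_poly_linear scale_one a_minus_def minus_eq_scale)
  next
    case (Suc n)
    then show ?case
      using nrm_corner_poly_expand[OF sa, of "(3/2) ^ n"]
        nrm_corner_poly_expand[OF sa, of "- ((3/2) ^ n)"] by simp
  qed
  have "(3/2) ^ n * nrm A b \<le> 1" for n
  proof -
    have "[:0, 2 * complex_of_real ((3/2) ^ n):]
        = [:1, of_real ((3/2) ^ n):] + smult (-1) [:1, - of_real ((3/2) ^ n):]" by simp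
    then have "?N [:0, 2 * complex_of_real ((3/2) ^ n):] \<le> 2"
      using nrm_corner_poly_add[of "[:1, of_real ((3/2) ^ n):]" "smult (-1) [:1, - of_real ((3/2) ^ n):]"]
        N[of n] unfolding nrm_corner_poly_smult by simp
    moreover have "corner_poly u b [:0, 2 * complex_of_real ((3/2) ^ n):]
        = scale A (2 * complex_of_real ((3/2) ^ n)) b"
      using b uc by (simp add: corner_poly_linear scale_zero_left scale_closed)
    ultimately show ?thesis using b by (simp add: nrm_scale norm_mult norm_power norm_divide)
  qed
  moreover have "\<exists>n. (3/2) ^ n * nrm A b > 1" if "nrm A b > 0"
  proof -
    obtain n where "1 / nrm A b < (3/2) ^ n" using real_arch_pow[of "3/2" "1 / nrm A b"] by auto
    then show ?thesis using that by (auto simp: field_simps)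
  qed
  ultimately have "nrm A b = 0" using nrm_nonneg[OF b] by (metis less_eq_real_def not_less)
  then show ?thesis using b by (simp add: nrm_eq_0)
qed

end

end

subsection \<open>Orthogonality of projections\<close>

context cstar_algebra
begin

text \<open>With \<open>c\<^sub>k = q\<^sub>i q\<^sub>k q\<^sub>i\<close> and \<open>n + 1\<close> projections, both \<open>n q\<^sub>i + c\<^sub>j\<close> (which is \<open>q\<^sub>i p q\<^sub>i\<close> plus
  the contractions \<open>q\<^sub>i - c\<^sub>k\<close>) and \<open>n q\<^sub>i - c\<^sub>j\<close> have norm at most \<open>n\<close>, which forces
  \<open>c\<^sub>j = (q\<^sub>j q\<^sub>i)\<^sup>* q\<^sub>j q\<^sub>i\<close> to vanish.\<close>

lemma projections_sum_orthogonal: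
  assumes I: "finite I" and q: "\<And>i. i \<in> I \<Longrightarrow> projection A (q i)"
    and sum: "projection A (\<Oplus>i\<in>I. q i)"
    and i: "i \<in> I" and j: "j \<in> I" and ij: "i \<noteq> j"
  shows "q i \<otimes> q j = \<zero>"
proof -
  define p where "p = (\<Oplus>i\<in>I. q i)"
  define u where "u = q i"
  define c where "c k = u \<otimes> (q k \<otimes> u)" for k
  have qc: "q k \<in> carrier A" "star A (q k) = q k" "q k \<otimes> q k = q k" if "k \<in> I" for k
    using q[OF that] by (auto simp: projection_def)
  have u: "u \<in> carrier A" "star A u = u" "u \<otimes> u = u" "projection A u"
    using i q qc by (auto simp: u_def)
  have p: "p \<in> carrier A" "projection A p" using sum by (auto simp: p_def projection_def)
  have cc: "c k \<in> carrier A" if "k \<in> I" for k using that qc u by (simp add: c_def mult_closed)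
  have c_le: "nrm A (u \<ominus> c k) \<le> 1" if k: "k \<in> I" for k
  proof -
    have "u \<ominus> c k = u \<otimes> (u \<ominus> q k \<otimes> u)"
      using u qc[OF k] by (simp add: c_def linear_simps closed_simps)
    then have "nrm A (u \<ominus> c k) \<le> nrm A u * nrm A (u \<ominus> q k \<otimes> u)"
      using u qc[OF k] by (simp add: nrm_mult closed_simps)
    also have "\<dots> \<le> 1 * 1"
      using projection_nrm_le_1[OF u(4)] nrm_complement_le[OF q[OF k] u(1)] u qc[OF k]
      by (intro mult_mono) (auto intro: nrm_nonneg simp: closed_simps)
    finally show ?thesis by simp
  qed
  have pu: "u \<otimes> (p \<otimes> u) = (\<Oplus>k\<in>I. c k)"
    using I u qc by (simp add: p_def c_def finsum_mult_left finsum_mult_right Pi_def mult_closed)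
  define J where "J = I - {i, j}"
  have J: "finite J" "J \<subseteq> I" using I by (auto simp: J_def)
  \<comment> \<open>Since J leaves out both i and j, this counts the projections other than
    \<open>q i\<close>.\<close>
  define n where "n = real (card J) + 1"
  have n: "n > 0" by (simp add: n_def)
  have ci: "c i = u" using u by (simp add: c_def u_def)
  have I': "I = insert i (insert j J)" "i \<notin> insert j J" "j \<notin> J" using i j ij by (auto simp: J_def)
  define s where "s = (\<Oplus>k\<in>J. c k)"
  have s: "s \<in> carrier A" using cc J by (auto simp: s_def Pi_def intro!: finsum_closed)
  have pu': "u \<otimes> (p \<otimes> u) = u \<oplus> (c j \<oplus> s)"
  proof -
    have "(\<Oplus>k\<in>insert j J. c k) = c j \<oplus> s"
      unfolding s_def using cc J j I' by (intro finsum_insert) auto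
    moreover have "(\<Oplus>k\<in>insert i (insert j J). c k) = c i \<oplus> (\<Oplus>k\<in>insert j J. c k)"
      using cc J i j I'(2) by (intro finsum_insert) auto
    ultimately show ?thesis using I'(1) by (simp add: pu ci)
  qed
  have diff: "(\<Oplus>k\<in>J. u \<ominus> c k) = scale A (complex_of_real (card J)) u \<ominus> s"
  proof -
    have "(\<Oplus>k\<in>L. u \<ominus> c k) = scale A (complex_of_real (card L)) u \<ominus> (\<Oplus>k\<in>L. c k)"
      if "finite L" "L \<subseteq> I" for L
      using that
    proof (induct L)
      case empty
      then show ?case using u by (simp add: scale_zero_left a_minus_def)
    next
      case (insert k L)
      then have *: "c k \<in> carrier A" "(\<Oplus>k\<in>L. c k) \<in> carrier A" "c \<in> L \<rightarrow> carrier A"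
        using cc by (auto simp: Pi_def intro!: finsum_closed)
      have "scale A (complex_of_real (card (insert k L))) u = u \<oplus> scale A (complex_of_real (card L)) u"
        using insert u by (simp add: scale_add_left scale_one)
      moreover have "(\<Oplus>k\<in>insert k L. u \<ominus> c k) = (u \<ominus> c k) \<oplus> (\<Oplus>k\<in>L. u \<ominus> c k)"
        using insert u cc by (intro finsum_insert) auto
      moreover have "(\<Oplus>k\<in>insert k L. c k) = c k \<oplus> (\<Oplus>k\<in>L. c k)"
        using insert * by (intro finsum_insert) auto
      moreover have "(\<Oplus>k\<in>L. u \<ominus> c k) = scale A (complex_of_real (card L)) u \<ominus> (\<Oplus>k\<in>L. c k)"
        using insert by simp
      moreover have "(u \<ominus> x) \<oplus> (v \<ominus> w) = (u \<oplus> v) \<ominus> (x \<oplus> w)"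
        if "x \<in> carrier A" "v \<in> carrier A" "w \<in> carrier A" for x v w
        using that u(1) by algebra
      ultimately show ?case using * u by (simp add: scale_closed)
    qed
    then show ?thesis using J by (simp add: s_def)
  qed
  \<comment> \<open>With this scaling the two norm bounds below say that u + b and u - b are
    contractions, as \<open>corner_selfadjoint_eq_zero\<close> wants.\<close>
  define b where "b = scale A (complex_of_real (1 / n)) (c j)"
  have b: "b \<in> carrier A" "u \<otimes> b = b" "b \<otimes> u = b" "star A b = b"
    using cc[OF j] u qc[OF j] mult_assoc[of u u "q j \<otimes> u"]
    by (simp_all add: b_def c_def closed_simps linear_simps)
  have nb: "scale A (complex_of_real n) (u \<oplus> b) = scale A (complex_of_real n) u \<oplus> c j"
    "scale A (complex_of_real n) (u \<ominus> b) = scale A (complex_of_real n) u \<ominus> c j"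
    using n u b cc[OF j] by (simp_all add: b_def scale_one closed_simps linear_simps)
  have nu: "scale A (complex_of_real n) u = scale A (complex_of_real (card J)) u \<oplus> u"
    using u by (simp add: n_def scale_add_left scale_one)
  have "scale A (complex_of_real n) u \<oplus> c j = u \<otimes> (p \<otimes> u) \<oplus> (\<Oplus>k\<in>J. u \<ominus> c k)"
    unfolding nu diff pu' using u s cc[OF j] by algebra
  moreover have "nrm A (u \<otimes> (p \<otimes> u)) \<le> 1"
  proof -
    have "nrm A (u \<otimes> (p \<otimes> u)) \<le> nrm A u * nrm A (p \<otimes> u)"
      using u p by (simp add: nrm_mult mult_closed)
    also have "\<dots> \<le> 1 * (nrm A p * nrm A u)"
      using u p by (intro mult_mono nrm_mult projection_nrm_le_1 nrm_nonneg) (auto simp: mult_closed)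
    also have "\<dots> \<le> 1 * (1 * 1)"
      using u p by (intro mult_mono projection_nrm_le_1 nrm_nonneg mult_nonneg_nonneg) auto
    finally show ?thesis by simp
  qed
  moreover have "nrm A (\<Oplus>k\<in>J. u \<ominus> c k) \<le> card J"
  proof -
    have "nrm A (\<Oplus>k\<in>J. u \<ominus> c k) \<le> (\<Sum>k\<in>J. nrm A (u \<ominus> c k))"
      using J u cc by (intro nrm_finsum_le) (auto simp: Pi_def)
    also have "\<dots> \<le> (\<Sum>k\<in>J. 1)" using J c_le by (intro sum_mono) auto
    finally show ?thesis by simp
  qed
  ultimately have "nrm A (scale A (complex_of_real n) u \<oplus> c j) \<le> n"
    using nrm_triangle[of "u \<otimes> (p \<otimes> u)" "\<Oplus>k\<in>J. u \<ominus> c k"] u p J cc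
    by (simp add: n_def finsum_closed Pi_def subset_iff closed_simps)
  then have "n * nrm A (u \<oplus> b) \<le> n" using nb(1)[symmetric] u b n
    by (simp add: nrm_scale del: of_real_add)
  then have plus: "nrm A (u \<oplus> b) \<le> 1" using n by simp
  have "scale A (complex_of_real n) u \<ominus> c j = scale A (complex_of_real (card J)) u \<oplus> (u \<ominus> c j)"
    unfolding nu using u cc[OF j] by algebra
  then have "nrm A (scale A (complex_of_real n) u \<ominus> c j) \<le> card J * nrm A u + nrm A (u \<ominus> c j)"
    using nrm_triangle[of "scale A (complex_of_real (card J)) u" "u \<ominus> c j"] u cc[OF j]
    by (simp add: nrm_scale closed_simps)
  also have "\<dots> \<le> real (card J) * 1 + 1"
    using projection_nrm_le_1[OF u(4)] c_le[OF j] by (intro add_mono mult_left_mono) auto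
  also have "\<dots> = n" by (simp add: n_def)
  finally have "n * nrm A (u \<ominus> b) \<le> n" using nb(2)[symmetric] u b n
    by (simp add: nrm_scale del: of_real_add)
  then have minus: "nrm A (u \<ominus> b) \<le> 1" using n by simp
  have "b = \<zero>"
    by (rule corner_selfadjoint_eq_zero[OF u(4) b(1-4) plus minus])
  then have "c j = \<zero>" using cc[OF j] n scale_scale[of "c j" n "1 / n"]
    by (simp add: b_def scale_one scale_zero_right)
  moreover have "q j \<otimes> (q j \<otimes> u) = q j \<otimes> u"
    using qc[OF j] u by (simp add: mult_assoc[symmetric])
  then have "c j = star A (q j \<otimes> u) \<otimes> (q j \<otimes> u)"
    using qc[OF j] u by (simp add: c_def linear_simps closed_simps)
  ultimately have "star A (q j \<otimes> u) \<otimes> (q j \<otimes> u) = \<zero>" by metis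
  then have "q j \<otimes> u = \<zero>" by (rule mult_cancel_nrm[OF mult_closed[OF qc(1)[OF j] u(1)]])
  then have "star A (q j \<otimes> u) = \<zero>" by (simp add: star_zero)
  then show ?thesis using qc[OF j] u by (simp add: star_mult u_def)
qed


subsection \<open>Contractivity of *-homomorphisms\<close>

text \<open>The solution \<open>y\<close> of \<open>(1 - y)\<^sup>2 = 1 - a\<^sup>2\<close> is the limit of \<open>y\<^sub>n\<^sub>+\<^sub>1 = (a\<^sup>2 + y\<^sub>n\<^sup>2) / 2\<close>, whose increments
  are majorized by those of the same recursion for the number 1 in place of \<open>a\<close>.\<close>

lemma selfadjoint_unitary_part:
  assumes a: "a \<in> carrier A" and sa: "star A a = a" and le: "nrm A a \<le> 1"
  obtains y where "y \<in> carrier A" "star A y = y" "y \<otimes> a = a \<otimes> y" "y \<oplus> y = a \<otimes> a \<oplus> y \<otimes> y"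
proof -
  define F where "F y = scale A (1/2) (a \<otimes> a \<oplus> y \<otimes> y)" for y
  define \<sigma> where "\<sigma> n = (F ^^ n) \<zero>" for n
  define t where "t n = ((\<lambda>s::real. (1 + s\<^sup>2) / 2) ^^ n) 0" for n
  have Suc: "\<sigma> (Suc n) = F (\<sigma> n)" "t (Suc n) = (1 + (t n)\<^sup>2) / 2" "\<sigma> 0 = \<zero>" "t 0 = 0" for n
    by (simp_all add: \<sigma>_def t_def)
  have F_closed: "F y \<in> carrier A" if "y \<in> carrier A" for y
    using that a by (simp add: F_def closed_simps)
  have \<sigma>: "\<sigma> n \<in> carrier A" for n
    by (induct n) (simp_all add: Suc F_closed)
  have \<sigma>_star: "star A (\<sigma> n) = \<sigma> n" for n
  proof (induct n)
    case (Suc n)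
    then show ?case using a sa \<sigma>[of n] unfolding \<open>\<sigma> (Suc n) = F (\<sigma> n)\<close>
      by (simp add: F_def star_add star_scale star_mult closed_simps)
  qed (simp add: Suc star_zero)
  have \<sigma>_comm: "\<sigma> n \<otimes> a = a \<otimes> \<sigma> n" for n
  proof (induct n)
    case (Suc n)
    have "\<sigma> n \<otimes> (\<sigma> n \<otimes> a) = a \<otimes> (\<sigma> n \<otimes> \<sigma> n)"
      using a \<sigma>[of n] Suc mult_assoc[of "\<sigma> n" a "\<sigma> n"] mult_assoc[of a "\<sigma> n" "\<sigma> n"] by simp
    then show ?case using a \<sigma>[of n] unfolding \<open>\<sigma> (Suc n) = F (\<sigma> n)\<close>
      by (simp add: F_def linear_simps closed_simps)
  qed (simp add: Suc a mult_zero_left mult_zero_right)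
  have t01: "0 \<le> t n \<and> t n \<le> 1" for n
    by (induct n) (auto simp: Suc power_le_one)
  have F_diff: "nrm A (F y \<ominus> F z) \<le> (nrm A y + nrm A z) / 2 * nrm A (y \<ominus> z)"
    if y: "y \<in> carrier A" and z: "z \<in> carrier A" for y z
  proof -
    \<comment> \<open>y^2 - z^2 = y (y - z) + (y - z) z holds without commutativity.\<close>
    have "F y \<ominus> F z = scale A (1/2) (y \<otimes> (y \<ominus> z) \<oplus> (y \<ominus> z) \<otimes> z)"
      using a y z unfolding F_def by algebra
    then have "nrm A (F y \<ominus> F z) = 1/2 * nrm A (y \<otimes> (y \<ominus> z) \<oplus> (y \<ominus> z) \<otimes> z)"
      using y z by (simp add: nrm_scale closed_simps norm_divide)
    also have "nrm A (y \<otimes> (y \<ominus> z) \<oplus> (y \<ominus> z) \<otimes> z) \<le> nrm A y * nrm A (y \<ominus> z) + nrm A (y \<ominus> z) * nrm A z"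
      using y z nrm_triangle[of "y \<otimes> (y \<ominus> z)" "(y \<ominus> z) \<otimes> z"] nrm_mult[of y "y \<ominus> z"] nrm_mult[of "y \<ominus> z" z]
      by (simp add: closed_simps)
    finally show ?thesis by (simp add: algebra_simps)
  qed
  have \<sigma>_le: "nrm A (\<sigma> n) \<le> t n" for n
  proof (induct n)
    case (Suc n)
    have "nrm A (F (\<sigma> n)) = 1/2 * nrm A (a \<otimes> a \<oplus> \<sigma> n \<otimes> \<sigma> n)"
      using a \<sigma>[of n] by (simp add: F_def nrm_scale closed_simps norm_divide)
    also have "nrm A (a \<otimes> a \<oplus> \<sigma> n \<otimes> \<sigma> n) \<le> nrm A a * nrm A a + nrm A (\<sigma> n) * nrm A (\<sigma> n)"
      using a \<sigma>[of n] nrm_triangle[of "a \<otimes> a" "\<sigma> n \<otimes> \<sigma> n"] nrm_mult[of a a] nrm_mult[of "\<sigma> n" "\<sigma> n"]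
      by (simp add: closed_simps)
    also have "\<dots> \<le> 1 * 1 + t n * t n"
      using Suc le a \<sigma>[of n] t01 by (intro add_mono mult_mono) (auto simp: nrm_nonneg)
    finally show ?case unfolding \<open>\<sigma> (Suc n) = F (\<sigma> n)\<close> \<open>t (Suc n) = (1 + (t n)\<^sup>2) / 2\<close>
      by (simp add: power2_eq_square)
  qed (simp add: Suc nrm_zero)
  have t_mono: "t n \<le> t (n + k)" for n k
  proof -
    \<comment> \<open>Twice the increment is the square of t m - 1.\<close>
    have "t m \<le> t (Suc m)" for m
      using sum_squares_ge_zero[of "t m - 1" 0] by (simp add: Suc power2_eq_square algebra_simps)
    then show ?thesis by (rule lift_Suc_mono_le) simp
  qed
  have major: "nrm A (\<sigma> (n + k) \<ominus> \<sigma> n) \<le> t (n + k) - t n" for n k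
  proof (induct n)
    case 0
    then show ?case using \<sigma>_le[of k] \<sigma>[of k] by (simp add: Suc a_minus_def)
  next
    case (Suc n)
    have "nrm A (\<sigma> (Suc n + k) \<ominus> \<sigma> (Suc n)) = nrm A (F (\<sigma> (n + k)) \<ominus> F (\<sigma> n))"
      by (simp add: \<open>\<And>n. \<sigma> (Suc n) = F (\<sigma> n)\<close>)
    also have "\<dots> \<le> (nrm A (\<sigma> (n + k)) + nrm A (\<sigma> n)) / 2 * nrm A (\<sigma> (n + k) \<ominus> \<sigma> n)"
      by (intro F_diff \<sigma>)
    also have "\<dots> \<le> (t (n + k) + t n) / 2 * (t (n + k) - t n)"
      using \<sigma> \<sigma>_le Suc t01 by (intro mult_mono divide_right_mono add_mono) (auto simp: nrm_nonneg)
    \<comment> \<open>A difference of squares divided by 2 is the next increment of the scalar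
      recursion, so the majorization reproduces itself.\<close>
    also have "\<dots> = t (Suc n + k) - t (Suc n)"
      by (simp add: \<open>\<And>n. t (Suc n) = (1 + (t n)\<^sup>2) / 2\<close> power2_eq_square field_simps)
    finally show ?case .
  qed
  have "Cauchy t"
  proof -
    have "incseq t" using t_mono by (auto simp: incseq_def le_iff_add)
    then have "convergent t"
      using t01 by (intro Bseq_mono_convergent BseqI'[of _ 1]) (auto simp: incseq_def)
    then show ?thesis by (rule convergent_Cauchy)
  qed
  have "\<forall>\<epsilon>>0. \<exists>N. \<forall>m\<ge>N. \<forall>n\<ge>N. nrm A (\<sigma> m \<ominus> \<sigma> n) < \<epsilon>"
  proof (intro allI impI)
    fix \<epsilon> :: real assume "\<epsilon> > 0"
    then obtain N where N: "\<And>m n. m \<ge> N \<Longrightarrow> n \<ge> N \<Longrightarrow> \<bar>t m - t n\<bar> < \<epsilon>"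
      using \<open>Cauchy t\<close> by (metis Cauchy_def dist_real_def)
    have ord: "nrm A (\<sigma> m \<ominus> \<sigma> n) < \<epsilon>" if "m \<ge> N" "n \<ge> N" "n \<le> m" for m n
      using N[OF that(1,2)] major[of n "m - n"] that by simp
    have sym: "nrm A (\<sigma> m \<ominus> \<sigma> n) = nrm A (\<sigma> n \<ominus> \<sigma> m)" for m n
      using nrm_minus[of "\<sigma> n \<ominus> \<sigma> m"] \<sigma> by (simp add: a_minus_def minus_add a_comm)
    show "\<exists>N. \<forall>m\<ge>N. \<forall>n\<ge>N. nrm A (\<sigma> m \<ominus> \<sigma> n) < \<epsilon>"
      using ord sym by (metis nat_le_linear)
  qed
  then obtain y where y: "y \<in> carrier A" and lim: "(\<lambda>n. nrm A (\<sigma> n \<ominus> y)) \<longlonglongrightarrow> 0"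
    using complete[of \<sigma>] \<sigma> by auto
  \<comment> \<open>Takes the place of continuity of the operations: each property of the limit is
    stated as a fixed element being zero, and that element is bounded by the distances of
    \<open>\<sigma> n\<close> and \<open>\<sigma> (Suc n)\<close> from y.\<close>
  have vanish: "x = \<zero>" if x: "x \<in> carrier A" and "\<And>n. nrm A x \<le> C * nrm A (\<sigma> n \<ominus> y) + D * nrm A (\<sigma> (Suc n) \<ominus> y)" for x C D
  proof -
    have "(\<lambda>n. C * nrm A (\<sigma> n \<ominus> y) + D * nrm A (\<sigma> (Suc n) \<ominus> y)) \<longlonglongrightarrow> C * 0 + D * 0"
      by (intro tendsto_intros lim LIMSEQ_Suc)
    then have "nrm A x \<le> 0" using that(2) by (intro LIMSEQ_le_const) auto
    then show ?thesis using nrm_nonneg[OF x] nrm_eq_0[OF x] by simp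
  qed
  have sy: "nrm A (y \<ominus> \<sigma> n) = nrm A (\<sigma> n \<ominus> y)" for n
    using nrm_minus[of "\<sigma> n \<ominus> y"] \<sigma> y by (simp add: a_minus_def minus_add a_comm)
  have "star A y \<ominus> y = \<zero>"
  proof (rule vanish)
    fix n
    have "star A y \<ominus> y = star A (y \<ominus> \<sigma> n) \<oplus> (\<sigma> n \<ominus> y)"
      using y \<sigma>[of n] \<sigma>_star[of n] by algebra
    then show "nrm A (star A y \<ominus> y) \<le> 2 * nrm A (\<sigma> n \<ominus> y) + 0 * nrm A (\<sigma> (Suc n) \<ominus> y)"
      using nrm_triangle[of "star A (y \<ominus> \<sigma> n)" "\<sigma> n \<ominus> y"] y \<sigma>[of n] sy[of n]
      by (simp add: closed_simps nrm_star)
  qed (simp add: y star_closed)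
  moreover have "y \<otimes> a \<ominus> a \<otimes> y = \<zero>"
  proof (rule vanish)
    fix n
    have "y \<otimes> a \<ominus> a \<otimes> y = (y \<ominus> \<sigma> n) \<otimes> a \<oplus> a \<otimes> (\<sigma> n \<ominus> y)"
      using y a \<sigma>[of n] \<sigma>_comm[of n] by algebra
    then show "nrm A (y \<otimes> a \<ominus> a \<otimes> y) \<le> (2 * nrm A a) * nrm A (\<sigma> n \<ominus> y) + 0 * nrm A (\<sigma> (Suc n) \<ominus> y)"
      using nrm_triangle[of "(y \<ominus> \<sigma> n) \<otimes> a" "a \<otimes> (\<sigma> n \<ominus> y)"] y a \<sigma>[of n] sy[of n]
        nrm_mult[of "y \<ominus> \<sigma> n" a] nrm_mult[of a "\<sigma> n \<ominus> y"]
      by (simp add: closed_simps algebra_simps)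
  qed (simp add: y a closed_simps)
  moreover have "F y \<ominus> y = \<zero>"
  proof (rule vanish)
    fix n
    have "F y \<ominus> y = (F y \<ominus> F (\<sigma> n)) \<oplus> (\<sigma> (Suc n) \<ominus> y)"
      using y \<sigma>[of n] F_closed[OF y] F_closed[OF \<sigma>[of n]]
      unfolding Suc by algebra
    then have "nrm A (F y \<ominus> y) \<le> nrm A (F y \<ominus> F (\<sigma> n)) + nrm A (\<sigma> (Suc n) \<ominus> y)"
      using nrm_triangle[of "F y \<ominus> F (\<sigma> n)" "\<sigma> (Suc n) \<ominus> y"] y \<sigma> F_closed by simp
    also have "nrm A (F y \<ominus> F (\<sigma> n)) \<le> (nrm A y + nrm A (\<sigma> n)) / 2 * nrm A (\<sigma> n \<ominus> y)"
      using F_diff[OF y \<sigma>[of n]] sy[of n] by simp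
    also have "\<dots> \<le> (nrm A y + 1) / 2 * nrm A (\<sigma> n \<ominus> y)"
      using \<sigma>_le[of n] t01[of n] y \<sigma>[of n] by (intro mult_right_mono) (auto simp: nrm_nonneg)
    finally show "nrm A (F y \<ominus> y) \<le> ((nrm A y + 1) / 2) * nrm A (\<sigma> n \<ominus> y) + 1 * nrm A (\<sigma> (Suc n) \<ominus> y)"
      by simp
  qed (simp add: y F_closed)
  ultimately have eqs: "star A y = y" "y \<otimes> a = a \<otimes> y" "F y = y"
    using y a F_closed by (simp_all add: diff_eq_zero_iff closed_simps)
  \<comment> \<open>Doubling \<open>F y = y\<close> gives the unit-free form of (1 - y)^2 = 1 -
    a^2.\<close>
  have "y \<oplus> y = scale A (1/2 + 1/2) (a \<otimes> a \<oplus> y \<otimes> y)"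
    using eqs(3) y a unfolding scale_add_left[OF a_closed[OF mult_closed[OF a a] mult_closed[OF y y]]]
    by (simp add: F_def)
  then have "y \<oplus> y = a \<otimes> a \<oplus> y \<otimes> y" using y a by (simp add: scale_one mult_closed)
  then show thesis using that y eqs by blast
qed

text \<open>For \<open>b + i (1 - z)\<close> acting unitarily, \<open>2 b\<close> is a sum of two isometries.\<close>

lemma selfadjoint_nrm_le_1:
  assumes b: "b \<in> carrier A" "star A b = b" and z: "z \<in> carrier A" "star A z = z"
    and comm: "z \<otimes> b = b \<otimes> z" and eq: "z \<oplus> z = b \<otimes> b \<oplus> z \<otimes> z"
  shows "nrm A b \<le> 1"
proof -
  define U where "U c w = b \<otimes> w \<oplus> scale A c (w \<ominus> z \<otimes> w)" for c w
  have U_closed: "U c w \<in> carrier A" if "w \<in> carrier A" for c w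
    using that b z by (simp add: U_def closed_simps)
  have U_nrm: "nrm A (U c b) = nrm A b" if c: "c = \<i> \<or> c = - \<i>" for c
  proof -
    have cc: "cnj c = - c" "c * c = -1" using c by auto
    have neg: "scale A (cnj c) x = \<ominus> scale A c x" "scale A c (scale A c x) = \<ominus> x"
      if "x \<in> carrier A" for x
      using that minus_eq_scale[of x] minus_eq_scale[of "scale A c x"]
      by (simp_all add: cc scale_scale scale_closed)
    have bb: "b \<otimes> b = z \<oplus> z \<ominus> z \<otimes> z"
      unfolding eq using b(1) z(1) by algebra
    have star_U: "star A (U c b) = b \<otimes> b \<ominus> scale A c (b \<ominus> b \<otimes> z)"
      using b z by (simp add: U_def star_add star_scale star_mult a_minus_def star_minus
        closed_simps neg)
    have U: "U c b = b \<otimes> b \<oplus> scale A c (b \<ominus> b \<otimes> z)"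
      by (simp add: U_def comm)
    define v where "v = b \<ominus> b \<otimes> z"
    have v: "v \<in> carrier A" using b z by (simp add: v_def closed_simps)
    have bv: "v \<otimes> (b \<otimes> b) = (b \<otimes> b) \<otimes> v"
    proof -
      have "z \<otimes> (b \<otimes> b) = (b \<otimes> b) \<otimes> z"
        using b z comm mult_assoc[of z b b] mult_assoc[of b z b] mult_assoc[of b b z] by simp
      then show ?thesis using b z mult_assoc[of b z "b \<otimes> b"] unfolding v_def by algebra
    qed
    have "v \<otimes> v = b \<otimes> b \<ominus> (b \<otimes> b) \<otimes> (b \<otimes> b)"
    proof -
      have "b \<otimes> z \<otimes> (b \<otimes> z) = (b \<otimes> b) \<otimes> (z \<otimes> z)" "b \<otimes> z \<otimes> b = (b \<otimes> b) \<otimes> z"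
        using b z comm mult_assoc[of z b z] by (simp_all add: mult_assoc mult_closed)
      then have "v \<otimes> v = b \<otimes> b \<ominus> (b \<otimes> b) \<otimes> z \<ominus> ((b \<otimes> b) \<otimes> z \<ominus> (b \<otimes> b) \<otimes> (z \<otimes> z))"
        using b z unfolding v_def by (simp add: linear_simps closed_simps)
      then show ?thesis using b(1) z(1) unfolding arg_cong[OF bb, of "\<lambda>x. b \<otimes> b \<otimes> x"] by algebra
    qed
    \<comment> \<open>The mixed terms cancel because v commutes with b^2, and v^2 = b^2 - b^4
      removes the fourth power.\<close>
    moreover have "star A (U c b) \<otimes> U c b = (b \<otimes> b) \<otimes> (b \<otimes> b) \<oplus> v \<otimes> v
        \<oplus> (scale A c ((b \<otimes> b) \<otimes> v) \<ominus> scale A c (v \<otimes> (b \<otimes> b)))"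
      unfolding star_U unfolding U v_def[symmetric]
      using b(1) v neg(2)[of "v \<otimes> v"] by algebra
    ultimately have "star A (U c b) \<otimes> U c b = b \<otimes> b"
      using b(1) v unfolding bv by algebra
    then have "(nrm A (U c b))\<^sup>2 = (nrm A b)\<^sup>2"
      using cstar_identity[OF U_closed[OF b(1)], of c] cstar_identity[OF b(1)] b by simp
    then show ?thesis using b U_closed by (simp add: nrm_nonneg)
  qed
  \<comment> \<open>The imaginary parts cancel. Both summands have the norm of b, so 2 |b|^2 \<le> 2
    |b|.\<close>
  have "U \<i> b \<oplus> U (- \<i>) b = scale A 2 (b \<otimes> b)"
  proof -
    have v: "b \<ominus> z \<otimes> b \<in> carrier A" using b z by (simp add: closed_simps)
    have "scale A (- \<i>) (b \<ominus> z \<otimes> b) = \<ominus> scale A \<i> (b \<ominus> z \<otimes> b)"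
      using v by (simp add: minus_eq_scale scale_closed scale_scale)
    moreover have "scale A 2 (b \<otimes> b) = b \<otimes> b \<oplus> b \<otimes> b"
      using scale_add_left[of "b \<otimes> b" 1 1] b by (simp add: scale_one mult_closed)
    moreover have "x \<oplus> w \<oplus> (x \<oplus> \<ominus> w) = x \<oplus> x" if "x \<in> carrier A" "w \<in> carrier A" for x w
      using that by algebra
    ultimately show ?thesis using v b unfolding U_def by (simp add: closed_simps)
  qed
  then have "2 * nrm A (b \<otimes> b) \<le> nrm A b + nrm A b"
    using nrm_triangle[OF U_closed[OF b(1)] U_closed[OF b(1)], of \<i> "- \<i>"] U_nrm b
    by (simp add: nrm_scale mult_closed)
  then have "nrm A b * nrm A b \<le> 1 * nrm A b"
    using cstar_identity[OF b(1)] b by (simp add: power2_eq_square)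
  then show ?thesis using nrm_nonneg[OF b(1)] by (cases "nrm A b = 0") auto
qed

end

lemma star_hom_closed: "star_hom h A B \<Longrightarrow> x \<in> carrier A \<Longrightarrow> h x \<in> carrier B"
  by (auto simp: star_hom_def)

lemma star_hom_comp: "star_hom h A B \<Longrightarrow> star_hom g B C \<Longrightarrow> star_hom (\<lambda>x. g (h x)) A C"
  by (auto simp: star_hom_def Pi_iff)

locale cstar_hom = A: cstar_algebra A + B: cstar_algebra B
  for A :: "'a cstar" and B :: "'b cstar" +
  fixes h assumes hom: "star_hom h A B"
begin

lemma hom_closed: "x \<in> carrier A \<Longrightarrow> h x \<in> carrier B"
  and hom_add: "\<lbrakk>x \<in> carrier A; y \<in> carrier A\<rbrakk> \<Longrightarrow> h (x \<oplus>\<^bsub>A\<^esub> y) = h x \<oplus>\<^bsub>B\<^esub> h y"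
  and hom_mult: "\<lbrakk>x \<in> carrier A; y \<in> carrier A\<rbrakk> \<Longrightarrow> h (x \<otimes>\<^bsub>A\<^esub> y) = h x \<otimes>\<^bsub>B\<^esub> h y"
  and hom_scale: "x \<in> carrier A \<Longrightarrow> h (scale A c x) = scale B c (h x)"
  and hom_star: "x \<in> carrier A \<Longrightarrow> h (star A x) = star B (h x)"
  using hom by (auto simp: star_hom_def)

lemma hom_zero: "h \<zero>\<^bsub>A\<^esub> = \<zero>\<^bsub>B\<^esub>"
  using hom_scale[of "\<zero>\<^bsub>A\<^esub>" 0] by (simp add: A.scale_zero_left B.scale_zero_left hom_closed)

lemma hom_minus: "x \<in> carrier A \<Longrightarrow> h (\<ominus>\<^bsub>A\<^esub> x) = \<ominus>\<^bsub>B\<^esub> h x"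
  by (simp add: A.minus_eq_scale B.minus_eq_scale hom_scale hom_closed)

lemma hom_finsum:
  "\<lbrakk>finite I; f \<in> I \<rightarrow> carrier A\<rbrakk> \<Longrightarrow> h (\<Oplus>\<^bsub>A\<^esub>i\<in>I. f i) = (\<Oplus>\<^bsub>B\<^esub>i\<in>I. h (f i))"
proof (induct set: finite)
  case empty then show ?case by (simp add: hom_zero)
next
  case (insert x F) then show ?case by (simp add: Pi_def hom_add hom_closed)
qed

text \<open>The equation for y in \<open>selfadjoint_unitary_part\<close> is algebraic, so h carries
  a solution for a in A to one for \<open>h a\<close> in B, where
  \<open>selfadjoint_nrm_le_1\<close> applies. A general x is reduced to x^* x divided by its norm,
  using the C*-identity in both algebras.\<close>

lemma hom_nrm_le: "x \<in> carrier A \<Longrightarrow> nrm B (h x) \<le> nrm A x"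
proof -
  assume x: "x \<in> carrier A"
  have unit_ball: "nrm B (h a) \<le> 1" if a: "a \<in> carrier A" "star A a = a" "nrm A a \<le> 1" for a
  proof -
    obtain y where y: "y \<in> carrier A" "star A y = y" "y \<otimes>\<^bsub>A\<^esub> a = a \<otimes>\<^bsub>A\<^esub> y"
      and eq: "y \<oplus>\<^bsub>A\<^esub> y = a \<otimes>\<^bsub>A\<^esub> a \<oplus>\<^bsub>A\<^esub> y \<otimes>\<^bsub>A\<^esub> y"
      by (rule A.selfadjoint_unitary_part[OF a])
    have "star B (h a) = h a" "star B (h y) = h y" "h y \<otimes>\<^bsub>B\<^esub> h a = h a \<otimes>\<^bsub>B\<^esub> h y"
      using a y by (metis hom_star hom_mult)+
    moreover have "h y \<oplus>\<^bsub>B\<^esub> h y = h a \<otimes>\<^bsub>B\<^esub> h a \<oplus>\<^bsub>B\<^esub> h y \<otimes>\<^bsub>B\<^esub> h y"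
      using arg_cong[OF eq, of h] a y by (simp add: hom_add hom_mult A.mult_closed)
    ultimately show ?thesis
      using a(1) y(1) by (intro B.selfadjoint_nrm_le_1[of "h a" "h y"]) (simp_all add: hom_closed)
  qed
  show ?thesis
  proof (cases "nrm A x = 0")
    case True
    then show ?thesis using x by (simp add: A.nrm_eq_0 hom_zero B.nrm_zero A.nrm_zero)
  next
    case False
    define r where "r = (nrm A x)\<^sup>2"
    have r: "r > 0" using False by (simp add: r_def)
    define a where "a = scale A (complex_of_real (1 / r)) (star A x \<otimes>\<^bsub>A\<^esub> x)"
    have "nrm B (h a) \<le> 1"
    proof (rule unit_ball)
      show "a \<in> carrier A" using x by (simp add: a_def A.closed_simps)
      show "star A a = a" using x
        by (simp add: a_def A.star_scale A.star_mult A.star_star A.closed_simps)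
      have "nrm A a = 1 / r * r" using x A.cstar_identity[OF x] r
        by (simp add: a_def A.nrm_scale A.closed_simps r_def[symmetric] norm_divide)
      then show "nrm A a \<le> 1" using r by simp
    qed
    moreover have "nrm B (h a) = 1 / r * (nrm B (h x))\<^sup>2"
      using x B.cstar_identity[OF hom_closed[OF x]] r
      by (simp add: a_def hom_scale hom_mult hom_star A.closed_simps B.nrm_scale B.closed_simps
        hom_closed norm_divide)
    ultimately have "(nrm B (h x))\<^sup>2 \<le> (nrm A x)\<^sup>2" using r by (simp add: r_def divide_simps)
    then show ?thesis using A.nrm_nonneg[OF x] by (rule power2_le_imp_le)
  qed
qed

end

section \<open>Uniqueness of the graph algebra\<close>

lemma closed_star_subalgebra_fixed_points:
  assumes "cstar_algebra A" and "star_hom k A A"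
  shows "closed_star_subalgebra {x \<in> carrier A. k x = x} A"
proof -
  interpret cstar_hom A A k using assms by (simp add: cstar_hom_def cstar_hom_axioms_def)
  have "k x = x" if \<sigma>: "\<And>n. \<sigma> n \<in> carrier A \<and> k (\<sigma> n) = \<sigma> n" and x: "x \<in> carrier A"
    and lim: "(\<lambda>n::nat. nrm A (\<sigma> n \<ominus>\<^bsub>A\<^esub> x)) \<longlonglongrightarrow> 0" for \<sigma> x
  proof -
    have "nrm A (k x \<ominus>\<^bsub>A\<^esub> x) \<le> 2 * nrm A (\<sigma> n \<ominus>\<^bsub>A\<^esub> x)" for n
    proof -
      let ?d = "\<sigma> n \<ominus>\<^bsub>A\<^esub> x"
      have d: "?d \<in> carrier A" using \<sigma> x by simp
      have kd: "k ?d = \<sigma> n \<ominus>\<^bsub>A\<^esub> k x" using \<sigma>[of n] x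
        by (simp add: a_minus_def hom_add hom_minus)
      \<comment> \<open>The fixed element \<open>\<sigma> n\<close> drops out, so both terms are
        controlled by its distance from x, the second one by contractivity of k.\<close>
      have "k x \<ominus>\<^bsub>A\<^esub> x = ?d \<ominus>\<^bsub>A\<^esub> k ?d"
        unfolding kd using \<sigma>[of n] x hom_closed[OF x] by algebra
      then show ?thesis
        using A.nrm_diff[OF d hom_closed[OF d]] hom_nrm_le[OF d] by simp
    qed
    note le = this
    have lim2: "(\<lambda>n. 2 * nrm A (\<sigma> n \<ominus>\<^bsub>A\<^esub> x)) \<longlonglongrightarrow> 2 * 0" by (intro tendsto_intros lim)
    have "nrm A (k x \<ominus>\<^bsub>A\<^esub> x) \<le> 2 * 0"
      by (rule LIMSEQ_le_const[OF lim2]) (use le in blast)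
    then have "k x \<ominus>\<^bsub>A\<^esub> x = \<zero>\<^bsub>A\<^esub>"
      using A.nrm_nonneg[of "k x \<ominus>\<^bsub>A\<^esub> x"] A.nrm_eq_0[of "k x \<ominus>\<^bsub>A\<^esub> x"] x hom_closed[OF x] by simp
    then show ?thesis using x hom_closed[OF x] by (simp add: A.diff_eq_zero_iff)
  qed
  then show ?thesis
    by (auto simp: closed_star_subalgebra_def hom_zero hom_add hom_mult hom_scale hom_star A.closed_simps)
qed

lemma generates_cstar_hom_id:
  assumes "cstar_algebra A" and "star_hom k A A" and "generates_cstar X A"
    and "\<And>x. x \<in> X \<Longrightarrow> k x = x" and "x \<in> carrier A"
  shows "k x = x"
proof -
  have "X \<subseteq> {x \<in> carrier A. k x = x}" using assms by (auto simp: generates_cstar_def)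
  then have "{x \<in> carrier A. k x = x} = carrier A"
    using assms(3) closed_star_subalgebra_fixed_points[OF assms(1,2)]
    unfolding generates_cstar_def by blast
  then show ?thesis using assms(5) by auto
qed

text \<open>The two algebras have elements of one type, so each is a test algebra for the other.
  Both composites of the resulting homomorphisms fix generators and hence are identities.\<close>

lemma graph_cstar_algebra_unique:
  fixes A B :: "'a cstar"
  assumes "graph_cstar_algebra G A" and "graph_cstar_algebra G B"
  shows "cstar_isomorphic A B"
proof -
  obtain P S where A: "cstar_algebra A" and PS: "universal_cuntz_krieger_family G A P S"
    using assms(1) by (auto simp: graph_cstar_algebra_def)
  obtain Q T where B: "cstar_algebra B" and QT: "universal_cuntz_krieger_family G B Q T"
    using assms(2) by (auto simp: graph_cstar_algebra_def)
  obtain h where h: "star_hom h A B" "\<And>v. v \<in> verts G \<Longrightarrow> h (P v) = Q v" "\<And>e. e \<in> arcs G \<Longrightarrow> h (S e) = T e"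
    using PS B QT unfolding universal_cuntz_krieger_family_def by metis
  obtain g where g: "star_hom g B A" "\<And>v. v \<in> verts G \<Longrightarrow> g (Q v) = P v" "\<And>e. e \<in> arcs G \<Longrightarrow> g (T e) = S e"
    using QT A PS unfolding universal_cuntz_krieger_family_def by metis
  have gh: "g (h x) = x" if "x \<in> carrier A" for x
    by (rule generates_cstar_hom_id[OF A star_hom_comp[OF h(1) g(1)], of "P ` verts G \<union> S ` arcs G"])
      (use PS h g that in \<open>auto simp: universal_cuntz_krieger_family_def\<close>)
  have hg: "h (g y) = y" if "y \<in> carrier B" for y
    by (rule generates_cstar_hom_id[OF B star_hom_comp[OF g(1) h(1)], of "Q ` verts G \<union> T ` arcs G"])
      (use QT h g that in \<open>auto simp: universal_cuntz_krieger_family_def\<close>)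
  have "bij_betw h (carrier A) (carrier B)"
    by (rule bij_betw_byWitness[where f' = g]) (use gh hg star_hom_closed[OF h(1)] star_hom_closed[OF g(1)] in auto)
  then show ?thesis using h(1) by (auto simp: cstar_isomorphic_def)
qed

subsection \<open>Cuntz-Krieger families\<close>

locale ck_family = cstar_algebra A + wf_digraph G
  for A :: "'a cstar" (structure) and G :: "('v, 'e) pre_digraph" +
  fixes P S
  assumes ck: "cuntz_krieger_family G A P S" and row_finite: "row_finite G" and no_sinks: "no_sinks G"
begin

lemma P_closed: "v \<in> verts G \<Longrightarrow> P v \<in> carrier A"
  and P_star: "v \<in> verts G \<Longrightarrow> star A (P v) = P v"
  and P_idem: "v \<in> verts G \<Longrightarrow> P v \<otimes> P v = P v"
  and P_orth: "\<lbrakk>v \<in> verts G; w \<in> verts G; v \<noteq> w\<rbrakk> \<Longrightarrow> P v \<otimes> P w = \<zero>"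
  and P_proj: "v \<in> verts G \<Longrightarrow> projection A (P v)"
  and S_closed: "e \<in> arcs G \<Longrightarrow> S e \<in> carrier A"
  and S_partial: "e \<in> arcs G \<Longrightarrow> S e \<otimes> star A (S e) \<otimes> S e = S e"
  and S_star_S: "e \<in> arcs G \<Longrightarrow> star A (S e) \<otimes> S e = P (head G e)"
  using ck by (auto simp: cuntz_krieger_family_def projection_def partial_isometry_def)

lemma out_arcs_finite: "v \<in> verts G \<Longrightarrow> finite (out_arcs G v)"
  using row_finite by (simp add: row_finite_def)

lemma P_sum: "v \<in> verts G \<Longrightarrow> P v = (\<Oplus>e \<in> out_arcs G v. S e \<otimes> star A (S e))"
  using ck no_sinks by (fastforce simp: cuntz_krieger_family_def no_sinks_def out_arcs_def)

lemma S_P_head: "e \<in> arcs G \<Longrightarrow> S e \<otimes> P (head G e) = S e"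
  using S_partial[of e] by (simp add: S_star_S[symmetric] mult_assoc S_closed star_closed)

lemma range_projection: "e \<in> arcs G \<Longrightarrow> projection A (S e \<otimes> star A (S e))"
  using S_partial[of e] S_closed[of e]
  by (simp add: projection_def closed_simps star_mult star_star mult_assoc[symmetric])

text \<open>Expand the projection at the tail as a sum of range projections. These are mutually
  orthogonal because their sum is again a projection, so only the one of e survives against
  S_e.\<close>

lemma P_tail_S: assumes e: "e \<in> arcs G" shows "P (tail G e) \<otimes> S e = S e"
proof -
  let ?q = "\<lambda>e. S e \<otimes> star A (S e)"
  let ?I = "out_arcs G (tail G e)"
  have v: "tail G e \<in> verts G" using e by simp
  have I: "finite ?I" "e \<in> ?I" and q: "\<And>f. f \<in> ?I \<Longrightarrow> projection A (?q f)"
    using e out_arcs_finite[OF v] range_projection by auto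
  have qc: "\<And>f. f \<in> ?I \<Longrightarrow> ?q f \<in> carrier A" using q by (auto simp: projection_def)
  have "projection A (\<Oplus>f\<in>?I. ?q f)" using P_sum[OF v] P_proj[OF v] by simp
  then have orth: "?q f \<otimes> ?q e = \<zero>" if "f \<in> ?I" "f \<noteq> e" for f
    using projections_sum_orthogonal[of ?I ?q f e] I q that by auto
  have "P (tail G e) \<otimes> ?q e = (\<Oplus>f\<in>?I. ?q f \<otimes> ?q e)"
    unfolding P_sum[OF v] using I qc by (intro finsum_mult_right) auto
  also have "\<dots> = ?q e \<otimes> ?q e"
    using I qc orth by (intro finsum_single) (auto simp: mult_closed)
  also have "\<dots> = ?q e" using q[OF I(2)] by (simp add: projection_def)
  finally have "P (tail G e) \<otimes> ?q e \<otimes> S e = ?q e \<otimes> S e" by simp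
  then show ?thesis using S_partial[OF e] v e
    by (simp add: mult_assoc S_closed P_closed closed_simps)
qed

lemma S_star_P_tail: "e \<in> arcs G \<Longrightarrow> star A (S e) \<otimes> P (tail G e) = star A (S e)"
  using arg_cong[OF P_tail_S[of e], of "star A"]
  by (simp add: star_mult P_star S_closed P_closed)

lemma P_head_S_star: "e \<in> arcs G \<Longrightarrow> P (head G e) \<otimes> star A (S e) = star A (S e)"
  using arg_cong[OF S_P_head[of e], of "star A"]
  by (simp add: star_mult P_star S_closed P_closed)

text \<open>Edges with different tails are separated by the vertex projections, edges with a common
  tail by their range projections.\<close>

lemma S_orth:
  assumes e: "e \<in> arcs G" and f: "f \<in> arcs G" and "e \<noteq> f"
  shows "star A (S e) \<otimes> S f = \<zero>"
proof (cases "tail G e = tail G f")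
  case False
  have "star A (S e) \<otimes> S f = (star A (S e) \<otimes> P (tail G e)) \<otimes> (P (tail G f) \<otimes> S f)"
    using e f by (simp add: S_star_P_tail P_tail_S)
  also have "\<dots> = star A (S e) \<otimes> ((P (tail G e) \<otimes> P (tail G f)) \<otimes> S f)"
    using e f by (simp add: mult_assoc closed_simps S_closed P_closed)
  finally show ?thesis using e f False
    by (simp add: P_orth mult_zero_left mult_zero_right S_closed closed_simps)
next
  case True
  let ?q = "\<lambda>e. S e \<otimes> star A (S e)"
  let ?I = "out_arcs G (tail G e)"
  have v: "tail G e \<in> verts G" using e by simp
  have "projection A (\<Oplus>f\<in>?I. ?q f)" using P_sum[OF v] P_proj[OF v] by simp
  then have orth: "?q e \<otimes> ?q f = \<zero>"
    using projections_sum_orthogonal[of ?I ?q e f] out_arcs_finite[OF v] range_projection assms True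
    by auto
  have se: "star A (S e) \<otimes> ?q e = star A (S e)"
    using arg_cong[OF S_partial[OF e], of "star A"] e
    by (simp add: star_mult star_star S_closed closed_simps)
  have "star A (S e) \<otimes> S f = (star A (S e) \<otimes> ?q e) \<otimes> (?q f \<otimes> S f)"
    unfolding se S_partial[OF f] ..
  also have "\<dots> = star A (S e) \<otimes> ((?q e \<otimes> ?q f) \<otimes> S f)"
    using e f by (simp add: mult_assoc closed_simps S_closed)
  finally show ?thesis using e f
    by (simp add: orth mult_zero_left mult_zero_right S_closed closed_simps)
qed

end

section \<open>Infinite paths\<close>

text \<open>The infinite concatenation of blocks, by recursion on the position n. The disjunct
  \<open>\<phi> (x 0) = []\<close> ends the recursion at an empty block, past which n would not
  decrease.\<close>

function subst_word :: "('e \<Rightarrow> 'f list) \<Rightarrow> 'e word \<Rightarrow> 'f word" where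
  "subst_word \<phi> x n = (if n < length (\<phi> (x 0)) \<or> \<phi> (x 0) = [] then \<phi> (x 0) ! n
     else subst_word \<phi> (suffix 1 x) (n - length (\<phi> (x 0))))"
  by auto
termination
proof (relation "Wellfounded.measure (\<lambda>(_, _, n). n)", goal_cases)
  case (2 \<phi> x n)
  then show ?case by (cases "\<phi> (x 0)") auto
qed simp

declare subst_word.simps [simp del]

lemma subst_word_unfold:
  "\<phi> (x 0) \<noteq> [] \<Longrightarrow> subst_word \<phi> x = \<phi> (x 0) \<frown> subst_word \<phi> (suffix 1 x)"
  by (rule ext, subst subst_word.simps) (auto simp: conc_def)

lemma subst_word_conc:
  "(\<And>e. e \<in> set p \<Longrightarrow> \<phi> e \<noteq> []) \<Longrightarrow>
    subst_word \<phi> (p \<frown> x) = concat (map \<phi> p) \<frown> subst_word \<phi> x"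
proof (induct p)
  case (Cons e p)
  then show ?case using subst_word_unfold[of \<phi> "e ## p \<frown> x"] by (simp add: suffix_def)
qed simp

lemma conc_first_two: "[x 0, x 1] \<frown> suffix 2 x = x"
proof
  fix n
  show "([x 0, x 1] \<frown> suffix 2 x) n = x n"
  proof (cases n)
    case (Suc m)
    then show ?thesis by (cases m) simp_all
  qed simp
qed

lemma conc_eq_conc:
  "\<lbrakk>p \<frown> z = p' \<frown> z'; length p \<le> length p'\<rbrakk> \<Longrightarrow> \<exists>r. p' = p @ r \<and> z = r \<frown> z'"
proof (induct p arbitrary: p')
  case (Cons a p)
  then show ?case by (cases p') auto
qed simp

lemma conc_eq_same_length:
  "p \<frown> z = p' \<frown> z' \<Longrightarrow> length p = length p' \<Longrightarrow> p = p' \<and> z = z'"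
  by (metis conc_eq_conc append.right_neutral append_eq_conv_conj conc_empty order_refl take_all)

text \<open>This turns the condition on large indices into the shape of the elements of
  cylinders.\<close>

lemma shift_tail_equiv_iff:
  "shift_tail_equiv x k y \<longleftrightarrow>
    (\<exists>p q z. x = p \<frown> z \<and> y = q \<frown> z \<and> k = int (length p) - int (length q))"
proof
  assume "shift_tail_equiv x k y"
  then obtain M where M: "\<And>i. i \<ge> M \<Longrightarrow> x i = y (nat (int i - k))"
    by (auto simp: shift_tail_equiv_def eventually_sequentially)
  \<comment> \<open>The cut lies past M and not before k, so that the matching position m - k in y
    is a natural number.\<close>
  define m where "m = max M (nat k)"
  define n where "n = nat (int m - k)"
  have "k \<le> int m" by (simp add: m_def of_nat_max)
  then have mn: "int n = int m - k" by (simp add: n_def)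
  have "suffix m x = suffix n y"
  proof
    fix i
    have "nat (int (m + i) - k) = n + i" using mn by simp
    then show "suffix m x i = suffix n y i" using M[of "m + i"] by (simp add: m_def)
  qed
  then have "x = prefix m x \<frown> suffix m x \<and> y = prefix n y \<frown> suffix m x
      \<and> k = int (length (prefix m x)) - int (length (prefix n y))"
    using mn prefix_suffix[of x m] prefix_suffix[of y n] by simp
  then show "\<exists>p q z. x = p \<frown> z \<and> y = q \<frown> z \<and> k = int (length p) - int (length q)" by blast
next
  assume "\<exists>p q z. x = p \<frown> z \<and> y = q \<frown> z \<and> k = int (length p) - int (length q)"
  then obtain p q z where *: "x = p \<frown> z" "y = q \<frown> z" "k = int (length p) - int (length q)" by blast
  have "x i = y (nat (int i - k))" if "i \<ge> length p" for i
  proof -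
    have "nat (int i - k) = length q + (i - length p)" using that by (simp add: *)
    then show ?thesis using that by (simp add: *)
  qed
  then show "shift_tail_equiv x k y" by (auto simp: shift_tail_equiv_def eventually_sequentially)
qed

lemma build_infinite_paths_iff:
  "e ## x \<in> infinite_paths G \<longleftrightarrow> e \<in> arcs G \<and> head G e = tail G (x 0) \<and> x \<in> infinite_paths G"
proof -
  have "(\<forall>n. P n) \<longleftrightarrow> P 0 \<and> (\<forall>n. P (Suc n))" for P by (metis not0_implies_Suc)
  from this[of "\<lambda>n. (e ## x) n \<in> arcs G \<and> head G ((e ## x) n) = tail G ((e ## x) (Suc n))"]
  show ?thesis by (auto simp: infinite_paths_def)
qed

lemma infinite_paths_suffix: "x \<in> infinite_paths G \<Longrightarrow> suffix n x \<in> infinite_paths G"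
  by (simp add: infinite_paths_def)

lemma infinite_paths_arcs: "x \<in> infinite_paths G \<Longrightarrow> x n \<in> arcs G"
  by (simp add: infinite_paths_def)

context wf_digraph
begin

lemma conc_infinite_paths_iff:
  "p \<frown> x \<in> infinite_paths G \<longleftrightarrow> x \<in> infinite_paths G \<and> (\<exists>u. awalk u p (tail G (x 0)))"
proof (induct p)
  case Nil
  then show ?case by (auto simp: awalk_Nil_iff infinite_paths_arcs)
next
  case (Cons e p)
  have *: "awalk u p (tail G (x 0)) \<Longrightarrow> tail G ((p \<frown> x) 0) = u" for u
    by (cases p) (auto simp: awalk_Cons_iff awalk_Nil_iff)
  show ?case unfolding build_cons build_infinite_paths_iff Cons
    using * by (fastforce simp: awalk_Cons_iff)
qed

lemma awalk_infinite_path: "awalk u p (tail G (x 0)) \<Longrightarrow> tail G ((p \<frown> x) 0) = u"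
  by (cases p) (auto simp: awalk_Cons_iff awalk_Nil_iff)

lemma cylinder_subset_arrows:
  "awalk u p v \<Longrightarrow> awalk w q v \<Longrightarrow> cylinder G p q v \<subseteq> arrows (path_groupoid G)"
  unfolding cylinder_def path_groupoid_def
  by (auto simp: conc_infinite_paths_iff shift_tail_equiv_iff)

text \<open>The record \<open>top_groupoid\<close> does not tie the topology to the arrows. The
  prefixes from \<open>shift_tail_equiv_iff\<close> give a basic set around each arrow.\<close>

lemma topspace_path_groupoid: "topspace (gtop (path_groupoid G)) = arrows (path_groupoid G)"
proof -
  have "\<exists>u w p q v. awalk u p v \<and> awalk w q v \<and> a \<in> cylinder G p q v"
    if a: "a \<in> arrows (path_groupoid G)" for a
  proof -
    obtain p q z where *: "a = (p \<frown> z, int (length p) - int (length q), q \<frown> z)"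
      "p \<frown> z \<in> infinite_paths G" "q \<frown> z \<in> infinite_paths G"
      using a by (auto simp: path_groupoid_def shift_tail_equiv_iff)
    then show ?thesis unfolding conc_infinite_paths_iff cylinder_def by blast
  qed
  moreover have "topspace (gtop (path_groupoid G)) =
      \<Union> {cylinder G p q v | u w p q v. awalk u p v \<and> awalk w q v}"
    by (simp add: path_groupoid_def)
  ultimately show ?thesis using cylinder_subset_arrows by blast
qed

lemma openin_cylinder:
  "awalk u p v \<Longrightarrow> awalk w q v \<Longrightarrow> openin (gtop (path_groupoid G)) (cylinder G p q v)"
  by (simp add: path_groupoid_def, rule topology_generated_by_Basis) blast

end

lemma continuous_map_path_groupoid:
  assumes "wf_digraph G" and "f ` topspace X \<subseteq> arrows (path_groupoid G)"
    and "\<And>u w p q v. \<lbrakk>pre_digraph.awalk G u p v; pre_digraph.awalk G w q v\<rbrakk> \<Longrightarrow>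
      openin X (f -` cylinder G p q v \<inter> topspace X)"
  shows "continuous_map X (gtop (path_groupoid G)) f"
proof -
  let ?C = "{cylinder G p q v | u w p q v. pre_digraph.awalk G u p v \<and> pre_digraph.awalk G w q v}"
  have gtop: "gtop (path_groupoid G) = topology_generated_by ?C" by (simp add: path_groupoid_def)
  have "f ` topspace X \<subseteq> topspace (gtop (path_groupoid G))"
    using assms(2) unfolding wf_digraph.topspace_path_groupoid[OF assms(1)] .
  then have "f ` topspace X \<subseteq> \<Union> ?C" unfolding gtop topology_generated_by_topspace .
  moreover have "openin X (f -` U \<inter> topspace X)" if "U \<in> ?C" for U using that assms(3) by blast
  ultimately show ?thesis unfolding gtop by (intro continuous_on_generated_topo)
qed

section \<open>Edge substitutions\<close>

text \<open>The edges of \<open>G\<close> correspond to blocks of one or two edges of \<open>H\<close>; whether an edge ends its block can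
  be read off the edge: it does unless it lies in \<open>N\<close>. With \<open>N = {}\<close> this is a graph isomorphism.\<close>

locale edge_substitution = G: wf_digraph G + H: wf_digraph H
  for G :: "('v, 'e) pre_digraph" and H :: "('w, 'f) pre_digraph" +
  fixes h :: "'v \<Rightarrow> 'w" and \<phi> :: "'e \<Rightarrow> 'f list" and N :: "'f set"
  assumes vertices: "bij_betw h (verts G) (verts H)"
    and blocks: "bij_betw \<phi> (arcs G) ({[f] |f. f \<in> arcs H - N} \<union>
      {[a, b] |a b. a \<in> arcs H \<inter> N \<and> b \<in> arcs H - N \<and> head H a = tail H b})"
    and tail_block: "e \<in> arcs G \<Longrightarrow> tail H (hd (\<phi> e)) = h (tail G e)"
    and head_block: "e \<in> arcs G \<Longrightarrow> head H (last (\<phi> e)) = h (head G e)"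
    and isolated: "\<lbrakk>a \<in> arcs H; a \<in> N; b \<in> arcs H; head H a = tail H b\<rbrakk> \<Longrightarrow> b \<notin> N"
begin

abbreviation "\<sigma> \<equiv> subst_word \<phi>"

definition subst_list :: "'e list \<Rightarrow> 'f list" where
  "subst_list p = concat (map \<phi> p)"

lemma subst_list_simps [simp]:
  "subst_list [] = []" "subst_list (e # p) = \<phi> e @ subst_list p"
  "subst_list (p @ q) = subst_list p @ subst_list q"
  by (simp_all add: subst_list_def)

lemma block_cases:
  assumes "e \<in> arcs G"
  obtains f where "\<phi> e = [f]" "f \<in> arcs H" "f \<notin> N"
  | a b where "\<phi> e = [a, b]" "a \<in> arcs H" "a \<in> N" "b \<in> arcs H" "b \<notin> N" "head H a = tail H b"
proof -
  have "\<phi> e \<in> {[f] |f. f \<in> arcs H - N} \<union>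
      {[a, b] |a b. a \<in> arcs H \<inter> N \<and> b \<in> arcs H - N \<and> head H a = tail H b}"
    using blocks assms by (auto simp: bij_betw_def)
  then show thesis using that by blast
qed

lemma block_nonempty: "e \<in> arcs G \<Longrightarrow> \<phi> e \<noteq> []"
  by (erule block_cases) auto

lemma block_inj: "\<lbrakk>e \<in> arcs G; e' \<in> arcs G; \<phi> e = \<phi> e'\<rbrakk> \<Longrightarrow> e = e'"
  using blocks by (auto simp: bij_betw_def inj_on_def)

lemma single_block:
  assumes "f \<in> arcs H" "f \<notin> N"
  obtains e where "e \<in> arcs G" "\<phi> e = [f]"
proof -
  have "[f] \<in> \<phi> ` arcs G" unfolding bij_betw_imp_surj_on[OF blocks] using assms by simp
  then show thesis using that by force
qed

lemma double_block:
  assumes "a \<in> arcs H" "a \<in> N" "b \<in> arcs H" "head H a = tail H b"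
  obtains e where "e \<in> arcs G" "\<phi> e = [a, b]"
proof -
  have "b \<notin> N" using isolated assms by blast
  with assms have "[a, b] \<in> \<phi> ` arcs G" unfolding bij_betw_imp_surj_on[OF blocks] by simp
  then show thesis using that by force
qed

lemma h_inj: "\<lbrakk>v \<in> verts G; w \<in> verts G; h v = h w\<rbrakk> \<Longrightarrow> v = w"
  using vertices by (auto simp: bij_betw_def inj_on_def)

lemma h_verts: "v \<in> verts G \<Longrightarrow> h v \<in> verts H"
  using vertices by (auto simp: bij_betw_def)

section \<open>Encoding and decoding of infinite paths\<close>

lemma subst_word_block:
  "x 0 \<in> arcs G \<Longrightarrow> \<sigma> x = \<phi> (x 0) \<frown> \<sigma> (suffix 1 x)"
  by (rule subst_word_unfold) (rule block_nonempty)

lemma subst_word_conc_arcs: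
  "set p \<subseteq> arcs G \<Longrightarrow> \<sigma> (p \<frown> x) = subst_list p \<frown> \<sigma> x"
  unfolding subst_list_def by (rule subst_word_conc) (auto dest: block_nonempty)

text \<open>Blocks form a prefix code: the first letter lies in N exactly if the block has two
  letters.\<close>

lemma block_conc_inj:
  assumes e: "e \<in> arcs G" and e': "e' \<in> arcs G" and eq: "\<phi> e \<frown> Y = \<phi> e' \<frown> Y'"
  shows "e = e' \<and> Y = Y'"
proof -
  have "\<phi> e = \<phi> e'"
    using e
  proof (cases rule: block_cases)
    case (1 f)
    note this[simp]
    show ?thesis using e' by (cases rule: block_cases) (use eq in auto)
  next
    case (2 a b)
    note this[simp]
    show ?thesis using e' by (cases rule: block_cases) (use eq in auto)
  qed
  then show ?thesis using eq block_inj[OF e e'] by auto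
qed

lemma subst_word_inj:
  assumes "\<sigma> x = \<sigma> y" and "range x \<subseteq> arcs G" and "range y \<subseteq> arcs G"
  shows "x = y"
proof
  fix n
  show "x n = y n"
    using assms
  proof (induct n arbitrary: x y)
    case 0
    then have "x 0 \<in> arcs G" "y 0 \<in> arcs G" by auto
    then show ?case using 0(1) block_conc_inj by (metis subst_word_block)
  next
    case (Suc n)
    have *: "x 0 \<in> arcs G" "y 0 \<in> arcs G" using Suc(3,4) by auto
    then have "\<sigma> (suffix 1 x) = \<sigma> (suffix 1 y)" using Suc(2) block_conc_inj by (metis subst_word_block)
    moreover have "range (suffix 1 x) \<subseteq> arcs G" "range (suffix 1 y) \<subseteq> arcs G"
      using Suc(3,4) by auto
    ultimately have "suffix 1 x n = suffix 1 y n" by (rule Suc(1))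
    then show ?case by simp
  qed
qed

lemma hd_block: "e \<in> arcs G \<Longrightarrow> hd (\<phi> e) = (\<phi> e \<frown> Y) 0"
  by (erule block_cases) auto

lemma tail_subst_word: "x \<in> infinite_paths G \<Longrightarrow> tail H (\<sigma> x 0) = h (tail G (x 0))"
  using hd_block[of "x 0"] tail_block[of "x 0"] subst_word_block[of x] infinite_paths_arcs[of x G 0]
  by metis

lemma subst_word_path:
  assumes "x \<in> infinite_paths G"
  shows "\<sigma> x \<in> infinite_paths H"
proof -
  have "\<sigma> x n \<in> arcs H \<and> head H (\<sigma> x n) = tail H (\<sigma> x (Suc n))" for n
    using assms
  proof (induct n arbitrary: x rule: less_induct)
    case (less n)
    let ?x' = "suffix 1 x"
    have x': "?x' \<in> infinite_paths G" by (rule infinite_paths_suffix[OF less(2)])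
    have e: "x 0 \<in> arcs G" by (rule infinite_paths_arcs[OF less(2)])
    have unf: "\<sigma> x = \<phi> (x 0) \<frown> \<sigma> ?x'" by (rule subst_word_block[of x, OF e])
    have hd': "head H (last (\<phi> (x 0))) = tail H (\<sigma> ?x' 0)"
      using less(2) e x' by (simp add: head_block tail_subst_word) (simp add: infinite_paths_def)
    have IH: "\<sigma> ?x' m \<in> arcs H \<and> head H (\<sigma> ?x' m) = tail H (\<sigma> ?x' (Suc m))" if "m < n" for m
      by (rule less(1)[OF that x'])
    from e show ?case
    proof (cases rule: block_cases)
      case (1 f)
      then have "\<sigma> x = f ## \<sigma> ?x'" using unf by simp
      then show ?thesis using 1 hd' IH by (cases n) simp_all
    next
      case (2 a b)
      then have s: "\<sigma> x = a ## b ## \<sigma> ?x'" using unf by simp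
      show ?thesis
      proof (cases n)
        case (Suc m)
        then show ?thesis using s 2 hd' IH by (cases m) simp_all
      qed (use s 2 in simp)
    qed
  qed
  then show ?thesis by (simp add: infinite_paths_def)
qed

lemma first_block:
  assumes "X \<in> infinite_paths H"
  obtains e Y where "e \<in> arcs G" "Y \<in> infinite_paths H" "X = \<phi> e \<frown> Y"
proof (cases "X 0 \<in> N")
  case False
  then obtain e where "e \<in> arcs G" "\<phi> e = [X 0]"
    using single_block[of "X 0"] infinite_paths_arcs[OF assms] by blast
  then show thesis using that[of e "suffix 1 X"] infinite_paths_suffix[OF assms] by simp
next
  case True
  have "head H (X 0) = tail H (X 1)" using assms by (simp add: infinite_paths_def)
  then obtain e where "e \<in> arcs G" "\<phi> e = [X 0, X 1]"
    using double_block[of "X 0" "X 1"] infinite_paths_arcs[OF assms] True by blast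
  then show thesis
    using that[of e "suffix 2 X"] infinite_paths_suffix[OF assms] conc_first_two[of X] by metis
qed

lemma subst_word_surj:
  assumes "X \<in> infinite_paths H"
  obtains x where "x \<in> infinite_paths G" "\<sigma> x = X"
proof -
  \<comment> \<open>D splits off the first block of X and pairs the arc it encodes with the
    remaining path; iterating its second component reads X block by block.\<close>
  define D where "D X = (SOME B. fst B \<in> arcs G \<and> snd B \<in> infinite_paths H \<and>
    \<phi> (fst B) \<frown> snd B = X)" for X
  define d where "d X n = fst (D (((snd \<circ> D) ^^ n) X))" for X n
  have D: "fst (D X) \<in> arcs G \<and> snd (D X) \<in> infinite_paths H \<and> \<phi> (fst (D X)) \<frown> snd (D X) = X"
    if "X \<in> infinite_paths H" for X
    unfolding D_def by (rule someI_ex) (use first_block[OF that] in \<open>metis fst_conv snd_conv\<close>)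
  have rest: "((snd \<circ> D) ^^ n) X \<in> infinite_paths H" if "X \<in> infinite_paths H" for X n
    using that D by (induct n) auto
  have d_Suc: "suffix 1 (d X) = d (snd (D X))" for X
    by (rule ext) (simp add: d_def funpow_swap1)
  have "d X \<in> infinite_paths G"
  proof -
    have "d X n \<in> arcs G \<and> head G (d X n) = tail G (d X (Suc n))" for n
    proof -
      define X' where "X' = ((snd \<circ> D) ^^ n) X"
      define Y where "Y = snd (D X')"
      have X': "X' \<in> infinite_paths H" unfolding X'_def by (rule rest[OF assms])
      have Y: "Y \<in> infinite_paths H" using D[OF X'] by (simp add: Y_def)
      let ?e = "fst (D X')" and ?e' = "fst (D Y)"
      have e: "?e \<in> arcs G" "?e' \<in> arcs G" using D[OF X'] D[OF Y] by auto
      have eq: "\<phi> ?e \<frown> Y = X'" using D[OF X'] by (simp add: Y_def)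
      \<comment> \<open>Consecutive blocks meet in a vertex of H, and injectivity of h carries this
        over to the decoded arcs.\<close>
      have "head H (last (\<phi> ?e)) = tail H (Y 0)"
        using e(1)
      proof (cases rule: block_cases)
        case (1 f)
        then have "f ## Y \<in> infinite_paths H" using eq X' by simp
        then show ?thesis using 1 by (simp add: build_infinite_paths_iff)
      next
        case (2 a b)
        then have "a ## b ## Y \<in> infinite_paths H" using eq X' by simp
        then show ?thesis using 2 by (simp add: build_infinite_paths_iff)
      qed
      also have "Y 0 = hd (\<phi> ?e')" using D[OF Y] hd_block[OF e(2)] by metis
      finally have "h (head G ?e) = h (tail G ?e')" using e by (simp add: head_block tail_block)
      then have "head G ?e = tail G ?e'" using e by (intro h_inj) auto
      then show ?thesis using e by (simp add: d_def X'_def Y_def)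
    qed
    then show ?thesis by (simp add: infinite_paths_def)
  qed
  moreover have "\<sigma> (d X) n = X n" if "X \<in> infinite_paths H" for X n
    using that
  proof (induct n arbitrary: X rule: less_induct)
    case (less n)
    have d0: "d X 0 = fst (D X)" by (simp add: d_def)
    have e: "d X 0 \<in> arcs G" using D[OF less(2)] d0 by simp
    have "\<sigma> (d X) = \<phi> (d X 0) \<frown> \<sigma> (d (snd (D X)))"
      using subst_word_block[of "d X"] e d_Suc by simp
    moreover have "\<phi> (d X 0) \<frown> snd (D X) = X" using D[OF less(2)] d0 by simp
    moreover have "\<sigma> (d (snd (D X))) m = snd (D X) m" if "m < n" for m
      using less(1)[OF that] D[OF less(2)] by blast
    moreover have "length (\<phi> (d X 0)) > 0" using block_nonempty[OF e] by simp
    ultimately show ?case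
      by (metis conc_fst conc_snd diff_less gr_zeroI length_0_conv less_nat_zero_code not_less_zero)
  qed
  ultimately show thesis using that assms by blast
qed

text \<open>The condition on \<open>last P\<close> says that P does not stop inside a block; as P is
  part of a path, each of its arcs in N is then followed by one that completes the block. One or two
  letters are consumed at a time, hence the induction on the length.\<close>

lemma list_into_blocks:
  assumes "P \<frown> Z \<in> infinite_paths H" and "P = [] \<or> last P \<notin> N"
  obtains p where "set p \<subseteq> arcs G" "P = subst_list p"
  using assms
proof (induct "length P" arbitrary: P thesis rule: less_induct)
  case less
  show ?case
  proof (cases P)
    case Nil
    then show ?thesis using less(2)[of "[]"] by simp
  next
    case (Cons a P')
    have a: "a \<in> arcs H" "P' \<frown> Z \<in> infinite_paths H" "head H a = tail H ((P' \<frown> Z) 0)"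
      using less(3) Cons by (simp_all add: build_infinite_paths_iff)
    show ?thesis
    proof (cases "a \<in> N")
      case False
      obtain p where "set p \<subseteq> arcs G" "P' = subst_list p"
        using less(1)[of P'] Cons a less(4) by (auto split: if_splits)
      moreover obtain e where "e \<in> arcs G" "\<phi> e = [a]" using single_block a False by blast
      ultimately show ?thesis using less(2)[of "e # p"] Cons by simp
    next
      case True
      then obtain b Q where Q: "P' = b # Q" using less(4) Cons by (cases P') auto
      have b: "b \<in> arcs H" "Q \<frown> Z \<in> infinite_paths H" "head H a = tail H b"
        using a Q by (simp_all add: build_infinite_paths_iff)
      obtain p where "set p \<subseteq> arcs G" "Q = subst_list p"
        using less(1)[of Q] Cons Q b less(4) by (auto split: if_splits)
      moreover obtain e where "e \<in> arcs G" "\<phi> e = [a, b]" using double_block a b True by blast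
      ultimately show ?thesis using less(2)[of "e # p"] Cons Q by simp
    qed
  qed
qed

text \<open>A common tail of two substituted paths may start in the middle of a block, but then it does so
  in both of them, and the next edge ends the block.\<close>

lemma common_tail_blocks:
  assumes x: "x \<in> infinite_paths G" "\<sigma> x = P \<frown> Z" and y: "y \<in> infinite_paths G" "\<sigma> y = Q \<frown> Z"
  obtains r p q z where "x = p \<frown> z" "y = q \<frown> z" "subst_list p = P @ r" "subst_list q = Q @ r"
    "Z = r \<frown> \<sigma> z" "z \<in> infinite_paths G" "set p \<subseteq> arcs G" "set q \<subseteq> arcs G"
proof -
  have PZ: "P \<frown> Z \<in> infinite_paths H" and QZ: "Q \<frown> Z \<in> infinite_paths H"
    using subst_word_path x y by metis+
  then have Z: "Z \<in> infinite_paths H" by (simp add: H.conc_infinite_paths_iff)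
  \<comment> \<open>Reading on to the first arc outside N puts the ends of \<open>P @ r\<close> and
    \<open>Q @ r\<close> on block boundaries. As r depends on Z alone, it serves both paths.\<close>
  obtain r Z' where r: "Z = r \<frown> Z'" "r \<noteq> []" "last r \<notin> N"
  proof (cases "Z 0 \<in> N")
    case False
    then show thesis using that[of "[Z 0]" "suffix 1 Z"] by simp
  next
    case True
    have "head H (Z 0) = tail H (Z 1)" using Z by (simp add: infinite_paths_def)
    then have "Z 1 \<notin> N" using isolated True infinite_paths_arcs[OF Z] by blast
    then show thesis using that[of "[Z 0, Z 1]" "suffix 2 Z"] conc_first_two[of Z] by simp
  qed
  have Z': "Z' \<in> infinite_paths H" using Z r by (simp add: H.conc_infinite_paths_iff)
  obtain z where z: "z \<in> infinite_paths G" "\<sigma> z = Z'" using subst_word_surj[OF Z'] by blast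
  have decode: "\<exists>p. set p \<subseteq> arcs G \<and> P @ r = subst_list p \<and> x = p \<frown> z"
    if x: "x \<in> infinite_paths G" "\<sigma> x = P \<frown> Z" for x P
  proof -
    have "(P @ r) \<frown> Z' \<in> infinite_paths H"
      using subst_word_path[OF x(1)] x(2) r(1) by simp
    then obtain p where p: "set p \<subseteq> arcs G" "P @ r = subst_list p"
      using list_into_blocks[of "P @ r" Z'] r by auto
    have "\<sigma> x = \<sigma> (p \<frown> z)"
      using p z x(2) r(1) by (simp add: subst_word_conc_arcs flip: p(2))
    then have "x = p \<frown> z"
      using p(1) z(1) x(1) by (intro subst_word_inj) (auto simp: infinite_paths_def)
    then show ?thesis using p by blast
  qed
  show thesis using decode[OF x] decode[OF y] that[of _ z _ r] z r by metis
qed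

section \<open>Lengths and lags under substitution\<close>

lemma subst_list_length_pos: "set s \<subseteq> arcs G \<Longrightarrow> s \<noteq> [] \<Longrightarrow> length (subst_list s) > 0"
  using block_nonempty by (cases s) auto

text \<open>k is the integer of an arrow of G and l that of its image in H. This is a relation of
  all four because k alone does not determine l: what counts is how many edges of the two prefixes
  have blocks of length two.\<close>

definition lag :: "'e word \<Rightarrow> int \<Rightarrow> 'e word \<Rightarrow> int \<Rightarrow> bool" where
  "lag x k y l \<longleftrightarrow> (\<exists>p q z. x = p \<frown> z \<and> y = q \<frown> z \<and> k = int (length p) - int (length q) \<and>
     l = int (length (subst_list p)) - int (length (subst_list q)))"

lemma lagI: "lag (p \<frown> z) (int (length p) - int (length q)) (q \<frown> z)
    (int (length (subst_list p)) - int (length (subst_list q)))"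
  by (auto simp: lag_def)

lemma lag_sym: "lag x k y l \<Longrightarrow> lag y (- k) x (- l)"
  unfolding lag_def by (metis minus_diff_eq)

text \<open>The two decompositions cut y at two places. Extending both prefixes of the earlier cut
  by the segment in between makes the cuts agree.\<close>

lemma lag_trans: assumes "lag x k y l" "lag y k' w l'" shows "lag x (k + k') w (l + l')"
proof -
  obtain p q z where 1: "x = p \<frown> z" "y = q \<frown> z" "k = int (length p) - int (length q)"
     "l = int (length (subst_list p)) - int (length (subst_list q))"
    using assms(1) by (auto simp: lag_def)
  obtain p' q' z' where 2: "y = p' \<frown> z'" "w = q' \<frown> z'" "k' = int (length p') - int (length q')"
     "l' = int (length (subst_list p')) - int (length (subst_list q'))"
    using assms(2) by (auto simp: lag_def)
  show ?thesis
  proof (cases "length q \<le> length p'")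
    case True
    then obtain r where "p' = q @ r" "z = r \<frown> z'" using conc_eq_conc[of q z p' z'] 1 2 by metis
    then show ?thesis using 1 2 unfolding lag_def
      by (intro exI[of _ "p @ r"] exI[of _ q'] exI[of _ z']) simp
  next
    case False
    then obtain r where "q = p' @ r" "z' = r \<frown> z" using conc_eq_conc[of p' z' q z] 1 2 by auto
    then show ?thesis using 1 2 unfolding lag_def
      by (intro exI[of _ p] exI[of _ "q' @ r"] exI[of _ z]) simp
  qed
qed

text \<open>With k fixed, passing to the later cut extends both prefixes by the same segment, whose
  contribution to l cancels.\<close>

lemma lag_unique: assumes "lag x k y l" "lag x k y l'" shows "l = l'"
proof -
  have main: "int (length (subst_list p)) - int (length (subst_list q)) =
      int (length (subst_list p')) - int (length (subst_list q'))"
    if "p \<frown> z = p' \<frown> z'" "q \<frown> z = q' \<frown> z'" "length p \<le> length p'"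
      "int (length p) - int (length q) = int (length p') - int (length q')" for p q z p' q' z'
  proof -
    note prems = that
    obtain r where r: "p' = p @ r" "z = r \<frown> z'" using conc_eq_conc prems(1,3) by metis
    have "length q \<le> length q'" using prems(3,4) by linarith
    then obtain r' where r': "q' = q @ r'" "z = r' \<frown> z'" using conc_eq_conc prems(2) by metis
    have "length r = length r'" using prems(4) r(1) r'(1) by simp
    then have "r = r'" using conc_eq_same_length r(2) r'(2) by metis
    then show ?thesis using r r' by simp
  qed
  obtain p q z where 1: "x = p \<frown> z" "y = q \<frown> z" "k = int (length p) - int (length q)"
     "l = int (length (subst_list p)) - int (length (subst_list q))"
    using assms(1) by (auto simp: lag_def)
  obtain p' q' z' where 2: "x = p' \<frown> z'" "y = q' \<frown> z'" "k = int (length p') - int (length q')"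
     "l' = int (length (subst_list p')) - int (length (subst_list q'))"
    using assms(2) by (auto simp: lag_def)
  show ?thesis using main[of p z p' z' q q'] main[of p' z' p z q' q] 1 2 by (metis nat_le_linear)
qed

text \<open>Eventually periodic paths are related with many different k, so k has to be recovered
  from l. The two extensions may a priori differ in length; but both begin the same tail, and a
  nonempty segment has positive substituted length, so equal substituted lengths force them to
  coincide.\<close>

lemma lag_inj:
  assumes "lag x k y l" "lag x k' y l" and x: "range x \<subseteq> arcs G" and y: "range y \<subseteq> arcs G"
  shows "k = k'"
proof -
  have main: "int (length p) - int (length q) = int (length p') - int (length q')"
    if "x = p \<frown> z" "x = p' \<frown> z'" "y = q \<frown> z" "y = q' \<frown> z'" "length p \<le> length p'"
      "int (length (subst_list p)) - int (length (subst_list q)) =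
      int (length (subst_list p')) - int (length (subst_list q'))" for p q z p' q' z'
  proof -
    note prems = that
    obtain r where r: "p' = p @ r" "z = r \<frown> z'" using conc_eq_conc prems(1,2,5) by metis
    \<comment> \<open>Otherwise one prefix would not shrink while the other one strictly does, which
      changes the difference of the substituted lengths.\<close>
    have le: "length q \<le> length q'"
    proof (rule ccontr)
      assume "\<not> length q \<le> length q'"
      then obtain s where s: "q = q' @ s" "z' = s \<frown> z"
        using conc_eq_conc[of q' z' q z] prems(3,4) by auto
      then have "s \<noteq> []" "set s \<subseteq> arcs G" using \<open>\<not> length q \<le> length q'\<close> prems(3) y by auto
      then have "length (subst_list s) > 0" by (intro subst_list_length_pos)
      then show False using prems(6) s(1) r(1) by simp
    qed
    then obtain r' where r': "q' = q @ r'" "z = r' \<frown> z'" using conc_eq_conc prems(3,4) by metis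
    have same: "length (subst_list r) = length (subst_list r')" using prems(6) r(1) r'(1) by simp
    have sub: "set r \<subseteq> arcs G" "set r' \<subseteq> arcs G" using prems(2,4) r(1) r'(1) x y by auto
    have aux: "s = s'" if "s \<frown> w = s' \<frown> w'" "length s \<le> length s'" "set s' \<subseteq> arcs G"
      "length (subst_list s) = length (subst_list s')" for s s' :: "'e list" and w w'
    proof -
      note prems = that
      obtain t where t: "s' = s @ t" using conc_eq_conc prems(1,2) by metis
      then show ?thesis using prems(3,4) subst_list_length_pos[of t] by auto
    qed
    have "r = r'"
      using aux[of r z' r' z'] aux[of r' z' r z'] r(2) r'(2) same sub by (metis nat_le_linear)
    then show ?thesis using r r' by simp
  qed
  obtain p q z where 1: "x = p \<frown> z" "y = q \<frown> z" "k = int (length p) - int (length q)"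
     "l = int (length (subst_list p)) - int (length (subst_list q))"
    using assms(1) by (auto simp: lag_def)
  obtain p' q' z' where 2: "x = p' \<frown> z'" "y = q' \<frown> z'" "k' = int (length p') - int (length q')"
     "l = int (length (subst_list p')) - int (length (subst_list q'))"
    using assms(2) by (auto simp: lag_def)
  show ?thesis using main[of p z p' z' q q'] main[of p' z' p z q' q] 1 2 by (metis nat_le_linear)
qed

section \<open>The isomorphism of path groupoids\<close>

definition subst_arrow :: "'e word \<times> int \<times> 'e word \<Rightarrow> 'f word \<times> int \<times> 'f word" where
  "subst_arrow = (\<lambda>(x, k, y). (\<sigma> x, (THE l. lag x k y l), \<sigma> y))"

lemma subst_arrow_eq: "lag x k y l \<Longrightarrow> subst_arrow (x, k, y) = (\<sigma> x, l, \<sigma> y)"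
  unfolding subst_arrow_def using lag_unique by auto

lemma lag_exists:
  assumes "(x, k, y) \<in> arrows (path_groupoid G)"
  obtains l where "lag x k y l"
  using assms by (auto simp: path_groupoid_def shift_tail_equiv_iff lag_def)

lemma arrows_iff:
  "(x, k, y) \<in> arrows (path_groupoid K) \<longleftrightarrow>
    x \<in> infinite_paths K \<and> y \<in> infinite_paths K \<and> shift_tail_equiv x k y"
  by (simp add: path_groupoid_def)

lemma bij_betw_subst_arrow:
  "bij_betw subst_arrow (arrows (path_groupoid G)) (arrows (path_groupoid H))"
proof (rule bij_betw_imageI)
  show "inj_on subst_arrow (arrows (path_groupoid G))"
  proof (rule inj_onI)
    fix a b assume a: "a \<in> arrows (path_groupoid G)" and b: "b \<in> arrows (path_groupoid G)"
      and eq: "subst_arrow a = subst_arrow b"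
    obtain x k y where a': "a = (x, k, y)" by (cases a)
    obtain x' k' y' where b': "b = (x', k', y')" by (cases b)
    obtain l where l: "lag x k y l" using a lag_exists a' by blast
    obtain l' where l': "lag x' k' y' l'" using b lag_exists b' by blast
    have paths: "range w \<subseteq> arcs G" if "w \<in> {x, y, x', y'}" for w
      using a b that unfolding a' b' arrows_iff by (auto simp: infinite_paths_def)
    have \<sigma>_eq: "\<sigma> x = \<sigma> x'" "\<sigma> y = \<sigma> y'" and ll: "l = l'"
      using eq unfolding a' b' subst_arrow_eq[OF l] subst_arrow_eq[OF l'] by auto
    have xy: "x = x'" "y = y'"
      by (rule subst_word_inj[OF \<sigma>_eq(1)]; rule paths; simp)
        (rule subst_word_inj[OF \<sigma>_eq(2)]; rule paths; simp)
    have "k = k'"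
      by (rule lag_inj[OF l]) (use l' xy ll paths in auto)
    then show "a = b" using a' b' xy by simp
  qed
  show "subst_arrow ` arrows (path_groupoid G) = arrows (path_groupoid H)"
  proof (rule subset_antisym; rule subsetI)
    fix b assume "b \<in> subst_arrow ` arrows (path_groupoid G)"
    then obtain x k y where *: "b = subst_arrow (x, k, y)" "(x, k, y) \<in> arrows (path_groupoid G)" by auto
    obtain p q z where pq: "x = p \<frown> z" "y = q \<frown> z" "k = int (length p) - int (length q)"
      using *(2) by (auto simp: arrows_iff shift_tail_equiv_iff)
    have "set p \<subseteq> arcs G" "set q \<subseteq> arcs G"
      using *(2) pq(1,2) by (auto simp: arrows_iff G.conc_infinite_paths_iff G.awalk_def)
    then have "\<sigma> x = subst_list p \<frown> \<sigma> z" "\<sigma> y = subst_list q \<frown> \<sigma> z"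
      using pq by (simp_all add: subst_word_conc_arcs)
    moreover have "b = (\<sigma> x, int (length (subst_list p)) - int (length (subst_list q)), \<sigma> y)"
      unfolding *(1) pq by (rule subst_arrow_eq[OF lagI])
    moreover have "\<sigma> x \<in> infinite_paths H" "\<sigma> y \<in> infinite_paths H"
      using *(2) subst_word_path by (auto simp: arrows_iff)
    ultimately show "b \<in> arrows (path_groupoid H)"
      unfolding shift_tail_equiv_iff arrows_iff by (auto simp: arrows_iff shift_tail_equiv_iff)
  next
    fix b assume b: "b \<in> arrows (path_groupoid H)"
    obtain X l Y where b': "b = (X, l, Y)" by (cases b)
    obtain P Q Z where PQ: "X = P \<frown> Z" "Y = Q \<frown> Z" "l = int (length P) - int (length Q)"
      using b unfolding b' by (auto simp: arrows_iff shift_tail_equiv_iff)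
    obtain x where x: "x \<in> infinite_paths G" "\<sigma> x = X"
      using subst_word_surj b unfolding b' arrows_iff by metis
    obtain y where y: "y \<in> infinite_paths G" "\<sigma> y = Y"
      using subst_word_surj b unfolding b' arrows_iff by metis
    \<comment> \<open>The same r is appended to P and Q, so the lag computed from p and q is still
      l.\<close>
    obtain r p q z where *: "x = p \<frown> z" "y = q \<frown> z" "subst_list p = P @ r" "subst_list q = Q @ r"
      using common_tail_blocks[of x P Z y Q] x y PQ by metis
    define k where "k = int (length p) - int (length q)"
    have "lag x k y l" using lagI[of p z q] * PQ k_def by simp
    moreover have "(x, k, y) \<in> arrows (path_groupoid G)"
      using x y * k_def by (auto simp: arrows_iff shift_tail_equiv_iff)
    ultimately show "b \<in> subst_arrow ` arrows (path_groupoid G)"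
      using subst_arrow_eq x y b' by (metis image_eqI)
  qed
qed

text \<open>This yields openness of the map. It holds because \<sigma> sends the paths from v onto
  those from \<open>h v\<close>, by injectivity of h.\<close>

lemma subst_arrow_cylinder:
  assumes p: "G.awalk u p v" and q: "G.awalk w q v"
  shows "subst_arrow ` cylinder G p q v = cylinder H (subst_list p) (subst_list q) (h v)"
proof -
  have img: "subst_arrow (p \<frown> z, int (length p) - int (length q), q \<frown> z) =
    (subst_list p \<frown> \<sigma> z, int (length (subst_list p)) - int (length (subst_list q)), subst_list q \<frown> \<sigma> z)" for z
    using subst_arrow_eq[OF lagI[of p z q]] p q by (simp add: subst_word_conc_arcs G.awalk_def)
  have v: "v \<in> verts G" using p by auto
  have "\<exists>z. Z = \<sigma> z \<and> z \<in> infinite_paths G \<and> tail G (z 0) = v"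
    if Z: "Z \<in> infinite_paths H" "tail H (Z 0) = h v" for Z
  proof -
    obtain z where z: "z \<in> infinite_paths G" "\<sigma> z = Z" using subst_word_surj[OF Z(1)] by blast
    then have "h (tail G (z 0)) = h v" using tail_subst_word Z(2) by metis
    then have "tail G (z 0) = v"
      using v G.tail_in_verts[OF infinite_paths_arcs[OF z(1)]] by (intro h_inj)
    then show ?thesis using z by blast
  qed
  then show ?thesis
    unfolding cylinder_def using img subst_word_path tail_subst_word
    by (auto simp: image_iff) metis+
qed

lemma awalk_subst_list:
  assumes "G.awalk u p v"
  shows "H.awalk (h u) (subst_list p) (h v)"
  using assms
proof (induct p arbitrary: u)
  case Nil
  then show ?case by (auto simp: G.awalk_Nil_iff H.awalk_Nil_iff h_verts)
next
  case (Cons e p)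
  then have e: "e \<in> arcs G" "u = tail G e" and IH: "H.awalk (h (head G e)) (subst_list p) (h v)"
    by (auto simp: G.awalk_Cons_iff)
  from e(1) show ?case
    by (cases rule: block_cases)
      (use e IH tail_block[OF e(1)] head_block[OF e(1)] in \<open>auto simp: H.awalk_Cons_iff\<close>)
qed

lemma homeomorphic_map_subst_arrow:
  "homeomorphic_map (gtop (path_groupoid G)) (gtop (path_groupoid H)) subst_arrow"
proof -
  define g where "g = inv_into (arrows (path_groupoid G)) subst_arrow"
  note bij = bij_betw_subst_arrow
  have gf: "g (subst_arrow a) = a" if "a \<in> arrows (path_groupoid G)" for a
    using bij_betw_inv_into_left[OF bij that] by (simp add: g_def)
  have fg: "subst_arrow (g b) = b" "g b \<in> arrows (path_groupoid G)"
    if "b \<in> arrows (path_groupoid H)" for b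
    using bij_betw_inv_into_right[OF bij that] bij_betw_inv_into[OF bij] that
    by (auto simp: g_def bij_betw_def)
  have "continuous_map (gtop (path_groupoid G)) (gtop (path_groupoid H)) subst_arrow"
  proof (rule continuous_map_path_groupoid[OF H.wf_digraph])
    show "subst_arrow ` topspace (gtop (path_groupoid G)) \<subseteq> arrows (path_groupoid H)"
      using bij by (simp add: G.topspace_path_groupoid bij_betw_def)
    fix u w P Q v assume PQ: "H.awalk u P v" "H.awalk w Q v"
    let ?U = "subst_arrow -` cylinder H P Q v \<inter> topspace (gtop (path_groupoid G))"
    \<comment> \<open>P or Q may end inside a block, and then the cylinder is not visibly the image
      of one. Around each point, lengthening both lists by r to a block boundary gives a smaller
      cylinder that is.\<close>
    show "openin (gtop (path_groupoid G)) ?U"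
    proof (subst openin_subopen, intro ballI)
      fix a assume a: "a \<in> ?U"
      obtain x k y where a': "a = (x, k, y)" by (cases a)
      have arr: "(x, k, y) \<in> arrows (path_groupoid G)" using a a' by (simp add: G.topspace_path_groupoid)
      then have xy: "x \<in> infinite_paths G" "y \<in> infinite_paths G" by (auto simp: arrows_iff)
      obtain l where l: "lag x k y l" using arr lag_exists by blast
      obtain Z where Z: "\<sigma> x = P \<frown> Z" "l = int (length P) - int (length Q)" "\<sigma> y = Q \<frown> Z"
        "tail H (Z 0) = v"
        using a unfolding a' cylinder_def by (auto simp: subst_arrow_eq[OF l])
      obtain r p q z where *: "x = p \<frown> z" "y = q \<frown> z" "subst_list p = P @ r" "subst_list q = Q @ r"
        "Z = r \<frown> \<sigma> z" "z \<in> infinite_paths G" "set p \<subseteq> arcs G" "set q \<subseteq> arcs G"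
        using common_tail_blocks[OF xy(1) Z(1) xy(2) Z(3)] by metis
      let ?v = "tail G (z 0)"
      obtain u' w' where pq: "G.awalk u' p ?v" "G.awalk w' q ?v"
        using xy * by (auto simp: G.conc_infinite_paths_iff)
      \<comment> \<open>Only the image of the arrow is known to lie in a cylinder, so
        \<open>lag_inj\<close> is needed to identify k.\<close>
      have "lag x (int (length p) - int (length q)) y l" using lagI[of p z q] * Z by simp
      then have "k = int (length p) - int (length q)"
        using lag_inj[OF l] xy by (auto simp: infinite_paths_def)
      then have "a \<in> cylinder G p q ?v" using * by (auto simp: a' cylinder_def)
      moreover have "cylinder G p q ?v \<subseteq> ?U"
      proof -
        have "H.awalk (h u') (P @ r) (h ?v)" using awalk_subst_list[OF pq(1)] * by simp
        then obtain v' where r': "H.awalk v' r (h ?v)" by (auto simp: H.awalk_append_iff)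
        have "v' = v" using H.awalk_infinite_path[of v' r "\<sigma> z"] r' Z(4) * tail_subst_word by simp
        have "cylinder H (P @ r) (Q @ r) (h ?v) \<subseteq> cylinder H P Q v"
        proof
          fix b assume "b \<in> cylinder H (P @ r) (Q @ r) (h ?v)"
          then obtain Y where Y: "b = (P \<frown> (r \<frown> Y), int (length P) - int (length Q), Q \<frown> (r \<frown> Y))"
            "Y \<in> infinite_paths H" "tail H (Y 0) = h ?v" by (auto simp: cylinder_def)
          have "r \<frown> Y \<in> infinite_paths H" using r' Y by (auto simp: H.conc_infinite_paths_iff)
          moreover have "tail H ((r \<frown> Y) 0) = v"
            using H.awalk_infinite_path[of v' r Y] r' Y \<open>v' = v\<close> by simp
          ultimately show "b \<in> cylinder H P Q v" using Y(1) unfolding cylinder_def by blast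
        qed
        then show ?thesis
          using subst_arrow_cylinder[OF pq] G.cylinder_subset_arrows[OF pq] *(3,4)
          by (auto simp: G.topspace_path_groupoid)
      qed
      ultimately show "\<exists>T. openin (gtop (path_groupoid G)) T \<and> a \<in> T \<and> T \<subseteq> ?U"
        using G.openin_cylinder[OF pq] by blast
    qed
  qed
  moreover have "continuous_map (gtop (path_groupoid H)) (gtop (path_groupoid G)) g"
  proof (rule continuous_map_path_groupoid[OF G.wf_digraph])
    show "g ` topspace (gtop (path_groupoid H)) \<subseteq> arrows (path_groupoid G)"
      using fg by (auto simp: H.topspace_path_groupoid)
    fix u w p q v assume pq: "G.awalk u p v" "G.awalk w q v"
    have "g -` cylinder G p q v \<inter> topspace (gtop (path_groupoid H)) = subst_arrow ` cylinder G p q v"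
    proof (rule subset_antisym; rule subsetI)
      fix b assume "b \<in> g -` cylinder G p q v \<inter> topspace (gtop (path_groupoid H))"
      then show "b \<in> subst_arrow ` cylinder G p q v"
        using fg(1)[of b] by (auto simp: H.topspace_path_groupoid image_iff intro: rev_bexI)
    next
      fix b assume "b \<in> subst_arrow ` cylinder G p q v"
      then obtain a where a: "a \<in> cylinder G p q v" "b = subst_arrow a" by blast
      then have "a \<in> arrows (path_groupoid G)" using G.cylinder_subset_arrows[OF pq] by blast
      then show "b \<in> g -` cylinder G p q v \<inter> topspace (gtop (path_groupoid H))"
        using a gf bij by (auto simp: H.topspace_path_groupoid bij_betw_def)
    qed
    then show "openin (gtop (path_groupoid H)) (g -` cylinder G p q v \<inter> topspace (gtop (path_groupoid H)))"
      using H.openin_cylinder[OF awalk_subst_list[OF pq(1)] awalk_subst_list[OF pq(2)]]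
      by (simp add: subst_arrow_cylinder[OF pq])
  qed
  ultimately have "homeomorphic_maps (gtop (path_groupoid G)) (gtop (path_groupoid H)) subst_arrow g"
    using gf fg by (auto simp: homeomorphic_maps_def G.topspace_path_groupoid H.topspace_path_groupoid)
  then show ?thesis by (auto simp: homeomorphic_map_maps)
qed

lemma path_groupoid_iso: "top_groupoid_iso subst_arrow (path_groupoid G) (path_groupoid H)"
proof -
  have lag_G: "\<exists>l. lag x k y l \<and> range x \<subseteq> arcs G \<and> range y \<subseteq> arcs G"
    if "(x, k, y) \<in> arrows (path_groupoid G)" for x k y
    using that lag_exists[OF that] by (metis arrows_iff image_subsetI infinite_paths_arcs)
  have comp: "composable (path_groupoid K) = {((x, k, y), (y', l, z)) | x k y y' l z. y = y'}"
    "gcomp (path_groupoid K) = (\<lambda>(x, k, y) (y', l, z). (x, k + l, z))"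
    "ginv (path_groupoid K) = (\<lambda>(x, k, y). (y, - k, x))" for K :: "('x, 'y) pre_digraph"
    by (simp_all add: path_groupoid_def)
  show ?thesis
    unfolding top_groupoid_iso_def
  proof (intro conjI ballI impI bij_betw_subst_arrow homeomorphic_map_subst_arrow)
    fix a b assume a: "a \<in> arrows (path_groupoid G)" and b: "b \<in> arrows (path_groupoid G)"
    obtain x k y where a': "a = (x, k, y)" by (cases a)
    obtain y' k' w where b': "b = (y', k', w)" by (cases b)
    obtain l where l: "lag x k y l" "range y \<subseteq> arcs G" using lag_G a unfolding a' by blast
    obtain l' where l': "lag y' k' w l'" "range y' \<subseteq> arcs G" using lag_G b unfolding b' by blast
    show "(a, b) \<in> composable (path_groupoid G) \<longleftrightarrow>
        (subst_arrow a, subst_arrow b) \<in> composable (path_groupoid H)"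
      unfolding a' b' subst_arrow_eq[OF l(1)] subst_arrow_eq[OF l'(1)] comp
      using subst_word_inj[OF _ l(2) l'(2)] by auto
    assume "(a, b) \<in> composable (path_groupoid G)"
    then have [simp]: "y' = y" by (auto simp: a' b' comp)
    have "lag x (k + k') w (l + l')" using lag_trans l(1) l'(1) by simp
    then show "subst_arrow (gcomp (path_groupoid G) a b) =
        gcomp (path_groupoid H) (subst_arrow a) (subst_arrow b)"
      using l l' by (simp add: a' b' comp subst_arrow_eq)
  next
    fix a assume a: "a \<in> arrows (path_groupoid G)"
    obtain x k y where a': "a = (x, k, y)" by (cases a)
    obtain l where l: "lag x k y l" using lag_G a unfolding a' by blast
    show "subst_arrow (ginv (path_groupoid G) a) = ginv (path_groupoid H) (subst_arrow a)"
      using l lag_sym[OF l] by (simp add: a' comp subst_arrow_eq)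
  qed
qed

end

subsection \<open>Transfer of Cuntz-Krieger families\<close>

context cstar_algebra
begin

lemma finsum_mult_orth:
  assumes I: "finite I" and x: "x \<in> I \<rightarrow> carrier A" and y: "y \<in> I \<rightarrow> carrier A"
    and orth: "\<And>i j. i \<in> I \<Longrightarrow> j \<in> I \<Longrightarrow> i \<noteq> j \<Longrightarrow> x i \<otimes> y j = \<zero>"
  shows "(\<Oplus>i\<in>I. x i) \<otimes> (\<Oplus>i\<in>I. y i) = (\<Oplus>i\<in>I. x i \<otimes> y i)"
proof -
  have "(\<Oplus>i\<in>I. x i) \<otimes> (\<Oplus>j\<in>I. y j) = (\<Oplus>i\<in>I. x i \<otimes> (\<Oplus>j\<in>I. y j))"
    using I x y by (intro finsum_mult_right) auto
  also have "\<dots> = (\<Oplus>i\<in>I. x i \<otimes> y i)"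
  proof (intro finsum_cong' refl)
    show "(\<lambda>i. x i \<otimes> y i) \<in> I \<rightarrow> carrier A" using x y by (auto simp: Pi_iff mult_closed)
    fix i assume i: "i \<in> I"
    have "x i \<otimes> (\<Oplus>j\<in>I. y j) = (\<Oplus>j\<in>I. x i \<otimes> y j)"
      using I x y i by (intro finsum_mult_left) auto
    also have "\<dots> = x i \<otimes> y i"
      using I x y i orth by (intro finsum_single) (auto simp: Pi_iff mult_closed)
    finally show "x i \<otimes> (\<Oplus>j\<in>I. y j) = x i \<otimes> y i" .
  qed
  finally show ?thesis .
qed

end

lemma closed_star_subalgebra_finsum:
  assumes "abelian_monoid A" and "closed_star_subalgebra K A"
  shows "\<lbrakk>finite I; \<And>i. i \<in> I \<Longrightarrow> f i \<in> K\<rbrakk> \<Longrightarrow> (\<Oplus>\<^bsub>A\<^esub>i\<in>I. f i) \<in> K"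
proof (induct set: finite)
  case empty
  then show ?case using assms
    by (simp add: abelian_monoid.finsum_empty closed_star_subalgebra_def)
next
  case (insert i I)
  then have "f \<in> insert i I \<rightarrow> carrier A" using assms(2) by (auto simp: closed_star_subalgebra_def)
  with insert have "(\<Oplus>\<^bsub>A\<^esub>j\<in>insert i I. f j) = f i \<oplus>\<^bsub>A\<^esub> (\<Oplus>\<^bsub>A\<^esub>j\<in>I. f j)"
    by (intro abelian_monoid.finsum_insert[OF assms(1)]) auto
  then show ?case using insert assms(2) by (auto simp: closed_star_subalgebra_def)
qed

locale row_finite_substitution = edge_substitution G H h \<phi> N
  for G :: "('v, 'e) pre_digraph" and H :: "('w, 'f) pre_digraph" and h \<phi> N +
  assumes row_finite_G: "row_finite G" and no_sinks_G: "no_sinks G"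
    and row_finite_H: "row_finite H" and no_sinks_H: "no_sinks H"
begin

definition starting :: "'f \<Rightarrow> 'e set" where
  "starting f = {e \<in> arcs G. hd (\<phi> e) = f}"

definition block_arc :: "'f list \<Rightarrow> 'e" where
  "block_arc = inv_into (arcs G) \<phi>"

text \<open>The operator of what remains of a block after its first arc. If nothing remains, the
  vertex projection stands for a path of length 0; a remaining arc lies outside N and is thus a
  block by itself.\<close>

definition rest :: "('v \<Rightarrow> 'a) \<Rightarrow> ('e \<Rightarrow> 'a) \<Rightarrow> 'e \<Rightarrow> 'a" where
  "rest P S e = (if tl (\<phi> e) = [] then P (head G e) else S (block_arc (tl (\<phi> e))))"

definition push_vertex :: "('v \<Rightarrow> 'a) \<Rightarrow> 'w \<Rightarrow> 'a" where
  "push_vertex P w = P (inv_into (verts G) h w)"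

text \<open>If \<open>f \<in> N\<close>, the terms are \<open>S\<^sub>e S\<^sub>b\<^sup>*\<close> for the arcs \<open>e\<close> with block \<open>f b\<close>; otherwise there is one term,
  which is \<open>S\<^sub>e\<close> for the arc \<open>e\<close> with block \<open>f\<close>.\<close>

definition push_arc :: "'a cstar \<Rightarrow> ('v \<Rightarrow> 'a) \<Rightarrow> ('e \<Rightarrow> 'a) \<Rightarrow> 'f \<Rightarrow> 'a" where
  "push_arc A P S f = (\<Oplus>\<^bsub>A\<^esub>e\<in>starting f. S e \<otimes>\<^bsub>A\<^esub> star A (rest P S e))"

definition pull_arc :: "'a cstar \<Rightarrow> ('f \<Rightarrow> 'a) \<Rightarrow> 'e \<Rightarrow> 'a" where
  "pull_arc A T e =
    (if tl (\<phi> e) = [] then T (hd (\<phi> e)) else T (hd (\<phi> e)) \<otimes>\<^bsub>A\<^esub> T (last (\<phi> e)))"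

lemma block_arc_eq: "e \<in> arcs G \<Longrightarrow> \<phi> e = l \<Longrightarrow> block_arc l = e"
  unfolding block_arc_def using blocks by (auto simp: bij_betw_def)

lemma vertex_preimage:
  assumes "w \<in> verts H"
  obtains v where "v \<in> verts G" "h v = w"
  using assms that unfolding bij_betw_imp_surj_on[OF vertices, symmetric] by blast

lemma push_vertex_h: "v \<in> verts G \<Longrightarrow> push_vertex P (h v) = P v"
  using vertices by (simp add: push_vertex_def bij_betw_def)

lemma starting_single:
  assumes e: "e \<in> arcs G" "\<phi> e = [f]"
  shows "starting f = {e}"
proof -
  have f: "f \<notin> N" using e(1) by (rule block_cases) (use e(2) in auto)
  have "e' = e" if "e' \<in> arcs G" "hd (\<phi> e') = f" for e'
    using that(1) by (rule block_cases) (use that f e block_inj in auto)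
  moreover have "hd (\<phi> e) = f" using e by simp
  ultimately show ?thesis unfolding starting_def using e(1) by blast
qed

lemma starting_double:
  assumes f: "f \<in> arcs H" "f \<in> N"
  shows "bij_betw (\<lambda>e. last (\<phi> e)) (starting f) (out_arcs H (head H f))"
    and "e \<in> starting f \<Longrightarrow> \<phi> e = [f, last (\<phi> e)]"
proof -
  have blk: "\<phi> e = [f, last (\<phi> e)] \<and> last (\<phi> e) \<in> out_arcs H (head H f)" if "e \<in> starting f" for e
  proof -
    have e: "e \<in> arcs G" "hd (\<phi> e) = f" using that by (auto simp: starting_def)
    from e(1) show ?thesis by (rule block_cases) (use e(2) f in auto)
  qed
  then show "e \<in> starting f \<Longrightarrow> \<phi> e = [f, last (\<phi> e)]" by blast
  show "bij_betw (\<lambda>e. last (\<phi> e)) (starting f) (out_arcs H (head H f))"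
  proof (rule bij_betw_imageI)
    show "inj_on (\<lambda>e. last (\<phi> e)) (starting f)"
    proof (rule inj_onI)
      fix e e' assume *: "e \<in> starting f" "e' \<in> starting f" "last (\<phi> e) = last (\<phi> e')"
      then have "\<phi> e = \<phi> e'" using blk by metis
      then show "e = e'" using * block_inj by (auto simp: starting_def)
    qed
    have "b \<in> (\<lambda>e. last (\<phi> e)) ` starting f" if b: "b \<in> out_arcs H (head H f)" for b
    proof -
      obtain e where "e \<in> arcs G" "\<phi> e = [f, b]" using double_block[of f b] f b by auto
      then show ?thesis by (force simp: starting_def image_iff)
    qed
    then show "(\<lambda>e. last (\<phi> e)) ` starting f = out_arcs H (head H f)" using blk by blast
  qed
qed

text \<open>The arcs leaving the range of an arc in \<open>N\<close> are themselves blocks, so they are the images of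
  the arcs of \<open>G\<close> leaving \<open>v\<close>.\<close>

lemma starting_double_arcs:
  assumes f: "f \<in> arcs H" "f \<in> N" and v: "v \<in> verts G" "h v = head H f"
  shows "bij_betw (\<lambda>e. block_arc [last (\<phi> e)]) (starting f) (out_arcs G v)"
proof -
  have blk: "\<exists>b. \<phi> e = [b] \<and> b \<in> out_arcs H (head H f)" if e: "e \<in> out_arcs G v" for e
  proof -
    have e': "e \<in> arcs G" using e by simp
    have t: "tail H (hd (\<phi> e)) = head H f" using e v(2) tail_block[OF e'] by simp
    show ?thesis using e'
    proof (cases rule: block_cases)
      case (1 b)
      then show ?thesis using t by auto
    next
      case (2 a b)
      then show ?thesis using isolated[of f a] f t by simp
    qed
  qed
  have "bij_betw (\<lambda>b. block_arc [b]) (out_arcs H (head H f)) (out_arcs G v)"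
  proof (rule bij_betw_byWitness[where f' = "\<lambda>e. hd (\<phi> e)"])
    have sol: "block_arc [b] \<in> out_arcs G v \<and> hd (\<phi> (block_arc [b])) = b"
      if b: "b \<in> out_arcs H (head H f)" for b
    proof -
      have "b \<notin> N" using isolated[of f b] f b by auto
      then obtain e where e: "e \<in> arcs G" "\<phi> e = [b]" using single_block[of b] b by auto
      have "h (tail G e) = h v" using tail_block[OF e(1)] e b v by simp
      then have "tail G e = v" using e v by (intro h_inj) auto
      then show ?thesis using e block_arc_eq[OF e] by simp
    qed
    show "\<forall>b\<in>out_arcs H (head H f). hd (\<phi> (block_arc [b])) = b"
      "(\<lambda>b. block_arc [b]) ` out_arcs H (head H f) \<subseteq> out_arcs G v" using sol by auto
    show "\<forall>e\<in>out_arcs G v. block_arc [hd (\<phi> e)] = e"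
      using blk block_arc_eq by fastforce
    show "(\<lambda>e. hd (\<phi> e)) ` out_arcs G v \<subseteq> out_arcs H (head H f)" using blk by fastforce
  qed
  from bij_betw_trans[OF starting_double(1)[OF f] this] show ?thesis by (simp add: comp_def)
qed

lemma finite_starting: "f \<in> arcs H \<Longrightarrow> finite (starting f)"
proof (cases "f \<in> N")
  case False
  assume "f \<in> arcs H"
  then obtain e where "e \<in> arcs G" "\<phi> e = [f]" using single_block False by blast
  then show ?thesis by (simp add: starting_single)
next
  case True
  assume f: "f \<in> arcs H"
  then have "finite (out_arcs H (head H f))" using row_finite_H by (simp add: row_finite_def)
  then show ?thesis using bij_betw_finite[OF starting_double(1)[OF f True]] by simp
qed

lemma out_arcs_starting:
  assumes "v \<in> verts G"
  shows "out_arcs G v = (\<Union>f\<in>out_arcs H (h v). starting f)"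
proof -
  have "hd (\<phi> e) \<in> arcs H" if "e \<in> arcs G" for e
    using that by (rule block_cases) auto
  moreover have "tail G e = v" if "e \<in> arcs G" "tail H (hd (\<phi> e)) = h v" for e
    using that assms by (intro h_inj) (auto simp: tail_block)
  ultimately show ?thesis by (auto simp: starting_def tail_block)
qed

text \<open>Grouping the arcs leaving v by the first arc of their block relates the Cuntz-Krieger
  sum at v to the one at \<open>h v\<close>.\<close>

lemma finsum_out_arcs:
  assumes A: "abelian_monoid A" and v: "v \<in> verts G" and g: "\<And>e. e \<in> arcs G \<Longrightarrow> g e \<in> carrier A"
  shows "(\<Oplus>\<^bsub>A\<^esub>e\<in>out_arcs G v. g e) = (\<Oplus>\<^bsub>A\<^esub>f\<in>out_arcs H (h v). \<Oplus>\<^bsub>A\<^esub>e\<in>starting f. g e)"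
proof -
  interpret abelian_monoid A by (rule A)
  show ?thesis
    unfolding out_arcs_starting[OF v]
    by (rule add.finprod_UN_disjoint)
      (use row_finite_H h_verts[OF v] g finite_starting
        in \<open>auto simp: row_finite_def pairwise_def disjnt_def starting_def\<close>)
qed

end

section \<open>From families of G to families of H\<close>

locale push_family = row_finite_substitution G H h \<phi> N + ck_family A G P S
  for A :: "'a cstar" (structure) and G :: "('v, 'e) pre_digraph" and P S
    and H :: "('w, 'f) pre_digraph" and h \<phi> N
begin

lemma rest_cases:
  assumes f: "f \<in> arcs H" and e: "e \<in> starting f"
  obtains "\<phi> e = [f]" "f \<notin> N" "rest P S e = P (head G e)" "e \<in> arcs G"
  | e' b where "\<phi> e = [f, b]" "f \<in> N" "rest P S e = S e'" "\<phi> e' = [b]" "e' \<in> arcs G" "e \<in> arcs G"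
    "head G e' = head G e"
proof -
  have ea: "e \<in> arcs G" "hd (\<phi> e) = f" using e by (auto simp: starting_def)
  from ea(1) show thesis
  proof (cases rule: block_cases)
    case (1 f')
    then show thesis using that(1) ea by (simp add: rest_def)
  next
    case (2 a b)
    obtain e' where e': "e' \<in> arcs G" "\<phi> e' = [b]" using single_block 2 by blast
    have "h (head G e') = h (head G e)" using head_block[OF e'(1)] head_block[OF ea(1)] e' 2 by simp
    then have "head G e' = head G e" using e' ea by (intro h_inj) auto
    then show thesis using that(2) 2 e' ea block_arc_eq[OF e'] by (simp add: rest_def)
  qed
qed

lemma rest_closed: "f \<in> arcs H \<Longrightarrow> e \<in> starting f \<Longrightarrow> rest P S e \<in> carrier A"
  by (erule rest_cases) (auto simp: P_closed S_closed)

lemma rest_star_rest: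
  "f \<in> arcs H \<Longrightarrow> e \<in> starting f \<Longrightarrow> star A (rest P S e) \<otimes> rest P S e = P (head G e)"
  by (erule rest_cases) (auto simp: P_star P_idem S_star_S)

lemma rest_P_head: "f \<in> arcs H \<Longrightarrow> e \<in> starting f \<Longrightarrow> rest P S e \<otimes> P (head G e) = rest P S e"
  by (erule rest_cases) (auto simp: P_idem S_P_head dest: S_P_head)

lemma rest_orth:
  assumes f: "f \<in> arcs H" and e: "e \<in> starting f" and d: "d \<in> starting f" and ne: "e \<noteq> d"
  shows "star A (rest P S e) \<otimes> rest P S d = \<zero>"
  using f e
proof (cases rule: rest_cases)
  case 1
  then show ?thesis using starting_single[of e f] d ne by auto
next
  case (2 e' b)
  note * = this
  show ?thesis using f d
  proof (cases rule: rest_cases)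
    case 1
    then show ?thesis using * by simp
  next
    case (2 d' c)
    then have "e' \<noteq> d'" using * ne block_inj[of e d] by auto
    then show ?thesis using * 2 by (simp add: S_orth)
  qed
qed

text \<open>For f in N the remainders run through all arcs leaving v, so this is the Cuntz-Krieger
  relation at v. Otherwise P v is the only term.\<close>

lemma sum_rest:
  assumes f: "f \<in> arcs H" and v: "v \<in> verts G" "h v = head H f"
  shows "(\<Oplus>e\<in>starting f. rest P S e \<otimes> star A (rest P S e)) = P v"
proof (cases "f \<in> N")
  case False
  obtain e where e: "e \<in> arcs G" "\<phi> e = [f]" using single_block f False by blast
  have "h (head G e) = h v" using head_block[OF e(1)] e v by simp
  then have hv: "head G e = v" using e v by (intro h_inj) auto
  have "rest P S e = P v" using e hv by (simp add: rest_def)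
  then show ?thesis using v starting_single[OF e] by (simp add: P_star P_idem P_closed)
next
  case True
  let ?j = "\<lambda>e. block_arc [last (\<phi> e)]"
  note bij = starting_double_arcs[OF f True v]
  have r: "rest P S e = S (?j e)" if "e \<in> starting f" for e
  proof -
    have "tl (\<phi> e) = [last (\<phi> e)]"
      using starting_double(2)[OF f True that] by (metis list.sel(3))
    then show ?thesis by (simp add: rest_def)
  qed
  have "P v = (\<Oplus>e\<in>?j ` starting f. S e \<otimes> star A (S e))"
    using P_sum[OF v(1)] bij by (simp add: bij_betw_def)
  also have "\<dots> = (\<Oplus>e\<in>starting f. S (?j e) \<otimes> star A (S (?j e)))"
    using bij by (intro finsum_reindex) (auto simp: bij_betw_def S_closed closed_simps)
  also have "\<dots> = (\<Oplus>e\<in>starting f. rest P S e \<otimes> star A (rest P S e))"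
    using r rest_closed[OF f] by (intro finsum_cong') (auto simp: closed_simps)
  finally show ?thesis by simp
qed

lemma P_rest:
  assumes f: "f \<in> arcs H" and e: "e \<in> starting f" and v: "v \<in> verts G" "h v = head H f"
  shows "P v \<otimes> rest P S e = rest P S e"
  using f e
proof (cases rule: rest_cases)
  case 1
  then have "h (head G e) = h v" using head_block[of e] v by simp
  then have "head G e = v" using 1 v by (intro h_inj) auto
  then show ?thesis using 1 v by (simp add: P_idem)
next
  case (2 e' b)
  have "head H f = tail H b"
    using 2(6) by (rule block_cases) (use 2 in auto)
  then have "h (tail G e') = h v" using tail_block[OF 2(5)] 2 v by simp
  then have "tail G e' = v" using 2 v by (intro h_inj) auto
  then show ?thesis using 2 P_tail_S[of e'] by simp
qed

lemma starting_arc: "e \<in> starting f \<Longrightarrow> e \<in> arcs G"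
  by (simp add: starting_def)

lemma push_arc_closed: "f \<in> arcs H \<Longrightarrow> push_arc A P S f \<in> carrier A"
  unfolding push_arc_def
  by (intro finsum_closed) (auto simp: rest_closed S_closed starting_arc closed_simps)

lemma star_push_arc:
  assumes f: "f \<in> arcs H"
  shows "star A (push_arc A P S f) = (\<Oplus>e\<in>starting f. rest P S e \<otimes> star A (S e))"
proof -
  have "star A (push_arc A P S f) = (\<Oplus>e\<in>starting f. star A (S e \<otimes> star A (rest P S e)))"
    unfolding push_arc_def using finite_starting[OF f]
    by (intro star_finsum) (auto simp: rest_closed[OF f] S_closed starting_arc closed_simps)
  also have "\<dots> = (\<Oplus>e\<in>starting f. rest P S e \<otimes> star A (S e))"
    by (intro finsum_cong')
      (auto simp: rest_closed[OF f] S_closed starting_arc closed_simps star_mult star_star)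
  finally show ?thesis .
qed

text \<open>The double sum collapses to its diagonal by \<open>rest_orth\<close>, and there the
  inner product of remainders is a vertex projection, which the edge operator absorbs.\<close>

lemma push_arc_star_push_arc:
  assumes f: "f \<in> arcs H"
  shows "push_arc A P S f \<otimes> star A (push_arc A P S f) = (\<Oplus>e\<in>starting f. S e \<otimes> star A (S e))"
proof -
  note closed = rest_closed[OF f] S_closed starting_arc closed_simps
  have "push_arc A P S f \<otimes> star A (push_arc A P S f)
      = (\<Oplus>e\<in>starting f. (S e \<otimes> star A (rest P S e)) \<otimes> (rest P S e \<otimes> star A (S e)))"
    unfolding star_push_arc[OF f] unfolding push_arc_def
  proof (intro finsum_mult_orth)
    fix e d assume *: "e \<in> starting f" "d \<in> starting f" "e \<noteq> d"
    have "S e \<otimes> star A (rest P S e) \<otimes> (rest P S d \<otimes> star A (S d))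
        = S e \<otimes> ((star A (rest P S e) \<otimes> rest P S d) \<otimes> star A (S d))"
      using * by (simp add: closed mult_assoc)
    then show "S e \<otimes> star A (rest P S e) \<otimes> (rest P S d \<otimes> star A (S d)) = \<zero>"
      using * by (simp add: rest_orth[OF f] closed mult_zero_left mult_zero_right)
  qed (auto simp: closed finite_starting[OF f])
  also have "\<dots> = (\<Oplus>e\<in>starting f. S e \<otimes> star A (S e))"
  proof (intro finsum_cong')
    fix e assume *: "e \<in> starting f"
    have "S e \<otimes> star A (rest P S e) \<otimes> (rest P S e \<otimes> star A (S e))
        = S e \<otimes> ((star A (rest P S e) \<otimes> rest P S e) \<otimes> star A (S e))"
      using * by (simp add: closed mult_assoc)
    then show "S e \<otimes> star A (rest P S e) \<otimes> (rest P S e \<otimes> star A (S e)) = S e \<otimes> star A (S e)"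
      using * by (simp add: rest_star_rest[OF f] P_head_S_star closed)
  qed (auto simp: closed)
  finally show ?thesis .
qed

text \<open>In this order the edge operators meet in the middle: \<open>S_orth\<close> removes the
  cross terms, and \<open>sum_rest\<close> adds up the diagonal.\<close>

lemma star_push_arc_push_arc:
  assumes f: "f \<in> arcs H" and v: "v \<in> verts G" "h v = head H f"
  shows "star A (push_arc A P S f) \<otimes> push_arc A P S f = P v"
proof -
  note closed = rest_closed[OF f] S_closed starting_arc closed_simps
  have "star A (push_arc A P S f) \<otimes> push_arc A P S f
      = (\<Oplus>e\<in>starting f. (rest P S e \<otimes> star A (S e)) \<otimes> (S e \<otimes> star A (rest P S e)))"
    unfolding star_push_arc[OF f] unfolding push_arc_def
  proof (intro finsum_mult_orth)
    fix e d assume *: "e \<in> starting f" "d \<in> starting f" "e \<noteq> d"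
    have "rest P S e \<otimes> star A (S e) \<otimes> (S d \<otimes> star A (rest P S d))
        = rest P S e \<otimes> ((star A (S e) \<otimes> S d) \<otimes> star A (rest P S d))"
      using * by (simp add: closed mult_assoc)
    then show "rest P S e \<otimes> star A (S e) \<otimes> (S d \<otimes> star A (rest P S d)) = \<zero>"
      using * by (simp add: S_orth closed mult_zero_left mult_zero_right)
  qed (auto simp: closed finite_starting[OF f])
  also have "\<dots> = (\<Oplus>e\<in>starting f. rest P S e \<otimes> star A (rest P S e))"
  proof (intro finsum_cong')
    fix e assume *: "e \<in> starting f"
    have "rest P S e \<otimes> star A (S e) \<otimes> (S e \<otimes> star A (rest P S e))
        = (rest P S e \<otimes> (star A (S e) \<otimes> S e)) \<otimes> star A (rest P S e)"
      using * by (simp add: closed mult_assoc)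
    then show "rest P S e \<otimes> star A (S e) \<otimes> (S e \<otimes> star A (rest P S e))
        = rest P S e \<otimes> star A (rest P S e)"
      using * by (simp add: S_star_S starting_arc rest_P_head[OF f])
  qed (auto simp: closed)
  also have "\<dots> = P v" by (rule sum_rest[OF f v])
  finally show ?thesis .
qed

lemma push_arc_P:
  assumes f: "f \<in> arcs H" and v: "v \<in> verts G" "h v = head H f"
  shows "push_arc A P S f \<otimes> P v = push_arc A P S f"
proof -
  note closed = rest_closed[OF f] S_closed starting_arc closed_simps P_closed[OF v(1)]
  have "push_arc A P S f \<otimes> P v = (\<Oplus>e\<in>starting f. S e \<otimes> star A (rest P S e) \<otimes> P v)"
    unfolding push_arc_def by (intro finsum_mult_right) (auto simp: closed finite_starting[OF f])
  also have "\<dots> = push_arc A P S f"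
    unfolding push_arc_def
  proof (intro finsum_cong')
    fix e assume *: "e \<in> starting f"
    have "star A (P v \<otimes> rest P S e) = star A (rest P S e)" using P_rest[OF f * v] by simp
    then have "star A (rest P S e) \<otimes> P v = star A (rest P S e)"
      using * by (simp add: star_mult closed P_star[OF v(1)])
    then show "S e \<otimes> star A (rest P S e) \<otimes> P v = S e \<otimes> star A (rest P S e)"
      using * by (simp add: mult_assoc closed)
  qed (auto simp: closed)
  finally show ?thesis .
qed

lemma cuntz_krieger_push: "cuntz_krieger_family H A (push_vertex P) (push_arc A P S)"
  unfolding cuntz_krieger_family_def
proof (intro conjI ballI impI)
  fix w assume "w \<in> verts H"
  then show "projection A (push_vertex P w)"
    using vertex_preimage[of w] by (metis P_proj push_vertex_h)
next
  fix w w' assume w: "w \<in> verts H" "w' \<in> verts H" "w \<noteq> w'"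
  obtain v where "v \<in> verts G" "h v = w" "push_vertex P w = P v" using vertex_preimage[OF w(1)] push_vertex_h by metis
  moreover obtain v' where "v' \<in> verts G" "h v' = w'" "push_vertex P w' = P v'"
    using vertex_preimage[OF w(2)] push_vertex_h by metis
  ultimately show "push_vertex P w \<otimes> push_vertex P w' = \<zero>" using w(3) P_orth[of v v'] by auto
next
  fix f assume f: "f \<in> arcs H"
  obtain v where v: "v \<in> verts G" "h v = head H f" "push_vertex P (head H f) = P v"
    using vertex_preimage[OF H.head_in_verts[OF f]] push_vertex_h by metis
  show "star A (push_arc A P S f) \<otimes> push_arc A P S f = push_vertex P (head H f)"
    using star_push_arc_push_arc[OF f v(1,2)] v(3) by simp
  show "partial_isometry A (push_arc A P S f)"
    using push_arc_P[OF f v(1,2)] push_arc_closed[OF f] star_push_arc_push_arc[OF f v(1,2)]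
    by (simp add: partial_isometry_def mult_assoc star_closed)
next
  fix w assume "w \<in> tail H ` arcs H"
  then have "w \<in> verts H" by auto
  then obtain v where v: "v \<in> verts G" "h v = w" "push_vertex P w = P v" using vertex_preimage push_vertex_h by metis
  \<comment> \<open>The relation at v in G becomes the one at w in H, since the inner sums are the
    range projections of the pushed arcs.\<close>
  have "P v = (\<Oplus>f\<in>out_arcs H (h v). \<Oplus>e\<in>starting f. S e \<otimes> star A (S e))"
    unfolding P_sum[OF v(1)]
    by (rule finsum_out_arcs[OF _ v(1)]) (auto simp: S_closed closed_simps abelian_monoid_axioms)
  also have "\<dots> = (\<Oplus>f\<in>out_arcs H w. push_arc A P S f \<otimes> star A (push_arc A P S f))"
  proof (intro finsum_cong')
    show "(\<lambda>f. push_arc A P S f \<otimes> star A (push_arc A P S f)) \<in> out_arcs H w \<rightarrow> carrier A"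
      by (auto simp: push_arc_closed closed_simps)
  qed (auto simp: v(2) push_arc_star_push_arc)
  finally show "push_vertex P w = (\<Oplus>f\<in>out_arcs H w. push_arc A P S f \<otimes> star A (push_arc A P S f))"
    using v(3) by simp
qed

lemma push_arc_single:
  assumes "e \<in> arcs G" "\<phi> e = [f]"
  shows "push_arc A P S f = S e"
  unfolding push_arc_def starting_single[OF assms] using assms
  by (simp add: rest_def P_star S_P_head S_closed P_closed closed_simps)

text \<open>For a block \<open>[a, b]\<close> the operator of b is \<open>rest P S e\<close>.
  Against it, the sum defining the operator of a keeps only the term of e.\<close>

lemma pull_push_arc:
  assumes e: "e \<in> arcs G"
  shows "pull_arc A (push_arc A P S) e = S e"
  using e
proof (cases rule: block_cases)
  case (1 f)
  then show ?thesis using push_arc_single[OF e] by (simp add: pull_arc_def)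
next
  case (2 a b)
  obtain d where d: "d \<in> arcs G" "\<phi> d = [b]" using single_block 2 by blast
  have es: "e \<in> starting a" using e 2 by (simp add: starting_def)
  have rd: "rest P S e = S d" using 2 block_arc_eq[OF d] by (simp add: rest_def)
  note closed = rest_closed[OF 2(2)] S_closed starting_arc closed_simps d
  have "pull_arc A (push_arc A P S) e = push_arc A P S a \<otimes> S d"
    using 2 push_arc_single[OF d] by (simp add: pull_arc_def)
  also have "\<dots> = (\<Oplus>c\<in>starting a. S c \<otimes> star A (rest P S c) \<otimes> S d)"
    unfolding push_arc_def by (intro finsum_mult_right) (auto simp: closed finite_starting[OF 2(2)])
  also have "\<dots> = S e \<otimes> star A (rest P S e) \<otimes> S d"
  proof (rule finsum_single[OF finite_starting[OF 2(2)] es])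
    fix c assume c: "c \<in> starting a" "c \<noteq> e"
    then show "S c \<otimes> star A (rest P S c) \<otimes> S d = \<zero>"
      using rest_orth[OF 2(2) c(1) es c(2)] by (simp add: rd mult_assoc closed mult_zero_right)
  qed (auto simp: closed)
  also have "\<dots> = S e"
    using rest_star_rest[OF 2(2) es] e by (simp add: rd mult_assoc closed S_P_head)
  finally show ?thesis .
qed

end

section \<open>From families of H to families of G\<close>

locale pull_family = row_finite_substitution G H h \<phi> N + ck_family A H Q T
  for A :: "'a cstar" (structure) and G :: "('v, 'e) pre_digraph"
    and H :: "('w, 'f) pre_digraph" and Q T and h \<phi> N
begin

lemma pull_arc_closed: "e \<in> arcs G \<Longrightarrow> pull_arc A T e \<in> carrier A"
  by (erule block_cases) (simp_all add: pull_arc_def S_closed closed_simps)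

text \<open>For f in N the second arcs run through all arcs leaving the head of f, so the sum is the
  Cuntz-Krieger relation at that head, conjugated by T f.\<close>

lemma sum_pull_starting:
  assumes f: "f \<in> arcs H"
  shows "(\<Oplus>e\<in>starting f. pull_arc A T e \<otimes> star A (pull_arc A T e)) = T f \<otimes> star A (T f)"
proof (cases "f \<in> N")
  case False
  obtain e where e: "e \<in> arcs G" "\<phi> e = [f]" using single_block f False by blast
  then show ?thesis using f by (simp add: starting_single pull_arc_def S_closed closed_simps)
next
  case True
  let ?j = "\<lambda>e. last (\<phi> e)"
  note bij = starting_double(1)[OF f True]
  have img: "?j e \<in> out_arcs H (head H f)" if "e \<in> starting f" for e
    using bij that by (auto simp: bij_betw_def)
  then have closed: "T (?j e) \<in> carrier A" if "e \<in> starting f" for e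
    using that by (auto simp: S_closed)
  have pull: "pull_arc A T e = T f \<otimes> T (?j e)" if "e \<in> starting f" for e
    using starting_double(2)[OF f True that] unfolding pull_arc_def
    by (metis list.sel(1,3) list.distinct(1))
  have "(\<Oplus>e\<in>starting f. pull_arc A T e \<otimes> star A (pull_arc A T e))
      = (\<Oplus>e\<in>starting f. T f \<otimes> (T (?j e) \<otimes> star A (T (?j e))) \<otimes> star A (T f))"
    using closed f by (intro finsum_cong')
      (auto simp: pull star_mult mult_assoc S_closed closed_simps)
  also have "\<dots> = T f \<otimes> (\<Oplus>e\<in>starting f. T (?j e) \<otimes> star A (T (?j e))) \<otimes> star A (T f)"
    using closed f finite_starting[OF f]
    by (simp add: finsum_mult_left finsum_mult_right Pi_iff S_closed closed_simps)
  also have "(\<Oplus>e\<in>starting f. T (?j e) \<otimes> star A (T (?j e)))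
      = (\<Oplus>b\<in>?j ` starting f. T b \<otimes> star A (T b))"
    using bij img by (intro finsum_reindex[symmetric])
      (auto simp: bij_betw_def S_closed closed_simps)
  also have "\<dots> = Q (head H f)"
    using P_sum[of "head H f"] bij f by (simp add: bij_betw_def)
  finally show ?thesis using f by (simp add: S_P_head)
qed

lemma cuntz_krieger_pull: "cuntz_krieger_family G A (\<lambda>v. Q (h v)) (pull_arc A T)"
  unfolding cuntz_krieger_family_def
proof (intro conjI ballI impI)
  fix v assume "v \<in> verts G"
  then show "projection A (Q (h v))" by (simp add: P_proj h_verts)
next
  fix v v' assume "v \<in> verts G" "v' \<in> verts G" "v \<noteq> v'"
  then show "Q (h v) \<otimes> Q (h v') = \<zero>" using P_orth h_verts h_inj by metis
next
  fix e assume e: "e \<in> arcs G"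
  note hd = head_block[OF e]
  from e have "star A (pull_arc A T e) \<otimes> pull_arc A T e = Q (h (head G e))
      \<and> partial_isometry A (pull_arc A T e)"
  proof (cases rule: block_cases)
    case (1 f)
    then show ?thesis using hd by (simp add: pull_arc_def S_star_S partial_isometry_def S_partial S_closed)
  next
    case (2 a b)
    have p: "pull_arc A T e = T a \<otimes> T b" using 2 by (simp add: pull_arc_def)
    have "star A (T a) \<otimes> (T a \<otimes> T b) = (star A (T a) \<otimes> T a) \<otimes> T b"
      using 2 by (simp add: mult_assoc S_closed closed_simps)
    then have ab: "star A (T a) \<otimes> (T a \<otimes> T b) = T b"
      using 2 P_tail_S[of b] by (simp add: S_star_S)
    show ?thesis using 2 hd S_partial[of b]
      by (simp add: p partial_isometry_def star_mult mult_assoc S_closed closed_simps ab S_star_S)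
  qed
  then show "star A (pull_arc A T e) \<otimes> pull_arc A T e = Q (h (head G e))"
    "partial_isometry A (pull_arc A T e)" by auto
next
  fix v assume "v \<in> tail G ` arcs G"
  then have v: "v \<in> verts G" by auto
  have "Q (h v) = (\<Oplus>f\<in>out_arcs H (h v). T f \<otimes> star A (T f))" by (rule P_sum[OF h_verts[OF v]])
  also have "\<dots> = (\<Oplus>f\<in>out_arcs H (h v). \<Oplus>e\<in>starting f. pull_arc A T e \<otimes> star A (pull_arc A T e))"
    by (intro finsum_cong') (auto simp: sum_pull_starting S_closed closed_simps)
  also have "\<dots> = (\<Oplus>e\<in>out_arcs G v. pull_arc A T e \<otimes> star A (pull_arc A T e))"
    by (rule finsum_out_arcs[OF _ v, symmetric])
      (auto simp: pull_arc_closed closed_simps abelian_monoid_axioms)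
  finally show "Q (h v) = (\<Oplus>e\<in>out_arcs G v. pull_arc A T e \<otimes> star A (pull_arc A T e))" .
qed

lemma push_pull_arc:
  assumes f: "f \<in> arcs H"
  shows "push_arc A (\<lambda>v. Q (h v)) (pull_arc A T) f = T f"
proof (cases "f \<in> N")
  case False
  obtain e where e: "e \<in> arcs G" "\<phi> e = [f]" using single_block f False by blast
  have "pull_arc A T e = T f" "rest (\<lambda>v. Q (h v)) (pull_arc A T) e = Q (head H f)"
    using e head_block[OF e(1)] by (simp_all add: pull_arc_def rest_def)
  then show ?thesis using f unfolding push_arc_def starting_single[OF e]
    by (simp add: P_star P_closed S_P_head S_closed closed_simps)
next
  case True
  \<comment> \<open>Each term T_f T_b T_b^* is rewritten as the range projection of T_f T_b times
    T_f, so that \<open>sum_pull_starting\<close> applies to the whole sum.\<close>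
  have "push_arc A (\<lambda>v. Q (h v)) (pull_arc A T) f
      = (\<Oplus>e\<in>starting f. pull_arc A T e \<otimes> star A (pull_arc A T e) \<otimes> T f)"
    unfolding push_arc_def
  proof (intro finsum_cong')
    fix e assume e: "e \<in> starting f"
    obtain b where b: "\<phi> e = [f, b]" using starting_double(2)[OF f True e] by blast
    have ea: "e \<in> arcs G" using e by (simp add: starting_def)
    have b': "b \<in> arcs H \<and> b \<notin> N \<and> head H f = tail H b"
      using ea by (rule block_cases) (use b in auto)
    obtain d where d: "d \<in> arcs G" "\<phi> d = [b]" using single_block b' by blast
    have p: "pull_arc A T e = T f \<otimes> T b" using b by (simp add: pull_arc_def)
    have "rest (\<lambda>v. Q (h v)) (pull_arc A T) e = T b"
      using b d block_arc_eq[OF d] by (simp add: rest_def pull_arc_def)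
    then show "pull_arc A T e \<otimes> star A (rest (\<lambda>v. Q (h v)) (pull_arc A T) e)
        = pull_arc A T e \<otimes> star A (pull_arc A T e) \<otimes> T f"
      using p f b' S_star_P_tail[of b]
      by (simp add: star_mult mult_assoc S_closed closed_simps S_star_S)
  qed (use f in \<open>auto simp: pull_arc_closed S_closed closed_simps starting_def\<close>)
  also have "\<dots> = (\<Oplus>e\<in>starting f. pull_arc A T e \<otimes> star A (pull_arc A T e)) \<otimes> T f"
    using f finite_starting[OF f]
    by (intro finsum_mult_right[symmetric]) (auto simp: pull_arc_closed S_closed closed_simps starting_def)
  also have "\<dots> = T f" using f by (simp add: sum_pull_starting S_partial)
  finally show ?thesis .
qed

end


section \<open>Transfer of the universal property\<close>

lemma (in row_finite_substitution) cuntz_krieger_transfer: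
  assumes A: "cstar_algebra A"
  shows "cuntz_krieger_family G A P S \<Longrightarrow> cuntz_krieger_family H A (push_vertex P) (push_arc A P S)"
    and "\<lbrakk>cuntz_krieger_family G A P S; e \<in> arcs G\<rbrakk> \<Longrightarrow> pull_arc A (push_arc A P S) e = S e"
    and "cuntz_krieger_family H A Q T \<Longrightarrow> cuntz_krieger_family G A (\<lambda>v. Q (h v)) (pull_arc A T)"
    and "\<lbrakk>cuntz_krieger_family H A Q T; f \<in> arcs H\<rbrakk> \<Longrightarrow>
      push_arc A (\<lambda>v. Q (h v)) (pull_arc A T) f = T f"
proof -
  have push: "push_family A G P S H h \<phi> N" if "cuntz_krieger_family G A P S"
    using that A row_finite_G no_sinks_G
    by (simp add: push_family_def ck_family_def ck_family_axioms_def row_finite_substitution_axioms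
      G.wf_digraph)
  have pull: "pull_family A G H Q T h \<phi> N" if "cuntz_krieger_family H A Q T"
    using that A row_finite_H no_sinks_H
    by (simp add: pull_family_def ck_family_def ck_family_axioms_def row_finite_substitution_axioms
      H.wf_digraph)
  show "cuntz_krieger_family G A P S \<Longrightarrow> cuntz_krieger_family H A (push_vertex P) (push_arc A P S)"
    by (rule push_family.cuntz_krieger_push[OF push])
  show "\<lbrakk>cuntz_krieger_family G A P S; e \<in> arcs G\<rbrakk> \<Longrightarrow> pull_arc A (push_arc A P S) e = S e"
    by (rule push_family.pull_push_arc[OF push])
  show "cuntz_krieger_family H A Q T \<Longrightarrow> cuntz_krieger_family G A (\<lambda>v. Q (h v)) (pull_arc A T)"
    by (rule pull_family.cuntz_krieger_pull[OF pull])
  show "\<lbrakk>cuntz_krieger_family H A Q T; f \<in> arcs H\<rbrakk> \<Longrightarrow>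
      push_arc A (\<lambda>v. Q (h v)) (pull_arc A T) f = T f"
    by (rule pull_family.push_pull_arc[OF pull])
qed

lemma cuntz_krieger_family_closed:
  assumes "cuntz_krieger_family G A P S"
  shows "v \<in> verts G \<Longrightarrow> P v \<in> carrier A" and "e \<in> arcs G \<Longrightarrow> S e \<in> carrier A"
  using assms by (auto simp: cuntz_krieger_family_def projection_def partial_isometry_def)

context row_finite_substitution
begin

lemma rest_image:
  assumes "e \<in> arcs G" and "\<And>v. v \<in> verts G \<Longrightarrow> g (P v) = P' v"
    and "\<And>e. e \<in> arcs G \<Longrightarrow> g (S e) = S' e"
  shows "g (rest P S e) = rest P' S' e"
  using assms(1)
proof (cases rule: block_cases)
  case (1 f)
  then show ?thesis using assms by (simp add: rest_def)
next
  case (2 a b)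
  then obtain d where d: "d \<in> arcs G" "\<phi> d = [b]" using single_block by blast
  then show ?thesis using assms(3) 2 block_arc_eq[OF d] by (simp add: rest_def)
qed

lemma rest_mem:
  assumes "e \<in> arcs G" and "\<And>v. v \<in> verts G \<Longrightarrow> P v \<in> K" and "\<And>e. e \<in> arcs G \<Longrightarrow> S e \<in> K"
  shows "rest P S e \<in> K"
  using assms(1)
proof (cases rule: block_cases)
  case (1 f)
  then show ?thesis using assms by (simp add: rest_def)
next
  case (2 a b)
  then obtain d where d: "d \<in> arcs G" "\<phi> d = [b]" using single_block by blast
  then show ?thesis using assms(3) 2 block_arc_eq[OF d] by (simp add: rest_def)
qed

lemma hom_push_arc:
  assumes A: "cstar_algebra A" and B: "cstar_algebra B" and g: "star_hom g A B"
    and P: "\<And>v. v \<in> verts G \<Longrightarrow> P v \<in> carrier A \<and> g (P v) = P' v"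
    and S: "\<And>e. e \<in> arcs G \<Longrightarrow> S e \<in> carrier A \<and> g (S e) = S' e" and f: "f \<in> arcs H"
  shows "g (push_arc A P S f) = push_arc B P' S' f"
proof -
  interpret cstar_hom A B g using A B g by (simp add: cstar_hom_def cstar_hom_axioms_def)
  have r: "rest P S e \<in> carrier A" "g (rest P S e) = rest P' S' e" if "e \<in> arcs G" for e
    using rest_mem[OF that, of P "carrier A" S] rest_image[OF that, of g P P' S S'] P S by auto
  have e: "e \<in> arcs G" if "e \<in> starting f" for e using that by (simp add: starting_def)
  have c: "S' e \<otimes>\<^bsub>B\<^esub> star B (rest P' S' e) \<in> carrier B" if "e \<in> arcs G" for e
    using hom_closed[OF r(1)[OF that]] hom_closed[of "S e"] S[OF that] r(2)[OF that]
    by (simp add: B.closed_simps)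
  have "g (push_arc A P S f) = (\<Oplus>\<^bsub>B\<^esub>e\<in>starting f. g (S e \<otimes>\<^bsub>A\<^esub> star A (rest P S e)))"
    unfolding push_arc_def using finite_starting[OF f]
    by (intro hom_finsum) (auto simp: r S e A.closed_simps)
  also have "\<dots> = push_arc B P' S' f"
    unfolding push_arc_def
    by (intro B.finsum_cong') (auto simp: c e r S hom_mult hom_star A.closed_simps)
  finally show ?thesis .
qed

lemma hom_pull_arc:
  assumes g: "star_hom g A B" and T: "\<And>f. f \<in> arcs H \<Longrightarrow> T f \<in> carrier A \<and> g (T f) = T' f"
    and e: "e \<in> arcs G"
  shows "g (pull_arc A T e) = pull_arc B T' e"
  using e
proof (cases rule: block_cases)
  case (1 f)
  then show ?thesis using T by (simp add: pull_arc_def)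
next
  case (2 a b)
  then show ?thesis using T[of a] T[of b] g by (simp add: pull_arc_def star_hom_def)
qed

lemma pull_arc_mem:
  assumes K: "closed_star_subalgebra K A" and T: "\<And>f. f \<in> arcs H \<Longrightarrow> T f \<in> K" and e: "e \<in> arcs G"
  shows "pull_arc A T e \<in> K"
  using e
proof (cases rule: block_cases)
  case (1 f)
  then show ?thesis using T by (simp add: pull_arc_def)
next
  case (2 a b)
  then show ?thesis using T[of a] T[of b] K by (simp add: pull_arc_def closed_star_subalgebra_def)
qed

lemma push_arc_mem:
  assumes A: "cstar_algebra A" and K: "closed_star_subalgebra K A"
    and P: "\<And>v. v \<in> verts G \<Longrightarrow> P v \<in> K" and S: "\<And>e. e \<in> arcs G \<Longrightarrow> S e \<in> K" and f: "f \<in> arcs H"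
  shows "push_arc A P S f \<in> K"
  unfolding push_arc_def
proof (rule closed_star_subalgebra_finsum[OF _ K finite_starting[OF f]])
  interpret cstar_algebra A by (rule A)
  show "abelian_monoid A" by (rule abelian_monoid_axioms)
  fix e assume "e \<in> starting f"
  then have "S e \<in> K" "rest P S e \<in> K" using S rest_mem[of e P K S] P by (auto simp: starting_def)
  then show "S e \<otimes>\<^bsub>A\<^esub> star A (rest P S e) \<in> K" using K by (simp add: closed_star_subalgebra_def)
qed

text \<open>The algebra stays and only the family changes. A closed *-subalgebra containing the
  pushed family contains the original one, which pulling recovers. A test family of H is pulled to
  G, and the homomorphism obtained there fits it, because pushing commutes with *-homomorphisms and
  undoes pulling.\<close>

lemma universal_push:
  fixes A :: "'a cstar"
  assumes A: "cstar_algebra A" and univ: "universal_cuntz_krieger_family G A P S"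
  shows "universal_cuntz_krieger_family H A (push_vertex P) (push_arc A P S)"
  unfolding universal_cuntz_krieger_family_def generates_cstar_def
proof (intro conjI allI impI)
  have ck: "cuntz_krieger_family G A P S" and gen: "generates_cstar (P ` verts G \<union> S ` arcs G) A"
    using univ by (auto simp: universal_cuntz_krieger_family_def)
  show ckH: "cuntz_krieger_family H A (push_vertex P) (push_arc A P S)"
    by (rule cuntz_krieger_transfer(1)[OF A ck])
  show "push_vertex P ` verts H \<union> push_arc A P S ` arcs H \<subseteq> carrier A"
    using cuntz_krieger_family_closed[OF ckH] by auto
  fix K assume K: "closed_star_subalgebra K A \<and> push_vertex P ` verts H \<union> push_arc A P S ` arcs H \<subseteq> K"
  have "P v \<in> K" if v: "v \<in> verts G" for v
  proof -
    have "push_vertex P (h v) \<in> K" using K h_verts[OF v] by auto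
    then show ?thesis by (simp add: push_vertex_h v)
  qed
  moreover have "S e \<in> K" if e: "e \<in> arcs G" for e
    using pull_arc_mem[of K A "push_arc A P S" e] K e cuntz_krieger_transfer(2)[OF A ck e] by auto
  ultimately show "K = carrier A" using gen K unfolding generates_cstar_def by blast
next
  fix B :: "'a cstar" and Q T assume B: "cstar_algebra B \<and> cuntz_krieger_family H B Q T"
  have ck: "cuntz_krieger_family G A P S" using univ by (auto simp: universal_cuntz_krieger_family_def)
  obtain g where g: "star_hom g A B" "\<And>v. v \<in> verts G \<Longrightarrow> g (P v) = Q (h v)"
    "\<And>e. e \<in> arcs G \<Longrightarrow> g (S e) = pull_arc B T e"
    using univ B cuntz_krieger_transfer(3)[of B Q T] unfolding universal_cuntz_krieger_family_def
    by (metis (no_types, lifting))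
  have "g (push_vertex P w) = Q w" if w: "w \<in> verts H" for w
    using vertex_preimage[OF w] g(2) push_vertex_h by metis
  moreover have "g (push_arc A P S f) = T f" if f: "f \<in> arcs H" for f
    using hom_push_arc[OF A _ g(1), of P "\<lambda>v. Q (h v)" S "pull_arc B T" f] B f g
      cuntz_krieger_family_closed[OF ck] cuntz_krieger_transfer(4)[of B Q T f] by simp
  ultimately show "\<exists>g. star_hom g A B \<and> (\<forall>w\<in>verts H. g (push_vertex P w) = Q w) \<and>
      (\<forall>f\<in>arcs H. g (push_arc A P S f) = T f)"
    using g(1) by blast
qed

lemma universal_pull:
  fixes A :: "'a cstar"
  assumes A: "cstar_algebra A" and univ: "universal_cuntz_krieger_family H A Q T"
  shows "universal_cuntz_krieger_family G A (\<lambda>v. Q (h v)) (pull_arc A T)"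
  unfolding universal_cuntz_krieger_family_def generates_cstar_def
proof (intro conjI allI impI)
  have ck: "cuntz_krieger_family H A Q T" and gen: "generates_cstar (Q ` verts H \<union> T ` arcs H) A"
    using univ by (auto simp: universal_cuntz_krieger_family_def)
  show ckG: "cuntz_krieger_family G A (\<lambda>v. Q (h v)) (pull_arc A T)"
    by (rule cuntz_krieger_transfer(3)[OF A ck])
  show "(\<lambda>v. Q (h v)) ` verts G \<union> pull_arc A T ` arcs G \<subseteq> carrier A"
    using cuntz_krieger_family_closed[OF ckG] by auto
  fix K assume K: "closed_star_subalgebra K A \<and> (\<lambda>v. Q (h v)) ` verts G \<union> pull_arc A T ` arcs G \<subseteq> K"
  have "Q w \<in> K" if w: "w \<in> verts H" for w
  proof -
    obtain v where "v \<in> verts G" "h v = w" by (rule vertex_preimage[OF w])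
    then show ?thesis using K by auto
  qed
  moreover have "T f \<in> K" if f: "f \<in> arcs H" for f
    using push_arc_mem[OF A, of K "\<lambda>v. Q (h v)" "pull_arc A T" f] K f
      cuntz_krieger_transfer(4)[OF A ck f] by auto
  ultimately show "K = carrier A" using gen K unfolding generates_cstar_def by blast
next
  fix B :: "'a cstar" and P S assume B: "cstar_algebra B \<and> cuntz_krieger_family G B P S"
  have ck: "cuntz_krieger_family H A Q T" using univ by (auto simp: universal_cuntz_krieger_family_def)
  obtain g where g: "star_hom g A B" "\<And>w. w \<in> verts H \<Longrightarrow> g (Q w) = push_vertex P w"
    "\<And>f. f \<in> arcs H \<Longrightarrow> g (T f) = push_arc B P S f"
    using univ B cuntz_krieger_transfer(1)[of B P S] unfolding universal_cuntz_krieger_family_def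
    by (metis (no_types, lifting))
  have "g (Q (h v)) = P v" if "v \<in> verts G" for v
    using g(2) h_verts push_vertex_h that by metis
  moreover have "g (pull_arc A T e) = S e" if e: "e \<in> arcs G" for e
    using hom_pull_arc[OF g(1), of T "push_arc B P S" e] B e g
      cuntz_krieger_family_closed[OF ck] cuntz_krieger_transfer(2)[of B P S e] by simp
  ultimately show "\<exists>g. star_hom g A B \<and> (\<forall>v\<in>verts G. g (Q (h v)) = P v) \<and>
      (\<forall>e\<in>arcs G. g (pull_arc A T e) = S e)"
    using g(1) by blast
qed

lemma graph_cstar_algebra_iff: "graph_cstar_algebra G A \<longleftrightarrow> graph_cstar_algebra H A"
  using universal_push universal_pull unfolding graph_cstar_algebra_def by blast

end

section \<open>Equivalence of graphs\<close>

lemma top_groupoid_isomorphic_trans: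
  assumes "top_groupoid_isomorphic G H" and "top_groupoid_isomorphic H K"
  shows "top_groupoid_isomorphic G K"
proof -
  obtain f g where f: "top_groupoid_iso f G H" and g: "top_groupoid_iso g H K"
    using assms by (auto simp: top_groupoid_isomorphic_def)
  have fH: "f a \<in> arrows H" if "a \<in> arrows G" for a
    using f that by (auto simp: top_groupoid_iso_def bij_betw_def)
  have "top_groupoid_iso (g \<circ> f) G K"
    unfolding top_groupoid_iso_def
  proof (intro conjI)
    show "bij_betw (g \<circ> f) (arrows G) (arrows K)"
      using f g unfolding top_groupoid_iso_def by (blast intro: bij_betw_trans)
    show "homeomorphic_map (gtop G) (gtop K) (g \<circ> f)"
      using f g unfolding top_groupoid_iso_def by (blast intro: homeomorphic_map_compose)
  qed (use f g fH in \<open>simp_all add: top_groupoid_iso_def\<close>)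
  then show ?thesis by (auto simp: top_groupoid_isomorphic_def)
qed

text \<open>The record \<open>top_groupoid\<close> carries no axioms, so closure of G under products
  and inverses is a hypothesis; it lets g undo f on them. The topological inverse of f is only
  determined on \<open>topspace\<close>, and \<open>top\<close> identifies it there with g.\<close>

lemma top_groupoid_isomorphic_sym:
  assumes iso: "top_groupoid_isomorphic G H" and top: "topspace (gtop G) = arrows G"
    and comp: "\<And>a b. \<lbrakk>a \<in> arrows G; b \<in> arrows G; (a, b) \<in> composable G\<rbrakk> \<Longrightarrow> gcomp G a b \<in> arrows G"
    and inv: "\<And>a. a \<in> arrows G \<Longrightarrow> ginv G a \<in> arrows G"
  shows "top_groupoid_isomorphic H G"
proof -
  obtain f where f: "top_groupoid_iso f G H" using iso by (auto simp: top_groupoid_isomorphic_def)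
  then have bij: "bij_betw f (arrows G) (arrows H)"
    and hom: "homeomorphic_map (gtop G) (gtop H) f"
    and f_comp: "\<And>a b. \<lbrakk>a \<in> arrows G; b \<in> arrows G\<rbrakk> \<Longrightarrow>
      (a, b) \<in> composable G \<longleftrightarrow> (f a, f b) \<in> composable H"
    and f_gcomp: "\<And>a b. \<lbrakk>a \<in> arrows G; b \<in> arrows G; (a, b) \<in> composable G\<rbrakk> \<Longrightarrow>
      f (gcomp G a b) = gcomp H (f a) (f b)"
    and f_ginv: "\<And>a. a \<in> arrows G \<Longrightarrow> f (ginv G a) = ginv H (f a)"
    by (auto simp: top_groupoid_iso_def)
  define g where "g = inv_into (arrows G) f"
  have gf: "g (f a) = a" if "a \<in> arrows G" for a
    using bij_betw_inv_into_left[OF bij that] by (simp add: g_def)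
  have fg: "f (g b) = b" and g_arr: "g b \<in> arrows G" if "b \<in> arrows H" for b
    using bij_betw_inv_into_right[OF bij that] bij_betw_apply[OF bij_betw_inv_into[OF bij] that]
    by (auto simp: g_def)
  obtain g' where g': "homeomorphic_maps (gtop G) (gtop H) f g'" using hom by (auto simp: homeomorphic_map_maps)
  have top_H: "topspace (gtop H) = arrows H"
    using homeomorphic_imp_surjective_map[OF hom] bij top by (simp add: bij_betw_def)
  have "g' b = g b" if "b \<in> topspace (gtop H)" for b
  proof -
    have b: "b \<in> arrows H" using that top_H by simp
    then have "g' (f (g b)) = g b"
      using g' g_arr[OF b] top by (auto simp: homeomorphic_maps_def)
    then show ?thesis using fg[OF b] by simp
  qed
  moreover have "homeomorphic_map (gtop H) (gtop G) g'" using g' by (simp add: homeomorphic_maps_map)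
  ultimately have "homeomorphic_map (gtop H) (gtop G) g" by (rule homeomorphic_map_eq[rotated]) auto
  moreover have "(a, b) \<in> composable H \<longleftrightarrow> (g a, g b) \<in> composable G"
    if "a \<in> arrows H" "b \<in> arrows H" for a b
    using f_comp[OF g_arr g_arr, OF that] fg that by simp
  moreover have "g (gcomp H a b) = gcomp G (g a) (g b)"
    if ab: "a \<in> arrows H" "b \<in> arrows H" "(a, b) \<in> composable H" for a b
  proof -
    have "(g a, g b) \<in> composable G" using f_comp[OF g_arr g_arr, OF ab(1,2)] fg ab by simp
    then show ?thesis
      using f_gcomp[of "g a" "g b"] gf[OF comp[of "g a" "g b"]] fg g_arr ab by simp
  qed
  moreover have "g (ginv H b) = ginv G (g b)" if b: "b \<in> arrows H" for b
    using f_ginv[OF g_arr[OF b]] gf[OF inv[OF g_arr[OF b]]] fg[OF b] by simp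
  ultimately have "top_groupoid_iso g H G"
    using bij_betw_inv_into[OF bij] by (auto simp: top_groupoid_iso_def g_def)
  then show ?thesis by (auto simp: top_groupoid_isomorphic_def)
qed

lemma shift_tail_equiv_sym: "shift_tail_equiv x k y \<Longrightarrow> shift_tail_equiv y (- k) x"
  unfolding shift_tail_equiv_iff by (metis minus_diff_eq)

lemma shift_tail_equiv_trans:
  assumes "shift_tail_equiv x k y" and "shift_tail_equiv y l w"
  shows "shift_tail_equiv x (k + l) w"
proof -
  obtain p q z where 1: "x = p \<frown> z" "y = q \<frown> z" "k = int (length p) - int (length q)"
    using assms(1) by (auto simp: shift_tail_equiv_iff)
  obtain p' q' z' where 2: "y = p' \<frown> z'" "w = q' \<frown> z'" "l = int (length p') - int (length q')"
    using assms(2) by (auto simp: shift_tail_equiv_iff)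
  show ?thesis
  proof (cases "length q \<le> length p'")
    case True
    then obtain r where "p' = q @ r" "z = r \<frown> z'" using conc_eq_conc[of q z p' z'] 1 2 by metis
    then show ?thesis using 1 2 unfolding shift_tail_equiv_iff
      by (intro exI[of _ "p @ r"] exI[of _ q'] exI[of _ z']) simp
  next
    case False
    then obtain r where "q = p' @ r" "z' = r \<frown> z" using conc_eq_conc[of p' z' q z] 1 2 by auto
    then show ?thesis using 1 2 unfolding shift_tail_equiv_iff
      by (intro exI[of _ p] exI[of _ "q' @ r"] exI[of _ z]) simp
  qed
qed

lemma path_groupoid_isomorphic_sym:
  assumes "wf_digraph G" and "top_groupoid_isomorphic (path_groupoid G) H"
  shows "top_groupoid_isomorphic H (path_groupoid G)"
  by (rule top_groupoid_isomorphic_sym[OF assms(2) wf_digraph.topspace_path_groupoid[OF assms(1)]])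
    (auto simp: path_groupoid_def intro: shift_tail_equiv_trans shift_tail_equiv_sym)

text \<open>Transferring only the universal property, rather than isomorphisms of graph algebras, avoids
  constructing graph algebras for the intermediate matrices.\<close>

definition algebraically_equivalent ::
  "'a cstar itself \<Rightarrow> ('v, 'e) pre_digraph \<Rightarrow> ('w, 'f) pre_digraph \<Rightarrow> bool" where
  "algebraically_equivalent _ G H \<longleftrightarrow>
     top_groupoid_isomorphic (path_groupoid G) (path_groupoid H) \<and>
     (\<forall>A :: 'a cstar. graph_cstar_algebra G A \<longleftrightarrow> graph_cstar_algebra H A)"

lemma algebraically_equivalent_trans:
  "\<lbrakk>algebraically_equivalent a G H; algebraically_equivalent a H K\<rbrakk> \<Longrightarrow> algebraically_equivalent a G K"
  unfolding algebraically_equivalent_def using top_groupoid_isomorphic_trans by blast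

lemma algebraically_equivalent_sym:
  "\<lbrakk>wf_digraph G; algebraically_equivalent a G H\<rbrakk> \<Longrightarrow> algebraically_equivalent a H G"
  unfolding algebraically_equivalent_def using path_groupoid_isomorphic_sym by blast

lemma algebraically_equivalent_refl: "algebraically_equivalent a G G"
proof -
  have "top_groupoid_iso id (path_groupoid G) (path_groupoid G)"
    by (simp add: top_groupoid_iso_def homeomorphic_map_id)
  then show ?thesis by (auto simp: algebraically_equivalent_def top_groupoid_isomorphic_def)
qed

lemma (in row_finite_substitution) algebraically_equivalent: "algebraically_equivalent a G H"
  using path_groupoid_iso graph_cstar_algebra_iff
  by (auto simp: algebraically_equivalent_def top_groupoid_isomorphic_def)

section \<open>Graphs of matrices\<close>

text \<open>The intermediate matrices of a chain are not given as vertex matrices. Each one gets a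
  graph of its own whose arcs are index pairs.\<close>

definition matrix_graph :: "'v set \<Rightarrow> ('v \<Rightarrow> 'v \<Rightarrow> nat) \<Rightarrow> ('v, 'v \<times> 'v) pre_digraph" where
  "matrix_graph V D = \<lparr>verts = V, arcs = {(i, j). i \<in> V \<and> j \<in> V \<and> D i j = 1}, tail = fst, head = snd\<rparr>"

definition support :: "'v set \<Rightarrow> ('v \<Rightarrow> 'v \<Rightarrow> nat) \<Rightarrow> 'v \<Rightarrow> 'v set" where
  "support V D i = {j \<in> V. D i j = 1}"

definition row_finite_matrix :: "'v set \<Rightarrow> ('v \<Rightarrow> 'v \<Rightarrow> nat) \<Rightarrow> bool" where
  "row_finite_matrix V D \<longleftrightarrow> zero_one_matrix V D \<and> (\<forall>i \<in> V. finite (support V D i) \<and> support V D i \<noteq> {})"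

lemma matrix_graph_simps [simp]:
  "verts (matrix_graph V D) = V" "tail (matrix_graph V D) = fst" "head (matrix_graph V D) = snd"
  "(i, j) \<in> arcs (matrix_graph V D) \<longleftrightarrow> i \<in> V \<and> j \<in> V \<and> D i j = 1"
  by (simp_all add: matrix_graph_def)

lemma wf_matrix_graph: "wf_digraph (matrix_graph V D)"
  by unfold_locales (auto simp: matrix_graph_def)

lemma out_arcs_matrix_graph: "i \<in> V \<Longrightarrow> out_arcs (matrix_graph V D) i = Pair i ` support V D i"
  by (auto simp: matrix_graph_def support_def out_arcs_def)

lemma row_finite_matrix_graph:
  assumes "row_finite_matrix V D"
  shows "row_finite (matrix_graph V D)" "no_sinks (matrix_graph V D)"
  using assms
  by (auto simp: row_finite_def no_sinks_def row_finite_matrix_def out_arcs_matrix_graph)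

lemma algebraically_equivalent_substitution:
  assumes "edge_substitution G H h \<phi> N" and "row_finite G" "no_sinks G" "row_finite H" "no_sinks H"
  shows "algebraically_equivalent a G H"
  using assms
  by (intro row_finite_substitution.algebraically_equivalent)
    (simp add: row_finite_substitution_def row_finite_substitution_axioms_def)

text \<open>The bijection k lets the matrices of E and F be read over one index set, which will be
  the vertex set of F.\<close>

locale indexed_graph = nomulti_digraph G for G :: "('w, 'e) pre_digraph" +
  fixes V :: "'v set" and k :: "'v \<Rightarrow> 'w" and D
  assumes index: "bij_betw k V (verts G)"
    and matrix: "\<And>i j. i \<in> V \<Longrightarrow> j \<in> V \<Longrightarrow> D i j = vertex_matrix G (k i) (k j)"
begin

abbreviation "index_of \<equiv> inv_into V k"

lemma index_of:
  "v \<in> verts G \<Longrightarrow> index_of v \<in> V" "v \<in> verts G \<Longrightarrow> k (index_of v) = v"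
  "i \<in> V \<Longrightarrow> index_of (k i) = i" "i \<in> V \<Longrightarrow> k i \<in> verts G"
  using index by (auto simp: bij_betw_def inv_into_into f_inv_into_f)

lemma card_arcs_between:
  "card {e \<in> arcs G. tail G e = v \<and> head G e = w} =
    (if \<exists>e\<in>arcs G. tail G e = v \<and> head G e = w then 1 else 0)"
proof (cases "\<exists>e\<in>arcs G. tail G e = v \<and> head G e = w")
  case True
  then obtain e where e: "e \<in> arcs G" "tail G e = v" "head G e = w" by blast
  have "e' = e" if "e' \<in> arcs G" "tail G e' = v" "head G e' = w" for e'
    using that e by (intro no_multi_arcs) (auto simp: arc_to_ends_def)
  then have single: "{e \<in> arcs G. tail G e = v \<and> head G e = w} = {e}" using e by blast
  show ?thesis unfolding single using True by simp
next
  case False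
  then have empty: "{e \<in> arcs G. tail G e = v \<and> head G e = w} = {}" by blast
  show ?thesis unfolding empty using False by simp
qed

lemma entry_eq_1_iff:
  assumes "i \<in> V" "j \<in> V"
  shows "D i j = 1 \<longleftrightarrow> (\<exists>e\<in>arcs G. tail G e = k i \<and> head G e = k j)"
  unfolding matrix[OF assms] vertex_matrix_def card_arcs_between by simp

lemma zero_one: "zero_one_matrix V D"
  by (simp add: zero_one_matrix_def matrix vertex_matrix_def card_arcs_between)

lemma bij_betw_support:
  assumes "v \<in> verts G"
  shows "bij_betw (\<lambda>e. index_of (head G e)) (out_arcs G v) (support V D (index_of v))"
proof (rule bij_betw_imageI)
  show "inj_on (\<lambda>e. index_of (head G e)) (out_arcs G v)"
  proof (rule inj_onI)
    fix e e' assume *: "e \<in> out_arcs G v" "e' \<in> out_arcs G v"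
      "index_of (head G e) = index_of (head G e')"
    then have "head G e = head G e'" using index_of(2) by (metis head_in_verts in_out_arcs_conv)
    then show "e = e'" using * by (intro no_multi_arcs) (auto simp: arc_to_ends_def)
  qed
  show "(\<lambda>e. index_of (head G e)) ` out_arcs G v = support V D (index_of v)"
  proof (rule subset_antisym; rule subsetI)
    fix j assume "j \<in> (\<lambda>e. index_of (head G e)) ` out_arcs G v"
    then obtain e where e: "e \<in> arcs G" "tail G e = v" "j = index_of (head G e)" by auto
    then have "D (index_of v) j = 1"
      using assms by (subst entry_eq_1_iff) (auto simp: index_of intro!: bexI[of _ e])
    then show "j \<in> support V D (index_of v)" using e by (simp add: support_def index_of)
  next
    fix j assume j: "j \<in> support V D (index_of v)"
    then obtain e where "e \<in> arcs G" "tail G e = v" "head G e = k j"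
      using entry_eq_1_iff[of "index_of v" j] assms by (auto simp: support_def index_of)
    then show "j \<in> (\<lambda>e. index_of (head G e)) ` out_arcs G v"
      using j by (auto simp: support_def index_of intro!: image_eqI[of _ _ e])
  qed
qed

lemma row_finite_matrix_iff: "row_finite_matrix V D \<longleftrightarrow> row_finite G \<and> no_sinks G"
proof -
  have eqs: "finite (out_arcs G v) \<longleftrightarrow> finite (support V D (index_of v))"
    "out_arcs G v = {} \<longleftrightarrow> support V D (index_of v) = {}" if "v \<in> verts G" for v
    using bij_betw_finite[OF bij_betw_support[OF that]] bij_betw_support[OF that]
    by (auto simp: bij_betw_def)
  have "(\<forall>i\<in>V. Q i) \<longleftrightarrow> (\<forall>v\<in>verts G. Q (index_of v))" for Q
    using index_of by metis
  then have "row_finite_matrix V D \<longleftrightarrow>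
      (\<forall>v\<in>verts G. finite (support V D (index_of v)) \<and> support V D (index_of v) \<noteq> {})"
    unfolding row_finite_matrix_def by (simp only: zero_one simp_thms)
  also have "\<dots> \<longleftrightarrow> row_finite G \<and> no_sinks G"
    by (simp add: eqs row_finite_def no_sinks_def ball_conj_distrib)
  finally show ?thesis .
qed

lemma edge_substitution_matrix_graph:
  "edge_substitution G (matrix_graph V D) index_of
    (\<lambda>e. [(index_of (tail G e), index_of (head G e))]) {}"
proof -
  interpret H: wf_digraph "matrix_graph V D" by (rule wf_matrix_graph)
  let ?\<phi> = "\<lambda>e. [(index_of (tail G e), index_of (head G e))]"
  show ?thesis
  proof unfold_locales
    show "bij_betw index_of (verts G) (verts (matrix_graph V D))"
      using bij_betw_inv_into[OF index] by simp
    have "inj_on ?\<phi> (arcs G)"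
    proof (rule inj_onI)
      fix e e' assume *: "e \<in> arcs G" "e' \<in> arcs G" "?\<phi> e = ?\<phi> e'"
      then have "tail G e = tail G e'" "head G e = head G e'"
        using index_of(2) by (metis head_in_verts tail_in_verts list.inject prod.inject)+
      then show "e = e'" using * by (intro no_multi_arcs) (auto simp: arc_to_ends_def)
    qed
    moreover have "?\<phi> ` arcs G = {[f] |f. f \<in> arcs (matrix_graph V D)}"
    proof (rule subset_antisym; rule subsetI)
      fix l assume "l \<in> ?\<phi> ` arcs G"
      then obtain e where e: "e \<in> arcs G" "l = ?\<phi> e" by blast
      then have "D (index_of (tail G e)) (index_of (head G e)) = 1"
        by (subst entry_eq_1_iff) (auto simp: index_of intro!: bexI[of _ e])
      then show "l \<in> {[f] |f. f \<in> arcs (matrix_graph V D)}" using e by (simp add: index_of)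
    next
      fix l assume "l \<in> {[f] |f. f \<in> arcs (matrix_graph V D)}"
      then obtain i j where ij: "l = [(i, j)]" "i \<in> V" "j \<in> V" "D i j = 1" by auto
      then obtain e where "e \<in> arcs G" "tail G e = k i" "head G e = k j"
        using entry_eq_1_iff[of i j] by blast
      then show "l \<in> ?\<phi> ` arcs G" using ij by (auto simp: index_of intro!: image_eqI[of _ _ e])
    qed
    ultimately show "bij_betw ?\<phi> (arcs G) ({[f] |f. f \<in> arcs (matrix_graph V D) - {}} \<union>
      {[a, b] |a b. a \<in> arcs (matrix_graph V D) \<inter> {} \<and> b \<in> arcs (matrix_graph V D) - {} \<and>
        head (matrix_graph V D) a = tail (matrix_graph V D) b})"
      by (simp add: bij_betw_def)
  qed simp_all
qed

lemma algebraically_equivalent_matrix_graph: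
  "row_finite_matrix V D \<Longrightarrow> algebraically_equivalent a G (matrix_graph V D)"
  using algebraically_equivalent_substitution[OF edge_substitution_matrix_graph] row_finite_matrix_graph
    row_finite_matrix_iff by blast

end

section \<open>Permutations and primitive transfers\<close>

lemma permutation_conjugate_equivalent:
  assumes "permutation_conjugate V B C" and C: "row_finite_matrix V C"
  shows "row_finite_matrix V B" "algebraically_equivalent a (matrix_graph V B) (matrix_graph V C)"
proof -
  obtain \<pi> where \<pi>: "bij_betw \<pi> V V" and eq: "\<And>i j. i \<in> V \<Longrightarrow> j \<in> V \<Longrightarrow> B i j = C (\<pi> i) (\<pi> j)"
    using assms(1) by (auto simp: permutation_conjugate_def)
  have \<pi>V: "\<pi> i \<in> V" if "i \<in> V" for i using \<pi> that by (auto simp: bij_betw_def)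
  have supp: "bij_betw \<pi> (support V B i) (support V C (\<pi> i))" if "i \<in> V" for i
  proof (rule bij_betw_imageI)
    show "inj_on \<pi> (support V B i)" using \<pi> by (auto simp: bij_betw_def support_def inj_on_def)
    show "\<pi> ` support V B i = support V C (\<pi> i)"
    proof (rule subset_antisym; rule subsetI)
      fix j assume j: "j \<in> support V C (\<pi> i)"
      then obtain j' where "j' \<in> V" "j = \<pi> j'" using \<pi> by (auto simp: bij_betw_def support_def)
      then show "j \<in> \<pi> ` support V B i" using j that eq by (auto simp: support_def)
    qed (use that eq \<pi>V in \<open>auto simp: support_def\<close>)
  qed
  have "finite (support V B i) \<and> support V B i \<noteq> {}" if "i \<in> V" for i
    using bij_betw_finite[OF supp[OF that]] supp[OF that] C \<pi>V[OF that]
    by (auto simp: row_finite_matrix_def bij_betw_def)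
  moreover have "zero_one_matrix V B"
    using C eq \<pi>V by (auto simp: row_finite_matrix_def zero_one_matrix_def)
  ultimately show B: "row_finite_matrix V B" by (simp add: row_finite_matrix_def)
  interpret G: wf_digraph "matrix_graph V B" by (rule wf_matrix_graph)
  interpret H: wf_digraph "matrix_graph V C" by (rule wf_matrix_graph)
  have \<pi>_inj: "inj_on \<pi> V" and \<pi>_surj: "\<pi> ` V = V" using \<pi> by (auto simp: bij_betw_def)
  let ?\<phi> = "\<lambda>(i, j). [(\<pi> i, \<pi> j)]"
  have "edge_substitution (matrix_graph V B) (matrix_graph V C) \<pi> ?\<phi> {}"
  proof unfold_locales
    show "bij_betw \<pi> (verts (matrix_graph V B)) (verts (matrix_graph V C))" using \<pi> by simp
    have "inj_on ?\<phi> (arcs (matrix_graph V B))"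
      using \<pi>_inj by (auto simp: inj_on_def matrix_graph_def)
    moreover have "?\<phi> ` arcs (matrix_graph V B) = {[f] |f. f \<in> arcs (matrix_graph V C)}"
    proof (rule subset_antisym; rule subsetI)
      fix l assume "l \<in> {[f] |f. f \<in> arcs (matrix_graph V C)}"
      then obtain i j where l: "l = [(i, j)]" "i \<in> V" "j \<in> V" "C i j = 1" by auto
      obtain i' j' where "i = \<pi> i'" "j = \<pi> j'" "i' \<in> V" "j' \<in> V" using l \<pi>_surj by (metis imageE)
      then show "l \<in> ?\<phi> ` arcs (matrix_graph V B)"
        using l eq by (intro image_eqI[of _ _ "(i', j')"]) auto
    qed (use eq \<pi>V in auto)
    ultimately show "bij_betw ?\<phi> (arcs (matrix_graph V B)) ({[f] |f. f \<in> arcs (matrix_graph V C) - {}} \<union>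
      {[a, b] |a b. a \<in> arcs (matrix_graph V C) \<inter> {} \<and> b \<in> arcs (matrix_graph V C) - {} \<and>
        head (matrix_graph V C) a = tail (matrix_graph V C) b})"
      by (simp add: bij_betw_def)
  qed auto
  then show "algebraically_equivalent a (matrix_graph V B) (matrix_graph V C)"
    by (rule algebraically_equivalent_substitution) (rule row_finite_matrix_graph; fact B C)+
qed

text \<open>As B has entries 0 and 1, the row equation says that the support of row p is the
  disjoint union of K and the supports of the rows in M. So an arc p -> j with j outside K belongs
  to exactly one m, and C has the arcs p -> m and m -> j, the latter because m differs from p and C
  keeps row m.\<close>

lemma primitive_transfer_equivalent:
  assumes "primitive_transfer V B C"
  shows "row_finite_matrix V B \<longleftrightarrow> row_finite_matrix V C"
    and "row_finite_matrix V B \<Longrightarrow> algebraically_equivalent a (matrix_graph V B) (matrix_graph V C)"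
proof -
  obtain p K M where p: "p \<in> V" and B01: "zero_one_matrix V B" and Bp: "\<not> zero_row V B p"
    and K: "finite K" "K \<subseteq> V" and M: "finite M" "M \<subseteq> V" and KM: "K \<inter> M = {}" and pM: "p \<notin> M"
    and sum: "\<And>j. j \<in> V \<Longrightarrow> B p j = (\<Sum>k\<in>K. if j = k then 1 else 0) + (\<Sum>m\<in>M. B m j)"
    and C_eq: "\<And>i j. i \<in> V \<Longrightarrow> i \<noteq> p \<Longrightarrow> j \<in> V \<Longrightarrow> C i j = B i j"
    and C_p: "\<And>j. j \<in> V \<Longrightarrow> C p j = (if j \<in> K \<union> M then 1 else 0)"
    using assms unfolding primitive_transfer_def primitive_transfer_at_def by auto
  have sum': "B p j = (if j \<in> K then 1 else 0) + (\<Sum>m\<in>M. B m j)" if "j \<in> V" for j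
    using sum[OF that] K(1) by (simp add: sum.delta')
  have le1: "B p j \<le> 1" if "j \<in> V" for j
    using B01 p that by (fastforce simp: zero_one_matrix_def)
  have M_unique: "\<exists>m\<in>M. B m j = 1 \<and> (\<forall>m'\<in>M. m \<noteq> m' \<longrightarrow> B m' j = 0)"
    if "j \<in> V" "j \<notin> K" "B p j = 1" for j
    using sum'[OF that(1)] that(2,3) sum_eq_1_iff[OF M(1), of "\<lambda>m. B m j"] by auto
  \<comment> \<open>The summand from K already exhausts the entry, which is at most 1.\<close>
  have K_row: "B p j = 1 \<and> (\<forall>m\<in>M. B m j = 0)" if "j \<in> K" for j
  proof -
    have "j \<in> V" using K that by blast
    then show ?thesis using sum'[of j] le1[of j] that M(1) by auto
  qed
  have M_row: "B p j = 1 \<and> j \<notin> K" if "m \<in> M" "B m j = 1" "j \<in> V" for m j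
  proof -
    have "j \<notin> K" using K_row that by fastforce
    moreover have "(\<Sum>m\<in>M. B m j) \<ge> B m j" using M(1) that(1) by (intro member_le_sum) auto
    ultimately show ?thesis using sum'[OF that(3)] le1[OF that(3)] that(2) by simp
  qed
  have supp: "support V C i = support V B i" if "i \<in> V" "i \<noteq> p" for i
    using C_eq[OF that] by (auto simp: support_def)
  have supp_C: "support V C p = K \<union> M" using C_p K M by (auto simp: support_def split: if_splits)
  have supp_B: "support V B p \<subseteq> K \<union> (\<Union>m\<in>M. support V B m)"
    using M_unique by (fastforce simp: support_def)
  have B_ne: "support V B p \<noteq> {}"
    using Bp B01 p by (fastforce simp: zero_row_def zero_one_matrix_def support_def)
  have C_ne: "K \<union> M \<noteq> {}" using supp_B B_ne by auto
  have "C i j \<in> {0, 1}" if "i \<in> V" "j \<in> V" for i j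
    using that C_eq[of i j] C_p[of j] B01 by (cases "i = p") (simp_all add: zero_one_matrix_def)
  then have C01: "zero_one_matrix V C" by (simp add: zero_one_matrix_def)
  \<comment> \<open>For the way back from C: row p of B is covered by K and finitely many other
    rows, which C shares with B.\<close>
  have fin: "finite (support V B p)" if "\<forall>i\<in>V. finite (support V C i)"
  proof (rule finite_subset[OF supp_B])
    have "finite (support V B m)" if m: "m \<in> M" for m
    proof -
      have "m \<in> V" "m \<noteq> p" using M pM m by auto
      then show ?thesis using supp[of m] \<open>\<forall>i\<in>V. finite (support V C i)\<close> by metis
    qed
    then show "finite (K \<union> (\<Union>m\<in>M. support V B m))" using K M by blast
  qed
  show iff: "row_finite_matrix V B \<longleftrightarrow> row_finite_matrix V C"
  proof
    assume B: "row_finite_matrix V B"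
    have "finite (support V C i) \<and> support V C i \<noteq> {}" if "i \<in> V" for i
      using B that supp[OF that] supp_C C_ne K(1) M(1)
      by (cases "i = p") (simp_all add: row_finite_matrix_def)
    then show "row_finite_matrix V C" using C01 by (simp add: row_finite_matrix_def)
  next
    assume C: "row_finite_matrix V C"
    have "finite (support V B i) \<and> support V B i \<noteq> {}" if "i \<in> V" for i
      using C that supp[OF that] fin B_ne unfolding row_finite_matrix_def by metis
    then show "row_finite_matrix V B" using B01 by (simp add: row_finite_matrix_def)
  qed
  define via where "via j = (SOME m. m \<in> M \<and> B m j = 1)" for j
  have via: "via j \<in> M \<and> B (via j) j = 1" if "j \<in> V" "j \<notin> K" "B p j = 1" for j
    unfolding via_def by (rule someI_ex) (use M_unique[OF that] in blast)
  have via_eq: "via j = m" if "m \<in> M" "B m j = 1" "j \<in> V" for m j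
  proof -
    have "j \<notin> K" "B p j = 1" using M_row[OF that] by auto
    then have "via j \<in> M \<and> B (via j) j = 1" "\<exists>m\<in>M. B m j = 1 \<and> (\<forall>m'\<in>M. m \<noteq> m' \<longrightarrow> B m' j = 0)"
      using via M_unique that(3) by auto
    then show ?thesis using that by (metis zero_neq_one)
  qed
  interpret G: wf_digraph "matrix_graph V B" by (rule wf_matrix_graph)
  interpret H: wf_digraph "matrix_graph V C" by (rule wf_matrix_graph)
  define \<phi> where "\<phi> = (\<lambda>(i, j). if i = p \<and> j \<notin> K then [(p, via j), (via j, j)] else [(i, j)])"
  \<comment> \<open>Of the arcs of C leaving p, those into K are blocks by themselves and those into
    M begin a block of two.\<close>
  define N where "N = Pair p ` M"
  let ?blocks = "{[f] |f. f \<in> arcs (matrix_graph V C) - N} \<union>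
      {[a, b] |a b. a \<in> arcs (matrix_graph V C) \<inter> N \<and> b \<in> arcs (matrix_graph V C) - N \<and>
        head (matrix_graph V C) a = tail (matrix_graph V C) b}"
  have "edge_substitution (matrix_graph V B) (matrix_graph V C) id \<phi> N"
  proof unfold_locales
    have inj: "inj_on \<phi> (arcs (matrix_graph V B))"
      by (auto simp: inj_on_def \<phi>_def split: if_splits)
    have arc: "\<phi> (i, j) \<in> ?blocks" if ij: "i \<in> V" "j \<in> V" "B i j = 1" for i j
    proof (cases "i = p \<and> j \<notin> K")
      case True
      then have m: "via j \<in> M" "B (via j) j = 1" using via ij by auto
      then have "via j \<in> V" "via j \<noteq> p" using M pM by auto
      then have "(p, via j) \<in> arcs (matrix_graph V C) \<inter> N" "(via j, j) \<in> arcs (matrix_graph V C) - N"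
        using m p ij C_p C_eq by (auto simp: N_def)
      then show ?thesis using True by (auto simp: \<phi>_def)
    next
      case False
      then have "(i, j) \<in> arcs (matrix_graph V C) - N"
        using ij C_p[of j] C_eq[of i j] KM by (cases "i = p") (auto simp: N_def)
      then show ?thesis using False by (auto simp: \<phi>_def)
    qed
    have single: "[f] \<in> \<phi> ` arcs (matrix_graph V B)" if fC: "f \<in> arcs (matrix_graph V C) - N" for f
    proof -
      obtain i j where f: "f = (i, j)" "i \<in> V" "j \<in> V" "C i j = 1" "(i, j) \<notin> N"
        using fC by (cases f) auto
      have "B i j = 1 \<and> \<not> (i = p \<and> j \<notin> K)"
      proof (cases "i = p")
        case True
        then have "j \<in> K \<union> M" using f(4) C_p[OF f(3)] by (metis zero_neq_one)
        moreover have "j \<notin> M" using f(5) True by (auto simp: N_def)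
        ultimately show ?thesis using True K_row[of j] by blast
      next
        case False
        then show ?thesis using f(4) C_eq[OF f(2) False f(3)] by simp
      qed
      then show ?thesis using f(2,3) unfolding f(1)
        by (intro image_eqI[of _ _ "(i, j)"]) (simp_all add: \<phi>_def)
    qed
    have double: "[a, b] \<in> \<phi> ` arcs (matrix_graph V B)"
      if arcs: "a \<in> arcs (matrix_graph V C) \<inter> N" "b \<in> arcs (matrix_graph V C) - N" "snd a = fst b" for a b
    proof -
      obtain m j where ab: "a = (p, m)" "m \<in> M" "b = (m, j)" "j \<in> V" "C m j = 1"
        using arcs by (cases b) (auto simp: N_def)
      have "m \<in> V" "m \<noteq> p" using ab(2) M pM by auto
      then have "B m j = 1" using ab(5) C_eq[of m j] ab(4) by simp
      then have "B p j = 1 \<and> j \<notin> K" "via j = m"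
        using M_row[OF ab(2) _ ab(4)] via_eq[OF ab(2) _ ab(4)] by simp_all
      then show ?thesis using ab(4) p unfolding ab(1,3)
        by (intro image_eqI[of _ _ "(p, j)"]) (simp_all add: \<phi>_def)
    qed
    have "\<phi> ` arcs (matrix_graph V B) = ?blocks"
    proof (rule subset_antisym)
      show "\<phi> ` arcs (matrix_graph V B) \<subseteq> ?blocks"
      proof (rule image_subsetI)
        fix e assume "e \<in> arcs (matrix_graph V B)"
        then show "\<phi> e \<in> ?blocks" using arc[of "fst e" "snd e"] by (cases e) simp
      qed
      show "?blocks \<subseteq> \<phi> ` arcs (matrix_graph V B)"
        unfolding matrix_graph_simps using single double by blast
    qed
    then show "bij_betw \<phi> (arcs (matrix_graph V B)) ?blocks" using inj by (simp add: bij_betw_def)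
  next
    \<comment> \<open>An arc in N ends in M, while every arc in N starts at p, which is outside
      M.\<close>
    fix a b assume "a \<in> N" "head (matrix_graph V C) a = tail (matrix_graph V C) b"
    then show "b \<notin> N" using pM by (auto simp: N_def)
  qed (auto simp: \<phi>_def)
  then show "algebraically_equivalent a (matrix_graph V B) (matrix_graph V C)"
    if "row_finite_matrix V B"
    using that iff row_finite_matrix_graph by (blast intro: algebraically_equivalent_substitution)
qed

lemma primitive_step_equivalent:
  assumes "primitive_step V D D'" and "row_finite_matrix V D'"
  shows "row_finite_matrix V D \<and> algebraically_equivalent a (matrix_graph V D) (matrix_graph V D')"
  using assms(1) unfolding primitive_step_def
proof (elim disjE)
  assume "primitive_transfer V D' D"
  then show ?thesis
    using primitive_transfer_equivalent assms(2) algebraically_equivalent_sym wf_matrix_graph by metis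
qed (use primitive_transfer_equivalent permutation_conjugate_equivalent assms(2) in metis)+

text \<open>The induction runs backwards because row-finiteness and the absence of zero rows are
  given at the end C of the chain.\<close>

lemma primitive_steps_equivalent:
  assumes "(primitive_step V)\<^sup>*\<^sup>* D C" and "row_finite_matrix V C"
  shows "row_finite_matrix V D \<and> algebraically_equivalent a (matrix_graph V D) (matrix_graph V C)"
  using assms(1)
proof (induct rule: converse_rtranclp_induct)
  case base
  then show ?case using assms(2) algebraically_equivalent_refl by blast
next
  case (step D D')
  then show ?case using primitive_step_equivalent algebraically_equivalent_trans by blast
qed

theorem corollary3p9:
  fixes E :: "('v, 'e) pre_digraph" and F :: "('w, 'f) pre_digraph"
  assumes "directed_graph E" and "row_finite E" and "no_sinks E"
    and "directed_graph F" and "primitively_equivalent F E"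
  shows "top_groupoid_isomorphic (path_groupoid E) (path_groupoid F) \<and>
    (\<forall>(A :: 'a cstar) (B :: 'a cstar).
       graph_cstar_algebra E A \<and> graph_cstar_algebra F B \<longrightarrow> cstar_isomorphic A B)"
proof -
  \<comment> \<open>The chain leads from the matrix of F to that of E, both indexed by
    \<open>verts F\<close>, so the end known to be row-finite is the right one.\<close>
  obtain h where h: "bij_betw h (verts F) (verts E)"
    and steps: "(primitive_step (verts F))\<^sup>*\<^sup>* (vertex_matrix F) (\<lambda>v w. vertex_matrix E (h v) (h w))"
    using assms(5) by (auto simp: primitively_equivalent_def primitively_equivalent_matrices_def)
  interpret E: indexed_graph E "verts F" h "\<lambda>v w. vertex_matrix E (h v) (h w)"
    using assms(1) h by (simp add: indexed_graph_def indexed_graph_axioms_def directed_graph_def)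
  interpret F: indexed_graph F "verts F" "\<lambda>v. v" "vertex_matrix F"
    using assms(4) by (simp add: indexed_graph_def indexed_graph_axioms_def directed_graph_def bij_betw_def)
  let ?a = "TYPE('a cstar)"
  note chain = primitive_steps_equivalent[OF steps, of ?a]
  have C: "row_finite_matrix (verts F) (\<lambda>v w. vertex_matrix E (h v) (h w))"
    using E.row_finite_matrix_iff assms(2,3) by blast
  \<comment> \<open>The chain also shows the matrix of F to be row-finite without zero rows, which
    the comparison of F with its matrix graph requires.\<close>
  have "algebraically_equivalent ?a F E"
    using chain[OF C] F.algebraically_equivalent_matrix_graph E.algebraically_equivalent_matrix_graph[OF C]
      algebraically_equivalent_sym[OF E.wf_digraph] algebraically_equivalent_trans by metis
  then have "algebraically_equivalent ?a E F" by (rule algebraically_equivalent_sym[OF F.wf_digraph])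
  then show ?thesis
    using graph_cstar_algebra_unique unfolding algebraically_equivalent_def by metis
qed

end
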